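(* Let $A_1\xrightarrow{\alpha_1}A_2\xrightarrow{\alpha_2}\cdots\xrightarrow{\alpha_{n-1}}A_n\xrightarrow{\alpha_n}A_{n+1}$ be a sequence of C*-algebras and C*-morphisms, and for $1\le j\le n$ let $T_j$ be the NC mapping cylindrical telescope of the first $j$ morphisms $\alpha_1,\dots,\alpha_j$. Then $K_0(A_1)\cong K_0(T_1)\cong\cdots\cong K_0(T_n)$.
   Context: C*-morphisms are $*$-homomorphisms. $\mathbb{I}=[0,1]$ and $\mathbb{I}A=C([0,1]\to A)$ for a C*-algebra $A$. The NC mapping cylindrical telescope of $A_1\xrightarrow{\alpha_1}\cdots\xrightarrow{\alpha_j}A_{j+1}$ is the C*-algebra $$T_j=\{a\oplus f_2\oplus\dots\oplus f_{j+1}\in A_1\oplus\mathbb{I}A_2\oplus\dots\oplus\mathbb{I}A_{j+1} : f_{k+1}(1)=\alpha_k\circ\alpha_{k-1}\circ\dots\circ\alpha_1(a),\ k=1,\dots,j\}.$$ $K_0$ denotes the usual $K_0$-group of a C*-algebra. *)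

theory Defs
  imports
    "HOL-Analysis.Analysis"
    "HOL-Algebra.Module"
    "HOL-Algebra.Coset"
    "Jordan_Normal_Form.Matrix"
begin

section \<open>C*-algebras\<close>

text \<open>
  Algebras are carrier-based records, so that a finite sequence of different C*-algebras can be
  treated as a family over one type. They need not be unital: the field \<open>one\<close>, inherited from
  the record \<open>module\<close>, is unconstrained, and no definition of \<open>K\<^sub>0\<close> below refers to it.
\<close>

record 'a star_alg = "(complex, 'a) module" +
  star :: "'a \<Rightarrow> 'a"

record 'a cstar_alg = "'a star_alg" +
  cnorm :: "'a \<Rightarrow> real"

definition complex_alg :: "complex star_alg" where
  "complex_alg = \<lparr>carrier = UNIV, mult = (*), one = 1, zero = 0, add = (+), smult = (*), star = cnj\<rparr>"

text \<open>
  The case distinction is there because the locale \<^locale>\<open>Metric_space\<close> demands symmetry and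
  nonnegativity on the whole type.
\<close>

definition cstar_dist :: "('a, 'm) cstar_alg_scheme \<Rightarrow> 'a \<Rightarrow> 'a \<Rightarrow> real" where
  "cstar_dist A x y = (if x \<in> carrier A \<and> y \<in> carrier A then cnorm A (x \<ominus>\<^bsub>A\<^esub> y) else 0)"

abbreviation cstar_topology :: "('a, 'm) cstar_alg_scheme \<Rightarrow> 'a topology" where
  "cstar_topology A \<equiv> Metric_space.mtopology (carrier A) (cstar_dist A)"

locale cstar_algebra = module complex_alg A for A :: "('a, 'm) cstar_alg_scheme" (structure) +
  assumes m_closed: "\<lbrakk>x \<in> carrier A; y \<in> carrier A\<rbrakk> \<Longrightarrow> x \<otimes> y \<in> carrier A"
    and m_assoc: "\<lbrakk>x \<in> carrier A; y \<in> carrier A; z \<in> carrier A\<rbrakk> \<Longrightarrow> (x \<otimes> y) \<otimes> z = x \<otimes> (y \<otimes> z)"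
    and l_distr: "\<lbrakk>x \<in> carrier A; y \<in> carrier A; z \<in> carrier A\<rbrakk> \<Longrightarrow> (x \<oplus> y) \<otimes> z = x \<otimes> z \<oplus> y \<otimes> z"
    and r_distr: "\<lbrakk>x \<in> carrier A; y \<in> carrier A; z \<in> carrier A\<rbrakk> \<Longrightarrow> z \<otimes> (x \<oplus> y) = z \<otimes> x \<oplus> z \<otimes> y"
    and smult_mult_l: "\<lbrakk>x \<in> carrier A; y \<in> carrier A\<rbrakk> \<Longrightarrow> (c \<odot> x) \<otimes> y = c \<odot> (x \<otimes> y)"
    and smult_mult_r: "\<lbrakk>x \<in> carrier A; y \<in> carrier A\<rbrakk> \<Longrightarrow> x \<otimes> (c \<odot> y) = c \<odot> (x \<otimes> y)"
    and star_closed: "x \<in> carrier A \<Longrightarrow> star A x \<in> carrier A"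
    and star_star: "x \<in> carrier A \<Longrightarrow> star A (star A x) = x"
    and star_add: "\<lbrakk>x \<in> carrier A; y \<in> carrier A\<rbrakk> \<Longrightarrow> star A (x \<oplus> y) = star A x \<oplus> star A y"
    and star_smult: "x \<in> carrier A \<Longrightarrow> star A (c \<odot> x) = cnj c \<odot> star A x"
    and star_mult: "\<lbrakk>x \<in> carrier A; y \<in> carrier A\<rbrakk> \<Longrightarrow> star A (x \<otimes> y) = star A y \<otimes> star A x"
    and cnorm_nonneg: "x \<in> carrier A \<Longrightarrow> 0 \<le> cnorm A x"
    and cnorm_eq_0_iff: "x \<in> carrier A \<Longrightarrow> cnorm A x = 0 \<longleftrightarrow> x = \<zero>"
    and cnorm_triangle: "\<lbrakk>x \<in> carrier A; y \<in> carrier A\<rbrakk> \<Longrightarrow> cnorm A (x \<oplus> y) \<le> cnorm A x + cnorm A y"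
    and cnorm_smult: "x \<in> carrier A \<Longrightarrow> cnorm A (c \<odot> x) = cmod c * cnorm A x"
    and cnorm_mult: "\<lbrakk>x \<in> carrier A; y \<in> carrier A\<rbrakk> \<Longrightarrow> cnorm A (x \<otimes> y) \<le> cnorm A x * cnorm A y"
    and cnorm_star_mult: "x \<in> carrier A \<Longrightarrow> cnorm A (star A x \<otimes> x) = (cnorm A x)\<^sup>2"
    and complete: "Metric_space.mcomplete (carrier A) (cstar_dist A)"

definition cstar_hom ::
    "('a, 'm) cstar_alg_scheme \<Rightarrow> ('b, 'n) cstar_alg_scheme \<Rightarrow> ('a \<Rightarrow> 'b) set" where
  "cstar_hom A B = {h \<in> hom A B \<inter> hom (add_monoid A) (add_monoid B).
     (\<forall>c. \<forall>x\<in>carrier A. h (c \<odot>\<^bsub>A\<^esub> x) = c \<odot>\<^bsub>B\<^esub> h x) \<and>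
     (\<forall>x\<in>carrier A. h (star A x) = star B (h x))}"


section \<open>The mapping cylindrical telescope\<close>

text \<open>
  Functions on \<open>[0,1]\<close> and finite families are extensional (\<^const>\<open>undefined\<close> outside their
  domain), so that equality of elements is equality in HOL.
\<close>

definition interval_alg :: "'a cstar_alg \<Rightarrow> (real \<Rightarrow> 'a) cstar_alg" where
  "interval_alg A = \<lparr>
     carrier = {f \<in> {0..1} \<rightarrow>\<^sub>E carrier A. continuous_map (top_of_set {0..1}) (cstar_topology A) f},
     mult = (\<lambda>f g. \<lambda>t\<in>{0..1}. f t \<otimes>\<^bsub>A\<^esub> g t),
     one = (\<lambda>t\<in>{0..1}. \<one>\<^bsub>A\<^esub>),
     zero = (\<lambda>t\<in>{0..1}. \<zero>\<^bsub>A\<^esub>),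
     add = (\<lambda>f g. \<lambda>t\<in>{0..1}. f t \<oplus>\<^bsub>A\<^esub> g t),
     smult = (\<lambda>c f. \<lambda>t\<in>{0..1}. c \<odot>\<^bsub>A\<^esub> f t),
     star = (\<lambda>f. \<lambda>t\<in>{0..1}. star A (f t)),
     cnorm = (\<lambda>f. SUP t\<in>{0..1}. cnorm A (f t))\<rparr>"

definition prod_alg :: "'a cstar_alg \<Rightarrow> 'b cstar_alg \<Rightarrow> ('a \<times> 'b) cstar_alg" where
  "prod_alg A B = \<lparr>
     carrier = carrier A \<times> carrier B,
     mult = (\<lambda>(a, b) (a', b'). (a \<otimes>\<^bsub>A\<^esub> a', b \<otimes>\<^bsub>B\<^esub> b')),
     one = (\<one>\<^bsub>A\<^esub>, \<one>\<^bsub>B\<^esub>),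
     zero = (\<zero>\<^bsub>A\<^esub>, \<zero>\<^bsub>B\<^esub>),
     add = (\<lambda>(a, b) (a', b'). (a \<oplus>\<^bsub>A\<^esub> a', b \<oplus>\<^bsub>B\<^esub> b')),
     smult = (\<lambda>c (a, b). (c \<odot>\<^bsub>A\<^esub> a, c \<odot>\<^bsub>B\<^esub> b)),
     star = (\<lambda>(a, b). (star A a, star B b)),
     cnorm = (\<lambda>(a, b). max (cnorm A a) (cnorm B b))\<rparr>"

definition direct_sum_alg :: "nat set \<Rightarrow> (nat \<Rightarrow> 'a cstar_alg) \<Rightarrow> (nat \<Rightarrow> 'a) cstar_alg" where
  "direct_sum_alg I B = \<lparr>
     carrier = (\<Pi>\<^sub>E k\<in>I. carrier (B k)),
     mult = (\<lambda>x y. \<lambda>k\<in>I. x k \<otimes>\<^bsub>B k\<^esub> y k),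
     one = (\<lambda>k\<in>I. \<one>\<^bsub>B k\<^esub>),
     zero = (\<lambda>k\<in>I. \<zero>\<^bsub>B k\<^esub>),
     add = (\<lambda>x y. \<lambda>k\<in>I. x k \<oplus>\<^bsub>B k\<^esub> y k),
     smult = (\<lambda>c x. \<lambda>k\<in>I. c \<odot>\<^bsub>B k\<^esub> x k),
     star = (\<lambda>x. \<lambda>k\<in>I. star (B k) (x k)),
     cnorm = (\<lambda>x. Max (insert 0 ((\<lambda>k. cnorm (B k) (x k)) ` I)))\<rparr>"

text \<open>\<open>comp_upto \<alpha> k = \<alpha> k \<circ> \<dots> \<circ> \<alpha> 1\<close>\<close>

primrec comp_upto :: "(nat \<Rightarrow> 'a \<Rightarrow> 'a) \<Rightarrow> nat \<Rightarrow> 'a \<Rightarrow> 'a" where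
  "comp_upto \<alpha> 0 = id"
| "comp_upto \<alpha> (Suc k) = \<alpha> (Suc k) \<circ> comp_upto \<alpha> k"

text \<open>
  An element \<open>a \<oplus> f\<^sub>2 \<oplus> \<dots> \<oplus> f\<^sub>j\<^sub>+\<^sub>1\<close> is the pair \<open>(a, f)\<close> with \<open>f\<close> a family indexed by
  \<open>{2..j+1}\<close>; the telescope inherits its operations and norm from the ambient direct sum.
\<close>

definition telescope ::
    "(nat \<Rightarrow> 'a cstar_alg) \<Rightarrow> (nat \<Rightarrow> 'a \<Rightarrow> 'a) \<Rightarrow> nat \<Rightarrow> ('a \<times> (nat \<Rightarrow> real \<Rightarrow> 'a)) cstar_alg" where
  "telescope A \<alpha> j =
    (let S = prod_alg (A 1) (direct_sum_alg {2..j+1} (\<lambda>k. interval_alg (A k)))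
     in S\<lparr>carrier := {(a, f) \<in> carrier S. \<forall>k\<in>{1..j}. f (k+1) 1 = comp_upto \<alpha> k a}\<rparr>)"


section \<open>The group \<open>K\<^sub>0\<close>\<close>

text \<open>
  Projections and their Murray-von Neumann equivalence refer to the *-algebra structure only, so no
  norms are put on unitizations and matrix algebras. Matrices are those of
  \<^theory>\<open>Jordan_Normal_Form.Matrix\<close>, whose entry type is arbitrary; the library's matrix arithmetic
  needs type classes and is replaced by operations over the record.
\<close>

definition mat_over :: "('a, 'm) star_alg_scheme \<Rightarrow> nat \<Rightarrow> nat \<Rightarrow> 'a mat set" where
  "mat_over R m n = {P \<in> carrier_mat m n. elements_mat P \<subseteq> carrier R}"

definition mat_mult :: "('a, 'm) star_alg_scheme \<Rightarrow> 'a mat \<Rightarrow> 'a mat \<Rightarrow> 'a mat" where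
  "mat_mult R P Q = mat (dim_row P) (dim_col Q)
     (\<lambda>(i, j). \<Oplus>\<^bsub>R\<^esub>k\<in>{..<dim_col P}. P $$ (i, k) \<otimes>\<^bsub>R\<^esub> Q $$ (k, j))"

definition mat_star :: "('a, 'm) star_alg_scheme \<Rightarrow> 'a mat \<Rightarrow> 'a mat" where
  "mat_star R P = map_mat (star R) (transpose_mat P)"

definition mat_zero :: "('a, 'm) star_alg_scheme \<Rightarrow> nat \<Rightarrow> nat \<Rightarrow> 'a mat" where
  "mat_zero R m n = mat m n (\<lambda>_. \<zero>\<^bsub>R\<^esub>)"

definition mat_dsum :: "('a, 'm) star_alg_scheme \<Rightarrow> 'a mat \<Rightarrow> 'a mat \<Rightarrow> 'a mat" where
  "mat_dsum R P Q = four_block_mat P (mat_zero R (dim_row P) (dim_col Q))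
                                   (mat_zero R (dim_row Q) (dim_col P)) Q"

text \<open>Projections in \<open>M\<^sub>n(R)\<close> for all \<open>n \<ge> 1\<close> together; the size is part of the matrix.\<close>

definition projections :: "('a, 'm) star_alg_scheme \<Rightarrow> 'a mat set" where
  "projections R = {p. \<exists>n\<ge>1. p \<in> mat_over R n n \<and> mat_star R p = p \<and> mat_mult R p p = p}"

definition mvn_rel :: "('a, 'm) star_alg_scheme \<Rightarrow> ('a mat \<times> 'a mat) set" where
  "mvn_rel R = {(p, q). p \<in> projections R \<and> q \<in> projections R \<and>
     (\<exists>v \<in> mat_over R (dim_row q) (dim_row p).
        p = mat_mult R (mat_star R v) v \<and> q = mat_mult R v (mat_star R v))}"

definition proj_monoid :: "('a, 'm) star_alg_scheme \<Rightarrow> 'a mat set monoid" where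
  "proj_monoid R = \<lparr>
     carrier = projections R // mvn_rel R,
     mult = (\<lambda>X Y. \<Union>p\<in>X. \<Union>q\<in>Y. mvn_rel R `` {mat_dsum R p q}),
     one = mvn_rel R `` {mat_zero R 1 1}\<rparr>"

definition proj_monoid_map ::
    "('b, 'n) star_alg_scheme \<Rightarrow> ('a \<Rightarrow> 'b) \<Rightarrow> 'a mat set \<Rightarrow> 'b mat set" where
  "proj_monoid_map R' h X = (\<Union>p\<in>X. mvn_rel R' `` {map_mat h p})"

text \<open>
  The Grothendieck group of a commutative monoid; the class of \<open>(x, y)\<close> is the formal difference
  \<open>x - y\<close>. The summand \<open>z\<close> is needed because the monoid need not be cancellative.
\<close>

definition groth_rel :: "'a monoid \<Rightarrow> (('a \<times> 'a) \<times> ('a \<times> 'a)) set" where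
  "groth_rel S = {((x, y), (x', y')).
     x \<in> carrier S \<and> y \<in> carrier S \<and> x' \<in> carrier S \<and> y' \<in> carrier S \<and>
     (\<exists>z \<in> carrier S. x \<otimes>\<^bsub>S\<^esub> y' \<otimes>\<^bsub>S\<^esub> z = x' \<otimes>\<^bsub>S\<^esub> y \<otimes>\<^bsub>S\<^esub> z)}"

definition groth_group :: "'a monoid \<Rightarrow> ('a \<times> 'a) set monoid" where
  "groth_group S = \<lparr>
     carrier = (carrier S \<times> carrier S) // groth_rel S,
     mult = (\<lambda>X Y. \<Union>(x, y)\<in>X. \<Union>(x', y')\<in>Y. groth_rel S `` {(x \<otimes>\<^bsub>S\<^esub> x', y \<otimes>\<^bsub>S\<^esub> y')}),
     one = groth_rel S `` {(\<one>\<^bsub>S\<^esub>, \<one>\<^bsub>S\<^esub>)}\<rparr>"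

definition groth_map :: "'b monoid \<Rightarrow> ('a \<Rightarrow> 'b) \<Rightarrow> ('a \<times> 'a) set \<Rightarrow> ('b \<times> 'b) set" where
  "groth_map S' h X = (\<Union>(x, y)\<in>X. groth_rel S' `` {(h x, h y)})"

text \<open>\<open>K\<^sub>0\<^sub>0\<close>: the Grothendieck group of the projections over a unital *-algebra, and its functoriality.\<close>

definition K00 :: "('a, 'm) star_alg_scheme \<Rightarrow> ('a mat set \<times> 'a mat set) set monoid" where
  "K00 R = groth_group (proj_monoid R)"

definition K00_map :: "('b, 'n) star_alg_scheme \<Rightarrow> ('a \<Rightarrow> 'b) \<Rightarrow>
    ('a mat set \<times> 'a mat set) set \<Rightarrow> ('b mat set \<times> 'b mat set) set" where
  "K00_map R' h = groth_map (proj_monoid R') (proj_monoid_map R' h)"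

text \<open>The pair \<open>(a, c)\<close> stands for \<open>a + c\<cdot>1\<close>; a new unit is adjoined even if \<open>A\<close> already has one.\<close>

definition unitization :: "('a, 'm) star_alg_scheme \<Rightarrow> ('a \<times> complex) star_alg" where
  "unitization A = \<lparr>
     carrier = carrier A \<times> UNIV,
     mult = (\<lambda>(a, c) (b, d). (a \<otimes>\<^bsub>A\<^esub> b \<oplus>\<^bsub>A\<^esub> d \<odot>\<^bsub>A\<^esub> a \<oplus>\<^bsub>A\<^esub> c \<odot>\<^bsub>A\<^esub> b, c * d)),
     one = (\<zero>\<^bsub>A\<^esub>, 1),
     zero = (\<zero>\<^bsub>A\<^esub>, 0),
     add = (\<lambda>(a, c) (b, d). (a \<oplus>\<^bsub>A\<^esub> b, c + d)),
     smult = (\<lambda>e (a, c). (e \<odot>\<^bsub>A\<^esub> a, e * c)),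
     star = (\<lambda>(a, c). (star A a, cnj c))\<rparr>"

text \<open>
  \<open>K\<^sub>0(A)\<close> is the kernel of the map \<open>K\<^sub>0\<^sub>0(A\<^sup>+) \<rightarrow> K\<^sub>0\<^sub>0(\<complex>)\<close> induced by the projection
  \<open>A\<^sup>+ \<rightarrow> \<complex>\<close> of the unitization. This is the standard definition covering unital and non-unital
  algebras at once; for unital \<open>A\<close> the kernel is isomorphic to \<open>K\<^sub>0\<^sub>0(A)\<close>.
\<close>

definition K0 :: "('a, 'm) star_alg_scheme \<Rightarrow>
    (('a \<times> complex) mat set \<times> ('a \<times> complex) mat set) set monoid" where
  "K0 A = (K00 (unitization A))
     \<lparr>carrier := kernel (K00 (unitization A)) (K00 complex_alg) (K00_map complex_alg snd)\<rparr>"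

end

theory Submission
  imports
    Defs
    "HOL-Algebra.Ideal"
begin

text \<open>
  Forgetting the last function is a retraction of the telescope \<open>T\<^sub>j\<^sub>+\<^sub>1\<close> onto \<open>T\<^sub>j\<close>: a section adds the
  constant function whose value is the image of the first coordinate \<open>a\<close>. In the same way \<open>A\<^sub>1\<close> is a
  retract of \<open>T\<^sub>1\<close>. The other composite, section after retraction, replaces functions by the constants
  that they end in, and it is joined to the identity by sliding: the endomorphism with parameter \<open>u\<close>
  turns \<open>f\<close> into \<open>t \<mapsto> f (max t u)\<close>. The value at \<open>1\<close> is all that the telescope prescribes, and sliding
  keeps it. So the theorem is an instance of the homotopy invariance of \<open>K\<^sub>0\<close>.

  Homotopy invariance rests on the fact that projections \<open>p\<close>, \<open>q\<close> which are close in norm are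
  Murray-von Neumann equivalent (\<open>close_projections\<close>). The element \<open>h = (p - q)\<^sup>2\<close> commutes with both,
  and \<open>p q p = p (1 - h)\<close>. If \<open>y\<close> is an inverse square root of \<open>1 - h\<close>, then \<open>v = y q p\<close> satisfies
  \<open>v\<^sup>* v = p\<close> and \<open>v v\<^sup>* = q\<close>. The inverse square root is found as the fixed point of a contraction. This
  takes a complete submultiplicative norm with isometric involution and no functional calculus; such
  norms are \<open>\<parallel>a\<parallel> + |c|\<close> on a unitization and the sum of the norms of the entries on matrices. A homotopy
  is then cut into finitely many short steps (\<open>homotopic_projections_mvn\<close>).

  The contraction is set up inside an ideal. That the telescope is complete would depend on the
  automatic continuity of *-homomorphisms, since its end condition involves the \<open>\<alpha>\<^sub>k\<close>. But sliding does
  not move the first coordinate, so the differences \<open>p - q\<close> that occur have entries in the ideal of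
  elements with first coordinate zero. There the end condition says that all functions vanish at \<open>1\<close>,
  which visibly survives uniform limits (\<open>end_ideal_complete\<close>).

  To pass from projections to \<open>K\<^sub>0\<close>, note that a retraction with these properties gives a bijection
  between the classes of projections that respects direct sums and scalar parts. The Grothendieck
  group and the kernel that defines \<open>K\<^sub>0\<close> are built from these data alone, so they are carried over as
  they stand (\<open>K0_iso_deformation_retract\<close>).
\<close>

section \<open>Rings with involution\<close>

locale star_ring = ring R for R :: "('a, 'm) star_alg_scheme" (structure) +
  assumes star_closed [simp, intro]: "x \<in> carrier R \<Longrightarrow> star R x \<in> carrier R"
    and star_star [simp]: "x \<in> carrier R \<Longrightarrow> star R (star R x) = x"
    and star_add: "\<lbrakk>x \<in> carrier R; y \<in> carrier R\<rbrakk> \<Longrightarrow> star R (x \<oplus> y) = star R x \<oplus> star R y"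
    and star_mult: "\<lbrakk>x \<in> carrier R; y \<in> carrier R\<rbrakk> \<Longrightarrow> star R (x \<otimes> y) = star R y \<otimes> star R x"
begin

lemma star_zero [simp]: "star R \<zero> = \<zero>"
  using star_add[of \<zero> \<zero>] by (metis add.l_cancel_one' l_zero star_closed zero_closed)

lemma star_one [simp]: "star R \<one> = \<one>"
  using star_mult[of "star R \<one>" \<one>] by (metis one_closed r_one l_one star_closed star_star)

lemma star_minus: "x \<in> carrier R \<Longrightarrow> star R (\<ominus> x) = \<ominus> star R x"
  by (metis a_inv_closed add.inv_equality l_neg star_add star_closed star_zero)

lemma star_diff:
  "\<lbrakk>x \<in> carrier R; y \<in> carrier R\<rbrakk> \<Longrightarrow> star R (x \<ominus> y) = star R x \<ominus> star R y"
  by (simp add: minus_eq star_add star_minus)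

lemma star_finsum:
  assumes "f \<in> S \<rightarrow> carrier R"
  shows "star R (\<Oplus>k\<in>S. f k) = (\<Oplus>k\<in>S. star R (f k))"
  using assms
proof (induction S rule: infinite_finite_induct)
  case (insert x S)
  then have "f x \<in> carrier R" "f \<in> S \<rightarrow> carrier R"
    by auto
  moreover from this have "(\<lambda>k. star R (f k)) \<in> S \<rightarrow> carrier R"
    by auto
  ultimately show ?case
    using insert by (simp add: star_add)
qed auto

end

lemma (in abelian_monoid) finsum_swap:
  assumes "finite S" "finite T" "\<And>a b. \<lbrakk>a \<in> S; b \<in> T\<rbrakk> \<Longrightarrow> f a b \<in> carrier G"
  shows "(\<Oplus>a\<in>S. \<Oplus>b\<in>T. f a b) = (\<Oplus>b\<in>T. \<Oplus>a\<in>S. f a b)"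
  using assms(1,3)
proof (induction S)
  case (insert x S)
  have "(\<Oplus>a\<in>insert x S. \<Oplus>b\<in>T. f a b) = (\<Oplus>b\<in>T. f x b) \<oplus> (\<Oplus>b\<in>T. \<Oplus>a\<in>S. f a b)"
    using insert by (subst finsum_insert) (auto intro!: finsum_closed)
  also have "\<dots> = (\<Oplus>b\<in>T. f x b \<oplus> (\<Oplus>a\<in>S. f a b))"
    using insert.prems by (intro finsum_addf[symmetric]) (auto intro!: finsum_closed)
  also have "\<dots> = (\<Oplus>b\<in>T. \<Oplus>a\<in>insert x S. f a b)"
    using insert by (intro finsum_cong') (auto intro!: finsum_closed finsum_insert[symmetric])
  finally show ?case .
qed (simp add: finsum_zero)

section \<open>Matrices over a ring with involution\<close>

lemma mat_over_iff:
  "P \<in> mat_over R m n \<longleftrightarrow>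
     dim_row P = m \<and> dim_col P = n \<and> (\<forall>i<m. \<forall>j<n. P $$ (i, j) \<in> carrier R)"
  unfolding mat_over_def by (fastforce simp: elements_mat_def)

lemma mat_over_dims: "P \<in> mat_over R m n \<Longrightarrow> dim_row P = m \<and> dim_col P = n"
  by (simp add: mat_over_iff)

lemma mat_mult_dims [simp]:
  "dim_row (mat_mult R P Q) = dim_row P" "dim_col (mat_mult R P Q) = dim_col Q"
  by (simp_all add: mat_mult_def)

lemma mat_mult_index [simp]:
  "\<lbrakk>i < dim_row P; j < dim_col Q\<rbrakk> \<Longrightarrow>
     mat_mult R P Q $$ (i, j) = (\<Oplus>\<^bsub>R\<^esub>k\<in>{..<dim_col P}. P $$ (i, k) \<otimes>\<^bsub>R\<^esub> Q $$ (k, j))"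
  by (simp add: mat_mult_def)

lemma mat_star_dims [simp]:
  "dim_row (mat_star R P) = dim_col P" "dim_col (mat_star R P) = dim_row P"
  by (simp_all add: mat_star_def)

lemma mat_star_index [simp]:
  "\<lbrakk>i < dim_col P; j < dim_row P\<rbrakk> \<Longrightarrow> mat_star R P $$ (i, j) = star R (P $$ (j, i))"
  by (simp add: mat_star_def)

lemma mat_zero_dims [simp]: "dim_row (mat_zero R m n) = m" "dim_col (mat_zero R m n) = n"
  by (simp_all add: mat_zero_def)

lemma mat_zero_index [simp]: "\<lbrakk>i < m; j < n\<rbrakk> \<Longrightarrow> mat_zero R m n $$ (i, j) = \<zero>\<^bsub>R\<^esub>"
  by (simp add: mat_zero_def)

lemma mat_dsum_dims [simp]:
  "dim_row (mat_dsum R P Q) = dim_row P + dim_row Q"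
  "dim_col (mat_dsum R P Q) = dim_col P + dim_col Q"
  by (simp_all add: mat_dsum_def)

lemma mat_dsum_index:
  "\<lbrakk>i < dim_row P + dim_row Q; j < dim_col P + dim_col Q\<rbrakk> \<Longrightarrow>
     mat_dsum R P Q $$ (i, j) =
       (if i < dim_row P then if j < dim_col P then P $$ (i, j) else \<zero>\<^bsub>R\<^esub>
        else if j < dim_col P then \<zero>\<^bsub>R\<^esub> else Q $$ (i - dim_row P, j - dim_col P))"
  unfolding mat_dsum_def by (subst index_mat_four_block) auto

context star_ring
begin

lemma mat_mult_closed:
  assumes "P \<in> mat_over R m n" "Q \<in> mat_over R n k"
  shows "mat_mult R P Q \<in> mat_over R m k"
  using assms by (auto simp: mat_over_iff intro!: finsum_closed)

lemma mat_mult_assoc: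
  assumes P: "P \<in> mat_over R m n" and Q: "Q \<in> mat_over R n k" and S: "S \<in> mat_over R k l"
  shows "mat_mult R (mat_mult R P Q) S = mat_mult R P (mat_mult R Q S)"
proof (rule eq_matI)
  fix i j
  assume ij: "i < dim_row (mat_mult R P (mat_mult R Q S))"
    "j < dim_col (mat_mult R P (mat_mult R Q S))"
  let ?t = "\<lambda>a b. P $$ (i, a) \<otimes> Q $$ (a, b) \<otimes> S $$ (b, j)"
  have t: "?t a b \<in> carrier R" if "a < n" "b < k" for a b
    using that assms ij by (auto simp: mat_over_iff)
  have "mat_mult R (mat_mult R P Q) S $$ (i, j) =
      (\<Oplus>b\<in>{..<k}. (\<Oplus>a\<in>{..<n}. P $$ (i, a) \<otimes> Q $$ (a, b)) \<otimes> S $$ (b, j))"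
    using assms ij by (auto simp: mat_over_iff intro!: finsum_cong' finsum_closed)
  also have "\<dots> = (\<Oplus>b\<in>{..<k}. \<Oplus>a\<in>{..<n}. ?t a b)"
    using assms ij
    by (intro finsum_cong' refl finsum_ldistr) (auto simp: mat_over_iff intro!: finsum_closed)
  also have "\<dots> = (\<Oplus>a\<in>{..<n}. \<Oplus>b\<in>{..<k}. ?t a b)"
    by (rule finsum_swap) (auto simp: t)
  also have "\<dots> = (\<Oplus>a\<in>{..<n}. \<Oplus>b\<in>{..<k}. P $$ (i, a) \<otimes> (Q $$ (a, b) \<otimes> S $$ (b, j)))"
    using assms ij
    by (intro finsum_cong' refl m_assoc) (auto simp: mat_over_iff intro!: finsum_closed)
  also have "\<dots> = (\<Oplus>a\<in>{..<n}. P $$ (i, a) \<otimes> (\<Oplus>b\<in>{..<k}. Q $$ (a, b) \<otimes> S $$ (b, j)))"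
    using assms ij
    by (intro finsum_cong' refl finsum_rdistr[symmetric])
      (auto simp: mat_over_iff intro!: finsum_closed)
  also have "\<dots> = mat_mult R P (mat_mult R Q S) $$ (i, j)"
    using assms ij by (auto simp: mat_over_iff intro!: finsum_cong' finsum_closed)
  finally show "mat_mult R (mat_mult R P Q) S $$ (i, j) = mat_mult R P (mat_mult R Q S) $$ (i, j)" .
qed auto

lemma mat_star_closed: "P \<in> mat_over R m n \<Longrightarrow> mat_star R P \<in> mat_over R n m"
  by (auto simp: mat_over_iff)

lemma mat_star_star: "P \<in> mat_over R m n \<Longrightarrow> mat_star R (mat_star R P) = P"
  by (rule eq_matI) (auto simp: mat_over_iff)

lemma mat_star_mult:
  assumes "P \<in> mat_over R m n" "Q \<in> mat_over R n k"
  shows "mat_star R (mat_mult R P Q) = mat_mult R (mat_star R Q) (mat_star R P)"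
  using assms
  by (intro eq_matI)
    (auto simp: mat_over_iff star_mult Pi_iff star_finsum intro!: finsum_cong')

lemma mat_dsum_closed:
  assumes "P \<in> mat_over R m n" "Q \<in> mat_over R m' n'"
  shows "mat_dsum R P Q \<in> mat_over R (m + m') (n + n')"
  using assms by (auto simp: mat_over_iff mat_dsum_index)

lemma mat_star_dsum:
  "mat_star R (mat_dsum R P Q) = mat_dsum R (mat_star R P) (mat_star R Q)"
  by (intro eq_matI) (auto simp: mat_dsum_index)

lemma mat_mult_dsum:
  assumes P: "P \<in> mat_over R m n" and P': "P' \<in> mat_over R n k"
    and Q: "Q \<in> mat_over R m' n'" and Q': "Q' \<in> mat_over R n' k'"
  shows "mat_mult R (mat_dsum R P Q) (mat_dsum R P' Q') =
         mat_dsum R (mat_mult R P P') (mat_mult R Q Q')"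
    (is "?L = ?M")
proof (rule eq_matI)
  note d = mat_over_dims[OF P] mat_over_dims[OF P'] mat_over_dims[OF Q] mat_over_dims[OF Q']
  fix i j
  assume "i < dim_row ?M" "j < dim_col ?M"
  then have i: "i < m + m'" and j: "j < k + k'"
    using d by auto
  let ?f = "\<lambda>a. mat_dsum R P Q $$ (i, a) \<otimes> mat_dsum R P' Q' $$ (a, j)"
  have f: "?f a \<in> carrier R" if "a < n + n'" for a
    using that i j mat_dsum_closed[OF P Q] mat_dsum_closed[OF P' Q'] by (auto simp: mat_over_iff)
  have L: "?L $$ (i, j) = (\<Oplus>a\<in>{..<n + n'}. ?f a)"
    using i j d by simp
  show "?L $$ (i, j) = ?M $$ (i, j)"
  proof (cases "i < m")
    case True
    have "(\<Oplus>a\<in>{..<n + n'}. ?f a) =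
        (\<Oplus>a\<in>{..<n}. if j < k then P $$ (i, a) \<otimes> P' $$ (a, j) else \<zero>)"
    proof (rule add.finprod_mono_neutral_cong_right)
      show "?f \<in> {..<n + n'} \<rightarrow> carrier R"
        using f by auto
    qed (use i j True d P P' Q' in \<open>auto simp: mat_dsum_index mat_over_iff\<close>)
    also have "\<dots> = ?M $$ (i, j)"
      using i j True d by (auto simp: mat_dsum_index finsum_zero)
    finally show ?thesis
      using L by simp
  next
    case False
    have "(\<Oplus>a\<in>{..<n + n'}. ?f a) = (\<Oplus>a\<in>(+) n ` {..<n'}. ?f a)"
    proof (rule add.finprod_mono_neutral_cong_right)
      show "?f \<in> {..<n + n'} \<rightarrow> carrier R"
        using f by auto
      fix a
      assume "a \<in> {..<n + n'} - (+) n ` {..<n'}"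
      then have "a < n"
        by (metis DiffE add_diff_cancel_left' imageI le_add_diff_inverse less_diff_conv2
            lessThan_iff linorder_not_less add.commute)
      then show "?f a = \<zero>"
        using i j False d P' by (auto simp: mat_dsum_index mat_over_iff)
    qed auto
    also have "\<dots> = (\<Oplus>a\<in>{..<n'}. ?f (n + a))"
      using f by (subst add.finprod_reindex) auto
    also have "\<dots> = (\<Oplus>a\<in>{..<n'}. if j < k then \<zero> else Q $$ (i - m, a) \<otimes> Q' $$ (a, j - k))"
      using i j False d Q Q' by (intro finsum_cong') (auto simp: mat_dsum_index mat_over_iff)
    also have "\<dots> = ?M $$ (i, j)"
      using i j False d by (auto simp: mat_dsum_index finsum_zero)
    finally show ?thesis
      using L by simp
  qed
qed (use mat_over_dims[OF P] mat_over_dims[OF P'] mat_over_dims[OF Q] mat_over_dims[OF Q'] in auto)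

section \<open>Murray-von Neumann equivalence\<close>

lemma projectionsE:
  assumes "p \<in> projections R"
  obtains n where "n \<ge> 1" "p \<in> mat_over R n n" "mat_star R p = p" "mat_mult R p p = p"
    "dim_row p = n" "dim_col p = n"
  using assms unfolding projections_def by (auto simp: mat_over_iff)

lemma mvn_relI:
  assumes "p \<in> projections R" "q \<in> projections R" "v \<in> mat_over R (dim_row q) (dim_row p)"
    "p = mat_mult R (mat_star R v) v" "q = mat_mult R v (mat_star R v)"
  shows "(p, q) \<in> mvn_rel R"
  using assms unfolding mvn_rel_def by blast

lemma mvn_relE:
  assumes "(p, q) \<in> mvn_rel R"
  obtains v where "p \<in> projections R" "q \<in> projections R"
    "v \<in> mat_over R (dim_row q) (dim_row p)"
    "mat_mult R (mat_star R v) v = p" "mat_mult R v (mat_star R v) = q"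
  using assms unfolding mvn_rel_def by force

text \<open>
  For transitivity: if \<open>v\<close> implements \<open>p \<sim> q\<close> and \<open>w\<close> implements \<open>q \<sim> r\<close>, then \<open>w v\<close> implements \<open>p \<sim> r\<close>,
  because \<open>w\<^sup>* w v = q v = v v\<^sup>* v = v p\<close> and symmetrically \<open>v v\<^sup>* w\<^sup>* = w\<^sup>* r\<close>.
\<close>

lemma mvn_equiv: "equiv (projections R) (mvn_rel R)"
proof (rule equivI)
  show "mvn_rel R \<subseteq> projections R \<times> projections R"
    unfolding mvn_rel_def by auto
  show "refl_on (projections R) (mvn_rel R)"
  proof (rule refl_onI)
    fix p
    assume "p \<in> projections R"
    then show "(p, p) \<in> mvn_rel R"
      using projectionsE[OF \<open>p \<in> projections R\<close>] by (metis mvn_relI)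
  qed
  show "sym (mvn_rel R)"
  proof (rule symI)
    fix p q
    assume "(p, q) \<in> mvn_rel R"
    then show "(q, p) \<in> mvn_rel R"
      by (elim mvn_relE, intro mvn_relI) (auto intro: mat_star_closed simp: mat_star_star)
  qed
  show "trans (mvn_rel R)"
  proof (rule transI)
    fix p q r
    assume "(p, q) \<in> mvn_rel R" "(q, r) \<in> mvn_rel R"
    then obtain v w where pqr: "p \<in> projections R" "q \<in> projections R" "r \<in> projections R"
      and v: "v \<in> mat_over R (dim_row q) (dim_row p)"
        "mat_mult R (mat_star R v) v = p" "mat_mult R v (mat_star R v) = q"
      and w: "w \<in> mat_over R (dim_row r) (dim_row q)"
        "mat_mult R (mat_star R w) w = q" "mat_mult R w (mat_star R w) = r"
      by (auto elim!: mvn_relE)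
    note vs = mat_star_closed[OF v(1)] and ws = mat_star_closed[OF w(1)]
    let ?u = "mat_mult R w v"
    have us: "mat_star R ?u = mat_mult R (mat_star R v) (mat_star R w)"
      using mat_star_mult[OF w(1) v(1)] .
    have pp: "mat_mult R p p = p" and rr: "mat_mult R r r = r"
      using pqr by (auto elim!: projectionsE)
    have "mat_mult R (mat_star R ?u) ?u =
        mat_mult R (mat_star R v) (mat_mult R (mat_star R w) (mat_mult R w v))"
      unfolding us by (rule mat_mult_assoc[OF vs ws mat_mult_closed[OF w(1) v(1)]])
    also have "mat_mult R (mat_star R w) (mat_mult R w v) = mat_mult R q v"
      using mat_mult_assoc[OF ws w(1) v(1)] w(2) by simp
    also have "mat_mult R q v = mat_mult R v p"
      using mat_mult_assoc[OF v(1) vs v(1)] v(2,3) by simp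
    also have "mat_mult R (mat_star R v) (mat_mult R v p) = p"
      using mat_mult_assoc[OF vs v(1) mat_mult_closed[OF vs v(1)]] v(2) pp by simp
    finally have 1: "mat_mult R (mat_star R ?u) ?u = p" .
    have "mat_mult R ?u (mat_star R ?u) =
        mat_mult R w (mat_mult R v (mat_mult R (mat_star R v) (mat_star R w)))"
      unfolding us by (rule mat_mult_assoc[OF w(1) v(1) mat_mult_closed[OF vs ws]])
    also have "mat_mult R v (mat_mult R (mat_star R v) (mat_star R w)) = mat_mult R q (mat_star R w)"
      using mat_mult_assoc[OF v(1) vs ws] v(3) by simp
    also have "\<dots> = mat_mult R (mat_star R w) r"
      using mat_mult_assoc[OF ws w(1) ws] w(2,3) by simp
    also have "mat_mult R w (mat_mult R (mat_star R w) r) = r"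
      using mat_mult_assoc[OF w(1) ws mat_mult_closed[OF w(1) ws]] w(3) rr by simp
    finally have 2: "mat_mult R ?u (mat_star R ?u) = r" .
    show "(p, r) \<in> mvn_rel R"
      by (rule mvn_relI[OF pqr(1,3) mat_mult_closed[OF w(1) v(1)] 1[symmetric] 2[symmetric]])
  qed
qed

lemma dsum_projection:
  assumes "p \<in> projections R" "q \<in> projections R"
  shows "mat_dsum R p q \<in> projections R"
proof -
  from assms obtain m n where p: "m \<ge> 1" "p \<in> mat_over R m m" "mat_star R p = p" "mat_mult R p p = p"
    and q: "q \<in> mat_over R n n" "mat_star R q = q" "mat_mult R q q = q"
    by (auto elim!: projectionsE)
  have "mat_dsum R p q \<in> mat_over R (m + n) (m + n)" "m + n \<ge> 1"
    using mat_dsum_closed[OF p(2) q(1)] p(1) by auto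
  then show ?thesis
    using mat_mult_dsum[OF p(2) p(2) q(1) q(1)] p(3,4) q(2,3)
    unfolding projections_def by (auto simp: mat_star_dsum)
qed

lemma mvn_rel_dsum:
  assumes "(p, p') \<in> mvn_rel R" "(q, q') \<in> mvn_rel R"
  shows "(mat_dsum R p q, mat_dsum R p' q') \<in> mvn_rel R"
proof -
  obtain v where v: "p \<in> projections R" "p' \<in> projections R"
      "v \<in> mat_over R (dim_row p') (dim_row p)"
      "mat_mult R (mat_star R v) v = p" "mat_mult R v (mat_star R v) = p'"
    using assms(1) by (rule mvn_relE)
  obtain w where w: "q \<in> projections R" "q' \<in> projections R"
      "w \<in> mat_over R (dim_row q') (dim_row q)"
      "mat_mult R (mat_star R w) w = q" "mat_mult R w (mat_star R w) = q'"
    using assms(2) by (rule mvn_relE)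
  note vs = mat_star_closed[OF v(3)] and ws = mat_star_closed[OF w(3)]
  show ?thesis
  proof (rule mvn_relI)
    show "mat_dsum R p q \<in> projections R" "mat_dsum R p' q' \<in> projections R"
      using v w by (auto intro: dsum_projection)
    show "mat_dsum R v w \<in> mat_over R (dim_row (mat_dsum R p' q')) (dim_row (mat_dsum R p q))"
      using mat_dsum_closed[OF v(3) w(3)] by simp
    show "mat_dsum R p q = mat_mult R (mat_star R (mat_dsum R v w)) (mat_dsum R v w)"
      using mat_mult_dsum[OF vs v(3) ws w(3)] v(4) w(4) by (simp add: mat_star_dsum)
    show "mat_dsum R p' q' = mat_mult R (mat_dsum R v w) (mat_star R (mat_dsum R v w))"
      using mat_mult_dsum[OF v(3) vs w(3) ws] v(5) w(5) by (simp add: mat_star_dsum)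
  qed
qed

end

section \<open>Homomorphisms of rings with involution\<close>

locale star_ring_hom = R?: star_ring R + S?: star_ring S
  for R :: "('a, 'm) star_alg_scheme" (structure) and S :: "('b, 'n) star_alg_scheme" (structure) +
  fixes h :: "'a \<Rightarrow> 'b"
  assumes h: "h \<in> ring_hom R S"
    and h_star: "x \<in> carrier R \<Longrightarrow> h (star R x) = star S (h x)"
begin

lemma hom_closed [simp, intro]: "x \<in> carrier R \<Longrightarrow> h x \<in> carrier S"
  using h by (rule ring_hom_closed)

lemma hom_finsum:
  assumes "f \<in> A \<rightarrow> carrier R"
  shows "h (\<Oplus>\<^bsub>R\<^esub>k\<in>A. f k) = (\<Oplus>\<^bsub>S\<^esub>k\<in>A. h (f k))"
  using assms
proof (induction A rule: infinite_finite_induct)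
  case (insert x A)
  then have "f x \<in> carrier R" "f \<in> A \<rightarrow> carrier R"
    by auto
  moreover from this have "(\<lambda>k. h (f k)) \<in> A \<rightarrow> carrier S"
    by auto
  ultimately show ?case
    using insert by (simp add: ring_hom_add[OF h])
qed (simp_all add: ring_hom_zero[OF h R.ring_axioms S.ring_axioms])

lemma map_mat_closed: "P \<in> mat_over R m n \<Longrightarrow> map_mat h P \<in> mat_over S m n"
  by (auto simp: mat_over_iff)

lemma map_mat_mult:
  assumes "P \<in> mat_over R m n" "Q \<in> mat_over R n k"
  shows "map_mat h (mat_mult R P Q) = mat_mult S (map_mat h P) (map_mat h Q)"
  using assms
  by (intro eq_matI) (auto simp: mat_over_iff Pi_iff hom_finsum ring_hom_mult[OF h] intro!: S.finsum_cong')

lemma map_mat_star: "P \<in> mat_over R m n \<Longrightarrow> map_mat h (mat_star R P) = mat_star S (map_mat h P)"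
  by (intro eq_matI) (auto simp: mat_over_iff h_star)

lemma hom_zero [simp]: "h \<zero>\<^bsub>R\<^esub> = \<zero>\<^bsub>S\<^esub>"
  by (rule ring_hom_zero[OF h R.ring_axioms S.ring_axioms])

lemma map_mat_dsum: "map_mat h (mat_dsum R P Q) = mat_dsum S (map_mat h P) (map_mat h Q)"
  by (intro eq_matI) (auto simp: mat_dsum_index)

lemma map_mat_projection:
  assumes "p \<in> projections R"
  shows "map_mat h p \<in> projections S"
proof -
  obtain n where p: "n \<ge> 1" "p \<in> mat_over R n n" "mat_star R p = p" "mat_mult R p p = p"
    using assms by (auto elim!: R.projectionsE)
  show ?thesis
    using map_mat_closed[OF p(2)] map_mat_mult[OF p(2) p(2)] map_mat_star[OF p(2)] p
    unfolding projections_def by auto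
qed

lemma map_mat_mvn_rel:
  assumes "(p, q) \<in> mvn_rel R"
  shows "(map_mat h p, map_mat h q) \<in> mvn_rel S"
proof -
  obtain v where v: "p \<in> projections R" "q \<in> projections R"
      "v \<in> mat_over R (dim_row q) (dim_row p)"
      "mat_mult R (mat_star R v) v = p" "mat_mult R v (mat_star R v) = q"
    using assms by (rule R.mvn_relE)
  note vs = R.mat_star_closed[OF v(3)]
  show ?thesis
  proof (rule S.mvn_relI)
    show "map_mat h v \<in> mat_over S (dim_row (map_mat h q)) (dim_row (map_mat h p))"
      using map_mat_closed[OF v(3)] by simp
    show "map_mat h p = mat_mult S (mat_star S (map_mat h v)) (map_mat h v)"
      using map_mat_mult[OF vs v(3)] v(4) by (simp add: map_mat_star[OF v(3)])
    show "map_mat h q = mat_mult S (map_mat h v) (mat_star S (map_mat h v))"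
      using map_mat_mult[OF v(3) vs] v(5) by (simp add: map_mat_star[OF v(3)])
  qed (use v in \<open>auto intro: map_mat_projection\<close>)
qed

end

section \<open>Close projections are equivalent\<close>

text \<open>
  The norm is a parameter and completeness is asked of a subset: below, the subset is an ideal of a
  ring that need not be complete itself.
\<close>

definition norm_complete :: "('a, 'm) ring_scheme \<Rightarrow> ('a \<Rightarrow> real) \<Rightarrow> 'a set \<Rightarrow> bool" where
  "norm_complete R N J \<longleftrightarrow>
     (\<forall>\<sigma>. range \<sigma> \<subseteq> J \<longrightarrow>
        (\<forall>\<epsilon>>0. \<exists>M. \<forall>m\<ge>M. \<forall>n\<ge>M. N (\<sigma> m \<ominus>\<^bsub>R\<^esub> \<sigma> n) < \<epsilon>) \<longrightarrow>
        (\<exists>l\<in>J. (\<lambda>n. N (\<sigma> n \<ominus>\<^bsub>R\<^esub> l)) \<longlonglongrightarrow> 0))"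

lemma norm_completeD:
  assumes "norm_complete R N J" "\<And>n. \<sigma> n \<in> J"
    and "\<And>\<epsilon>. \<epsilon> > 0 \<Longrightarrow> \<exists>M. \<forall>m\<ge>M. \<forall>n\<ge>M. N (\<sigma> m \<ominus>\<^bsub>R\<^esub> \<sigma> n) < \<epsilon>"
  obtains l where "l \<in> J" "(\<lambda>n. N (\<sigma> n \<ominus>\<^bsub>R\<^esub> l)) \<longlonglongrightarrow> 0"
proof -
  have "range \<sigma> \<subseteq> J"
    using assms(2) by auto
  then show ?thesis
    using assms(1,3) that unfolding norm_complete_def by meson
qed

locale normed_star_ring = star_ring R for R :: "('a, 'm) star_alg_scheme" (structure) +
  fixes N :: "'a \<Rightarrow> real"
  assumes norm_nonneg: "x \<in> carrier R \<Longrightarrow> 0 \<le> N x"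
    and norm_zero [simp]: "N \<zero> = 0"
    and norm_eq_zero: "\<lbrakk>x \<in> carrier R; N x = 0\<rbrakk> \<Longrightarrow> x = \<zero>"
    and norm_triangle: "\<lbrakk>x \<in> carrier R; y \<in> carrier R\<rbrakk> \<Longrightarrow> N (x \<oplus> y) \<le> N x + N y"
    and norm_minus: "x \<in> carrier R \<Longrightarrow> N (\<ominus> x) = N x"
    and norm_mult: "\<lbrakk>x \<in> carrier R; y \<in> carrier R\<rbrakk> \<Longrightarrow> N (x \<otimes> y) \<le> N x * N y"
    and norm_star: "x \<in> carrier R \<Longrightarrow> N (star R x) = N x"
begin

lemma diff_eq_zero_iff:
  assumes "x \<in> carrier R" "y \<in> carrier R"
  shows "x \<ominus> y = \<zero> \<longleftrightarrow> x = y"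
proof -
  have "x = (x \<ominus> y) \<oplus> y" "y \<ominus> y = \<zero>"
    using assms by algebra+
  then show ?thesis
    using assms by (metis l_zero)
qed

lemma commute_mult:
  assumes "a \<in> carrier R" "b \<in> carrier R" "x \<in> carrier R"
    and "a \<otimes> x = x \<otimes> a" "b \<otimes> x = x \<otimes> b"
  shows "(a \<otimes> b) \<otimes> x = x \<otimes> (a \<otimes> b)"
proof -
  have "(a \<otimes> b) \<otimes> x = a \<otimes> (x \<otimes> b)"
    using assms by (simp add: m_assoc)
  also have "\<dots> = (x \<otimes> a) \<otimes> b"
    using assms(1-3) by (simp add: assms(4) flip: m_assoc)
  finally show ?thesis
    using assms by (simp add: m_assoc)
qed

lemma norm_diff_triangle:
  "\<lbrakk>x \<in> carrier R; y \<in> carrier R\<rbrakk> \<Longrightarrow> N (x \<ominus> y) \<le> N x + N y"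
  using norm_triangle[of x "\<ominus> y"] norm_minus[of y] by (simp add: minus_eq)

lemma norm_diff_commute:
  "\<lbrakk>x \<in> carrier R; y \<in> carrier R\<rbrakk> \<Longrightarrow> N (x \<ominus> y) = N (y \<ominus> x)"
  using norm_minus[of "x \<ominus> y"] by (simp add: minus_eq minus_add a_comm)

lemma norm_diff_trans:
  assumes "x \<in> carrier R" "y \<in> carrier R" "z \<in> carrier R"
  shows "N (x \<ominus> z) \<le> N (x \<ominus> y) + N (y \<ominus> z)"
proof -
  have "x \<ominus> z = (x \<ominus> y) \<oplus> (y \<ominus> z)"
    using assms by algebra
  then show ?thesis
    using assms norm_triangle[of "x \<ominus> y" "y \<ominus> z"] by simp
qed

definition norm_dist :: "'a \<Rightarrow> 'a \<Rightarrow> real" where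
  "norm_dist x y = (if x \<in> carrier R \<and> y \<in> carrier R then N (x \<ominus> y) else 0)"

lemma norm_Metric_space:
  assumes "M \<subseteq> carrier R"
  shows "Metric_space M norm_dist"
proof
  fix x y
  show "0 \<le> norm_dist x y"
    by (simp add: norm_dist_def norm_nonneg)
  show "norm_dist x y = norm_dist y x"
    by (simp add: norm_dist_def norm_diff_commute)
next
  fix x y
  assume "x \<in> M" "y \<in> M"
  then have "x \<in> carrier R" "y \<in> carrier R"
    using assms by auto
  then show "norm_dist x y = 0 \<longleftrightarrow> x = y"
    using norm_eq_zero[of "x \<ominus> y"] diff_eq_zero_iff[of x y] by (auto simp: norm_dist_def)
next
  fix x y z
  assume "x \<in> M" "y \<in> M" "z \<in> M"
  then show "norm_dist x z \<le> norm_dist x y + norm_dist y z"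
    using assms norm_diff_trans by (auto simp: norm_dist_def)
qed

text \<open>
  Banach's fixed point theorem. The set \<open>K\<close> will be cut out of a ball of the ideal \<open>J\<close> by algebraic
  relations, which is why closedness is asked in this form.
\<close>

lemma contraction_fixed_point:
  assumes J: "norm_complete R N J" "J \<subseteq> carrier R" and K: "K \<subseteq> J" "K \<noteq> {}"
    and limits: "\<And>\<sigma> l. \<lbrakk>range \<sigma> \<subseteq> K; l \<in> J; (\<lambda>n. N (\<sigma> n \<ominus> l)) \<longlonglongrightarrow> 0\<rbrakk> \<Longrightarrow> l \<in> K"
    and F: "F \<in> K \<rightarrow> K" and "k < 1"
    and contraction: "\<And>x y. \<lbrakk>x \<in> K; y \<in> K\<rbrakk> \<Longrightarrow> N (F x \<ominus> F y) \<le> k * N (x \<ominus> y)"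
  obtains w where "w \<in> K" "F w = w"
proof -
  have KR: "x \<in> carrier R" if "x \<in> K" for x
    using that J K by auto
  interpret Metric_space K norm_dist
    using KR by (intro norm_Metric_space) auto
  have "mcomplete"
    unfolding mcomplete_def
  proof (intro allI impI)
    fix \<sigma>
    assume "MCauchy \<sigma>"
    then have \<sigma>: "range \<sigma> \<subseteq> K"
      and Cauchy: "\<forall>\<epsilon>>0. \<exists>M. \<forall>n n'. M \<le> n \<longrightarrow> M \<le> n' \<longrightarrow> norm_dist (\<sigma> n) (\<sigma> n') < \<epsilon>"
      by (auto simp: MCauchy_def)
    have \<sigma>R: "\<sigma> n \<in> carrier R" for n
      using \<sigma> KR by auto
    have "\<forall>\<epsilon>>0. \<exists>M. \<forall>m\<ge>M. \<forall>n\<ge>M. N (\<sigma> m \<ominus> \<sigma> n) < \<epsilon>"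
      using Cauchy \<sigma>R by (simp add: norm_dist_def)
    moreover have "range \<sigma> \<subseteq> J"
      using \<sigma> K by auto
    ultimately obtain l where l: "l \<in> J" "(\<lambda>n. N (\<sigma> n \<ominus> l)) \<longlonglongrightarrow> 0"
      using J(1) unfolding norm_complete_def by blast
    have "l \<in> K"
      using limits[OF \<sigma> l] .
    moreover have "(\<lambda>n. norm_dist (\<sigma> n) l) \<longlonglongrightarrow> 0"
      using l \<sigma>R J(2) by (auto simp: norm_dist_def)
    ultimately have "limitin mtopology \<sigma> l sequentially"
      using \<sigma> by (auto simp: limitin_metric_dist_null image_subset_iff)
    then show "\<exists>x. limitin mtopology \<sigma> x sequentially" ..
  qed
  moreover have "norm_dist (F x) (F y) \<le> k * norm_dist x y" if "x \<in> K" "y \<in> K" for x y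
    using contraction[OF that] that F KR by (auto simp: norm_dist_def Pi_iff)
  ultimately show ?thesis
    using Banach_fixedpoint_thm K(2) F \<open>k < 1\<close> that by metis
qed

text \<open>
  Equations between Lipschitz maps pass to limits. Applied to the involution and the identity, and to
  the two multiplications by \<open>x\<close>, this shows that \<open>w\<^sup>* = w\<close> and \<open>w x = x w\<close> are closed conditions on \<open>w\<close>.
\<close>

lemma limit_eqI:
  assumes "\<And>n. \<sigma> n \<in> carrier R" "l \<in> carrier R" "(\<lambda>n. N (\<sigma> n \<ominus> l)) \<longlonglongrightarrow> 0"
    and a: "\<And>x. x \<in> carrier R \<Longrightarrow> a x \<in> carrier R" and b: "\<And>x. x \<in> carrier R \<Longrightarrow> b x \<in> carrier R"
    and a_bound: "\<And>x y. \<lbrakk>x \<in> carrier R; y \<in> carrier R\<rbrakk> \<Longrightarrow> N (a x \<ominus> a y) \<le> A * N (x \<ominus> y)"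
    and b_bound: "\<And>x y. \<lbrakk>x \<in> carrier R; y \<in> carrier R\<rbrakk> \<Longrightarrow> N (b x \<ominus> b y) \<le> B * N (x \<ominus> y)"
    and eq: "\<And>n. a (\<sigma> n) = b (\<sigma> n)"
  shows "a l = b l"
proof -
  have bound: "N (a l \<ominus> b l) \<le> (A + B) * N (\<sigma> n \<ominus> l)" for n
  proof -
    have "N (a l \<ominus> b l) \<le> N (a l \<ominus> a (\<sigma> n)) + N (a (\<sigma> n) \<ominus> b l)"
      using assms(1,2) a b by (intro norm_diff_trans) auto
    also have "N (a l \<ominus> a (\<sigma> n)) = N (a (\<sigma> n) \<ominus> a l)"
      using assms(1,2) a by (intro norm_diff_commute) auto
    also have "\<dots> + N (a (\<sigma> n) \<ominus> b l) \<le> (A + B) * N (\<sigma> n \<ominus> l)"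
      using a_bound[of "\<sigma> n" l] b_bound[of "\<sigma> n" l] assms(1,2) eq[of n]
      by (simp add: distrib_right)
    finally show ?thesis
      by simp
  qed
  have "(\<lambda>n. (A + B) * N (\<sigma> n \<ominus> l)) \<longlonglongrightarrow> 0"
    using tendsto_mult_right_zero[OF assms(3)] by simp
  then have "N (a l \<ominus> b l) \<le> 0"
    by (rule tendsto_lowerbound) (auto simp: bound)
  then have "N (a l \<ominus> b l) = 0"
    using norm_nonneg[of "a l \<ominus> b l"] a b assms(2) by simp
  then have "a l \<ominus> b l = \<zero>"
    using norm_eq_zero[of "a l \<ominus> b l"] a b assms(2) by simp
  then show ?thesis
    using a b assms(2) by (simp add: diff_eq_zero_iff)
qed

lemma norm_limit_le:
  assumes "\<And>n. \<sigma> n \<in> carrier R" "l \<in> carrier R" "(\<lambda>n. N (\<sigma> n \<ominus> l)) \<longlonglongrightarrow> 0"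
    and "\<And>n. N (\<sigma> n) \<le> c"
  shows "N l \<le> c"
proof -
  have "N l \<le> c + N (\<sigma> n \<ominus> l)" for n
  proof -
    have "l = \<sigma> n \<ominus> (\<sigma> n \<ominus> l)"
      using assms(1)[of n] assms(2) by algebra
    then show ?thesis
      using norm_diff_triangle[of "\<sigma> n" "\<sigma> n \<ominus> l"] assms(1,2) assms(4)[of n] by simp
  qed
  moreover have "(\<lambda>n. c + N (\<sigma> n \<ominus> l)) \<longlonglongrightarrow> c + 0"
    by (intro tendsto_intros assms(3))
  ultimately show ?thesis
    using tendsto_lowerbound[of "\<lambda>n. c + N (\<sigma> n \<ominus> l)" "c + 0" sequentially "N l"] by simp
qed

text \<open>
  The equation for \<open>w\<close> says that \<open>1 + 2 w\<close> is an inverse square root of \<open>1 - h\<close>, when \<open>4 g = h\<close>: expanding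
  \<open>(1 + 2 w)\<^sup>2 (1 - h) = 1\<close> for commuting \<open>w\<close> and \<open>h\<close> gives \<open>4 w = h + 4 h w - 4 w\<^sup>2 + 4 h w\<^sup>2\<close>. Its right-hand
  side, divided by four, maps the ball of radius \<open>1/4\<close> in \<open>J\<close> to itself, as \<open>1/16 + 1/16 + 1/16 + 1/64 \<le> 1/4\<close>,
  and contracts it by the factor \<open>1/4 + 1/2 + 1/8 = 7/8\<close>. Self-adjointness and the commutation relations
  are preserved by it and by limits, so they can be imposed on the set on which the fixed point is sought.
\<close>

lemma inverse_sqrt_perturbation:
  assumes ideal: "ideal J R" and complete: "norm_complete R N J"
    and pq: "p \<in> carrier R" "q \<in> carrier R"
    and h: "h \<in> J" "star R h = h" "N h \<le> 1/4" "h \<otimes> p = p \<otimes> h" "h \<otimes> q = q \<otimes> h"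
    and g: "g \<in> J" "star R g = g" "N g \<le> 1/16" "g \<otimes> p = p \<otimes> g" "g \<otimes> q = q \<otimes> g"
    and h_comm: "\<And>w. \<lbrakk>w \<in> carrier R; w \<otimes> p = p \<otimes> w; w \<otimes> q = q \<otimes> w\<rbrakk> \<Longrightarrow> w \<otimes> h = h \<otimes> w"
  obtains w where "w \<in> carrier R" "star R w = w" "w \<otimes> p = p \<otimes> w" "w \<otimes> q = q \<otimes> w"
    "w = g \<oplus> h \<otimes> w \<ominus> w \<otimes> w \<oplus> h \<otimes> (w \<otimes> w)"
proof -
  interpret J: ideal J R
    by fact
  define K where "K = {w \<in> J. N w \<le> 1/4 \<and> star R w = w \<and> w \<otimes> p = p \<otimes> w \<and> w \<otimes> q = q \<otimes> w}"
  define F where "F w = g \<oplus> h \<otimes> w \<ominus> w \<otimes> w \<oplus> h \<otimes> (w \<otimes> w)" for w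
  have JR: "J \<subseteq> carrier R"
    by (rule J.a_subset)
  then have hR: "h \<in> carrier R" and gR: "g \<in> carrier R"
    using h g by auto
  have KD: "w \<in> carrier R" "w \<in> J" "N w \<le> 1/4" "star R w = w" "w \<otimes> p = p \<otimes> w"
      "w \<otimes> q = q \<otimes> w" "w \<otimes> h = h \<otimes> w" if "w \<in> K" for w
    using that JR h_comm by (auto simp: K_def)
  have zero_K: "\<zero> \<in> K"
    using pq J.zero_closed by (auto simp: K_def)
  have limit_K: "l \<in> K" if \<sigma>: "range \<sigma> \<subseteq> K" and l: "l \<in> J" and lim: "(\<lambda>n. N (\<sigma> n \<ominus> l)) \<longlonglongrightarrow> 0" for \<sigma> l
  proof -
    have \<sigma>K: "\<sigma> n \<in> K" for n
      using \<sigma> by auto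
    have lR: "l \<in> carrier R"
      using l JR by auto
    note limit = limit_eqI[OF KD(1)[OF \<sigma>K] lR lim]
    have "star R l = l"
      by (rule limit[of "star R" "\<lambda>x. x" 1 1]) (simp_all add: KD[OF \<sigma>K] norm_star flip: star_diff)
    moreover have comm: "l \<otimes> x = x \<otimes> l"
      if x: "x \<in> carrier R" "\<And>n. \<sigma> n \<otimes> x = x \<otimes> \<sigma> n" for x
    proof (rule limit[of "\<lambda>y. y \<otimes> x" "\<lambda>y. x \<otimes> y" "N x" "N x"])
      fix y z
      assume yz: "y \<in> carrier R" "z \<in> carrier R"
      have "y \<otimes> x \<ominus> z \<otimes> x = (y \<ominus> z) \<otimes> x" "x \<otimes> y \<ominus> x \<otimes> z = x \<otimes> (y \<ominus> z)"
        using yz x by algebra+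
      then show "N (y \<otimes> x \<ominus> z \<otimes> x) \<le> N x * N (y \<ominus> z)" "N (x \<otimes> y \<ominus> x \<otimes> z) \<le> N x * N (y \<ominus> z)"
        using norm_mult[of "y \<ominus> z" x] norm_mult[of x "y \<ominus> z"] yz x by (simp_all add: mult.commute)
    qed (use x in auto)
    moreover have "N l \<le> 1/4"
      using norm_limit_le[OF KD(1)[OF \<sigma>K] lR lim] KD(3)[OF \<sigma>K] by blast
    ultimately show "l \<in> K"
      using l comm[OF pq(1)] comm[OF pq(2)] KD[OF \<sigma>K] by (simp add: K_def)
  qed
  have F_K: "F w \<in> K" if w: "w \<in> K" for w
  proof -
    note W = KD[OF w]
    have "F w \<in> J"
      using W g h hR by (auto simp: F_def minus_eq intro!: J.a_closed J.a_inv_closed J.I_l_closed)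
    moreover have "N (F w) \<le> 1/4"
    proof -
      have ww: "N (w \<otimes> w) \<le> 1/16"
        using norm_mult[of w w] W mult_mono[of "N w" "1/4" "N w" "1/4"] norm_nonneg[of w] by simp
      have hw: "N (h \<otimes> w) \<le> 1/16"
        using norm_mult[of h w] W hR h mult_mono[of "N h" "1/4" "N w" "1/4"] norm_nonneg[of w] by simp
      have hww: "N (h \<otimes> (w \<otimes> w)) \<le> 1/64"
        using norm_mult[of h "w \<otimes> w"] W hR h ww mult_mono[of "N h" "1/4" "N (w \<otimes> w)" "1/16"]
          norm_nonneg[of "w \<otimes> w"] by simp
      have "N (F w) \<le> N (g \<oplus> h \<otimes> w \<ominus> w \<otimes> w) + N (h \<otimes> (w \<otimes> w))"
        using W gR hR unfolding F_def by (intro norm_triangle) auto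
      also have "N (g \<oplus> h \<otimes> w \<ominus> w \<otimes> w) \<le> N (g \<oplus> h \<otimes> w) + N (w \<otimes> w)"
        using W gR hR by (intro norm_diff_triangle) auto
      also have "N (g \<oplus> h \<otimes> w) \<le> N g + N (h \<otimes> w)"
        using W gR hR by (intro norm_triangle) auto
      finally show ?thesis
        using g ww hw hww by simp
    qed
    moreover have "star R (F w) = F w"
    proof -
      have "star R (h \<otimes> w) = h \<otimes> w" "star R (w \<otimes> w) = w \<otimes> w"
        using W hR h by (simp_all add: star_mult)
      moreover have "star R (h \<otimes> (w \<otimes> w)) = h \<otimes> (w \<otimes> w)"
        using W(1,4,7) hR h(2) commute_mult[of w w h] by (simp add: star_mult)
      ultimately show ?thesis
        using W gR hR g by (simp add: F_def star_add star_diff)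
    qed
    moreover have "F w \<otimes> x = x \<otimes> F w"
      if x: "x \<in> carrier R" "w \<otimes> x = x \<otimes> w" "h \<otimes> x = x \<otimes> h" "g \<otimes> x = x \<otimes> g" for x
    proof -
      have ww: "(w \<otimes> w) \<otimes> x = x \<otimes> (w \<otimes> w)"
        using W(1) x by (intro commute_mult) auto
      have hw: "(h \<otimes> w) \<otimes> x = x \<otimes> (h \<otimes> w)"
        using W(1) hR x by (intro commute_mult) auto
      have hww: "(h \<otimes> (w \<otimes> w)) \<otimes> x = x \<otimes> (h \<otimes> (w \<otimes> w))"
        using W(1) hR x ww by (intro commute_mult) auto
      show ?thesis
        using W(1) hR gR x(1)
        by (simp add: F_def minus_eq l_distr r_distr l_minus r_minus x(4) ww hw hww)
    qed
    ultimately show ?thesis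
      using W g h pq by (simp add: K_def)
  qed
  have F_contraction: "N (F w \<ominus> F w') \<le> 7/8 * N (w \<ominus> w')" if "w \<in> K" "w' \<in> K" for w w'
  proof -
    note W = KD[OF that(1)] and W' = KD[OF that(2)]
    define d where "d = w \<ominus> w'"
    define s where "s = w \<otimes> d \<oplus> d \<otimes> w'"
    have dR: "d \<in> carrier R" and sR: "s \<in> carrier R"
      using W(1) W'(1) by (auto simp: d_def s_def)
    have "F w \<ominus> F w' = h \<otimes> d \<ominus> s \<oplus> h \<otimes> s"
      unfolding F_def s_def d_def using W(1) W'(1) hR gR by algebra
    then have "N (F w \<ominus> F w') \<le> N (h \<otimes> d \<ominus> s) + N (h \<otimes> s)"
      using hR dR sR by (simp add: norm_triangle)
    also have "N (h \<otimes> d \<ominus> s) \<le> N (h \<otimes> d) + N s"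
      using hR dR sR by (intro norm_diff_triangle) auto
    finally have "N (F w \<ominus> F w') \<le> N (h \<otimes> d) + N s + N (h \<otimes> s)"
      by simp
    moreover have "N (h \<otimes> d) \<le> 1/4 * N d"
      using norm_mult[OF hR dR] mult_right_mono[OF h(3) norm_nonneg[OF dR]] by simp
    moreover have "N (w \<otimes> d) \<le> 1/4 * N d"
      using norm_mult[OF W(1) dR] mult_right_mono[OF W(3) norm_nonneg[OF dR]] by simp
    moreover have "N (d \<otimes> w') \<le> 1/4 * N d"
      using norm_mult[OF dR W'(1)] mult_left_mono[OF W'(3) norm_nonneg[OF dR]] by simp
    moreover have "N s \<le> N (w \<otimes> d) + N (d \<otimes> w')"
      unfolding s_def using W(1) W'(1) dR by (intro norm_triangle) auto
    moreover have "N (h \<otimes> s) \<le> 1/4 * N s"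
      using norm_mult[OF hR sR] mult_right_mono[OF h(3) norm_nonneg[OF sR]] by simp
    ultimately show ?thesis
      by (simp add: d_def)
  qed
  obtain w where "w \<in> K" "F w = w"
  proof (rule contraction_fixed_point[OF complete JR])
    show "K \<subseteq> J" "K \<noteq> {}"
      using zero_K by (auto simp: K_def)
    show "F \<in> K \<rightarrow> K" "(7/8 :: real) < 1"
      using F_K by auto
  qed (use limit_K F_contraction in auto)
  then show ?thesis
    using KD(1,4,5,6)[OF \<open>w \<in> K\<close>] by (intro that[of w]) (simp_all add: F_def)
qed

text \<open>
  The element \<open>e\<close> is the scalar \<open>1/4\<close>; as the inverse of the integer \<open>4\<close> it is central and self-adjoint. With \<open>y = 1 + 2 w\<close> from the preceding lemma, \<open>v = y q p\<close> is the required partial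
  isometry: \<open>v\<^sup>* v = y\<^sup>2 p q p = y\<^sup>2 (1 - h) p = p\<close>, and \<open>v v\<^sup>* = q\<close> by symmetry.
\<close>

theorem close_projections:
  assumes ideal: "ideal J R" and complete: "norm_complete R N J"
    and e: "e \<in> carrier R" "e \<oplus> e \<oplus> e \<oplus> e = \<one>"
    and p: "p \<in> carrier R" "star R p = p" "p \<otimes> p = p"
    and q: "q \<in> carrier R" "star R q = q" "q \<otimes> q = q"
    and pq: "p \<ominus> q \<in> J"
    and close: "(N (p \<ominus> q))\<^sup>2 \<le> 1/4" "N e * (N (p \<ominus> q))\<^sup>2 \<le> 1/16"
  shows "\<exists>v\<in>carrier R. star R v \<otimes> v = p \<and> v \<otimes> star R v = q"
proof -
  interpret J: ideal J R
    by fact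
  define h where "h = (p \<ominus> q) \<otimes> (p \<ominus> q)"
  define g where "g = e \<otimes> h"
  have hR: "h \<in> carrier R" and gR: "g \<in> carrier R"
    using p q e by (auto simp: h_def g_def)
  have e_central: "e \<otimes> x = x \<otimes> e" if "x \<in> carrier R" for x
  proof -
    have "e \<otimes> x = (e \<otimes> x) \<otimes> (e \<oplus> e \<oplus> e \<oplus> e)"
      using e that by simp
    also have "\<dots> = (e \<oplus> e \<oplus> e \<oplus> e) \<otimes> (x \<otimes> e)"
      using e(1) that by (simp add: l_distr r_distr m_assoc)
    also have "\<dots> = x \<otimes> e"
      using e that by simp
    finally show ?thesis .
  qed
  have e_star: "star R e = e"
  proof -
    have e4: "star R e \<oplus> star R e \<oplus> star R e \<oplus> star R e = \<one>"
      using e by (simp flip: star_add)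
    have "star R e = star R e \<otimes> (e \<oplus> e \<oplus> e \<oplus> e)"
      using e by simp
    also have "\<dots> = (star R e \<oplus> star R e \<oplus> star R e \<oplus> star R e) \<otimes> e"
      using e(1) by (simp add: l_distr r_distr)
    also have "\<dots> = e"
      using e e4 by simp
    finally show ?thesis .
  qed
  have g4: "g \<oplus> g \<oplus> g \<oplus> g = h"
  proof -
    have "g \<oplus> g \<oplus> g \<oplus> g = (e \<oplus> e \<oplus> e \<oplus> e) \<otimes> h"
      using e(1) hR by (simp add: g_def l_distr)
    then show ?thesis
      using e hR by simp
  qed
  have h_comm: "w \<otimes> h = h \<otimes> w"
    if w: "w \<in> carrier R" "w \<otimes> p = p \<otimes> w" "w \<otimes> q = q \<otimes> w" for w
  proof -
    have "w \<otimes> (p \<ominus> q) = (p \<ominus> q) \<otimes> w"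
      using w p(1) q(1) by (simp add: minus_eq l_distr r_distr l_minus r_minus)
    then show ?thesis
      unfolding h_def using w(1) p(1) q(1)
      by (intro commute_mult[symmetric]) (assumption | rule minus_closed | erule sym)+
  qed
  have h_expand: "h = p \<oplus> q \<ominus> p \<otimes> q \<ominus> q \<otimes> p"
  proof -
    have "h = p \<otimes> p \<oplus> q \<otimes> q \<ominus> p \<otimes> q \<ominus> q \<otimes> p"
      unfolding h_def using p(1) q(1) by algebra
    then show ?thesis
      using p(3) q(3) by simp
  qed
  have php: "p \<otimes> q \<otimes> p = p \<otimes> (\<one> \<ominus> h)" "p \<otimes> q \<otimes> p = (\<one> \<ominus> h) \<otimes> p"
  proof -
    have "p \<otimes> (\<one> \<ominus> h) = p \<ominus> p \<otimes> h"
      using p(1) hR by (simp add: minus_eq r_distr r_minus)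
    also have "\<dots> = p \<ominus> p \<otimes> p \<ominus> p \<otimes> q \<oplus> p \<otimes> p \<otimes> q \<oplus> p \<otimes> q \<otimes> p"
      unfolding h_expand using p(1) q(1) by algebra
    also have "\<dots> = p \<ominus> p \<ominus> p \<otimes> q \<oplus> p \<otimes> q \<oplus> p \<otimes> q \<otimes> p"
      by (simp add: p(3))
    also have "\<dots> = p \<otimes> q \<otimes> p"
      using p(1) q(1) by algebra
    finally show "p \<otimes> q \<otimes> p = p \<otimes> (\<one> \<ominus> h)" ..
    have "(\<one> \<ominus> h) \<otimes> p = p \<ominus> p \<otimes> p \<ominus> q \<otimes> p \<oplus> q \<otimes> (p \<otimes> p) \<oplus> p \<otimes> q \<otimes> p"
      unfolding h_expand using p(1) q(1) by algebra
    also have "\<dots> = p \<ominus> p \<ominus> q \<otimes> p \<oplus> q \<otimes> p \<oplus> p \<otimes> q \<otimes> p"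
      by (simp add: p(3))
    also have "\<dots> = p \<otimes> q \<otimes> p"
      using p(1) q(1) by algebra
    finally show "p \<otimes> q \<otimes> p = (\<one> \<ominus> h) \<otimes> p" ..
  qed
  have qhq: "q \<otimes> p \<otimes> q = q \<otimes> (\<one> \<ominus> h)" "q \<otimes> p \<otimes> q = (\<one> \<ominus> h) \<otimes> q"
  proof -
    have "q \<otimes> (\<one> \<ominus> h) = q \<ominus> q \<otimes> h"
      using q(1) hR by (simp add: minus_eq r_distr r_minus)
    also have "\<dots> = q \<ominus> q \<otimes> q \<ominus> q \<otimes> p \<oplus> q \<otimes> q \<otimes> p \<oplus> q \<otimes> p \<otimes> q"
      unfolding h_expand using p(1) q(1) by algebra
    also have "\<dots> = q \<ominus> q \<ominus> q \<otimes> p \<oplus> q \<otimes> p \<oplus> q \<otimes> p \<otimes> q"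
      by (simp add: q(3))
    also have "\<dots> = q \<otimes> p \<otimes> q"
      using p(1) q(1) by algebra
    finally show "q \<otimes> p \<otimes> q = q \<otimes> (\<one> \<ominus> h)" ..
    have "(\<one> \<ominus> h) \<otimes> q = q \<ominus> q \<otimes> q \<ominus> p \<otimes> q \<oplus> p \<otimes> (q \<otimes> q) \<oplus> q \<otimes> p \<otimes> q"
      unfolding h_expand using p(1) q(1) by algebra
    also have "\<dots> = q \<ominus> q \<ominus> p \<otimes> q \<oplus> p \<otimes> q \<oplus> q \<otimes> p \<otimes> q"
      by (simp add: q(3))
    also have "\<dots> = q \<otimes> p \<otimes> q"
      using p(1) q(1) by algebra
    finally show "q \<otimes> p \<otimes> q = (\<one> \<ominus> h) \<otimes> q" ..
  qed
  have comm_of: "h \<otimes> x = x \<otimes> h" if "x \<in> carrier R" "x \<otimes> (\<one> \<ominus> h) = (\<one> \<ominus> h) \<otimes> x" for x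
  proof -
    have "h \<otimes> x = x \<ominus> (\<one> \<ominus> h) \<otimes> x" "x \<ominus> x \<otimes> h = x \<otimes> (\<one> \<ominus> h)"
      using hR that(1) by (algebra, simp add: minus_eq r_distr r_minus)
    moreover have "x \<otimes> h = x \<ominus> (x \<ominus> x \<otimes> h)"
      using hR that(1) by algebra
    ultimately show ?thesis
      using that(2) by simp
  qed
  have hp: "h \<otimes> p = p \<otimes> h" and hq: "h \<otimes> q = q \<otimes> h"
    using comm_of[OF p(1)] comm_of[OF q(1)] php qhq by simp_all
  have gx: "g \<otimes> x = x \<otimes> g" if "x \<in> carrier R" "h \<otimes> x = x \<otimes> h" for x
    using that e hR e_central unfolding g_def by (intro commute_mult) auto
  have hJ: "h \<in> J" and gJ: "g \<in> J"
    using pq p q e unfolding g_def h_def by (auto intro!: J.I_l_closed)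
  have h_star: "star R h = h"
    using p q by (simp add: h_def star_mult star_diff)
  have g_star: "star R g = g"
    using e hR e_central by (simp add: g_def star_mult h_star e_star)
  have Nh2: "N h \<le> (N (p \<ominus> q))\<^sup>2"
    using norm_mult[of "p \<ominus> q" "p \<ominus> q"] p q by (simp add: h_def power2_eq_square)
  have Nh: "N h \<le> 1/4"
    using Nh2 close by simp
  have Ng: "N g \<le> 1/16"
    using norm_mult[OF e(1) hR] mult_left_mono[OF Nh2 norm_nonneg[OF e(1)]] close by (simp add: g_def)
  obtain w where w: "w \<in> carrier R" "star R w = w" "w \<otimes> p = p \<otimes> w" "w \<otimes> q = q \<otimes> w"
    and w_eq: "w = g \<oplus> h \<otimes> w \<ominus> w \<otimes> w \<oplus> h \<otimes> (w \<otimes> w)"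
    using inverse_sqrt_perturbation[OF ideal complete p(1) q(1) hJ h_star Nh hp hq gJ g_star Ng
        gx[OF p(1) hp] gx[OF q(1) hq], of thesis] h_comm by blast
  \<comment> \<open>the inverse square root of \<open>1 - h\<close>\<close>
  define y where "y = \<one> \<oplus> w \<oplus> w"
  have yR: "y \<in> carrier R" and y_star: "star R y = y"
    using w by (auto simp: y_def star_add)
  have yp: "y \<otimes> p = p \<otimes> y" and yq: "y \<otimes> q = q \<otimes> y"
    using w p(1) q(1) by (simp_all add: y_def l_distr r_distr)
  have yy: "y \<otimes> y \<otimes> (\<one> \<ominus> h) = \<one>"
  proof -
    \<comment> \<open>\<open>y\<^sup>2 = 1 + 4 s\<close>, and the fixed point equation says \<open>(1 - h) s = g\<close>\<close>
    define s where "s = w \<oplus> w \<otimes> w"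
    define u where "u = s \<ominus> h \<otimes> s"
    have sR: "s \<in> carrier R"
      using w(1) by (simp add: s_def)
    have wh: "w \<otimes> h = h \<otimes> w"
      using h_comm w by blast
    have "u = w \<oplus> w \<otimes> w \<ominus> h \<otimes> w \<ominus> h \<otimes> (w \<otimes> w)"
      unfolding u_def s_def using w(1) hR by algebra
    also have "\<dots> = (g \<oplus> h \<otimes> w \<ominus> w \<otimes> w \<oplus> h \<otimes> (w \<otimes> w)) \<oplus> w \<otimes> w \<ominus> h \<otimes> w \<ominus> h \<otimes> (w \<otimes> w)"
      by (simp flip: w_eq)
    also have "\<dots> = g"
      using w(1) hR gR by algebra
    finally have u: "u = g" .
    have "y \<otimes> y \<otimes> (\<one> \<ominus> h) = (\<one> \<ominus> h) \<otimes> (y \<otimes> y)"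
    proof -
      have "y \<otimes> h = h \<otimes> y"
        using w hR wh by (simp add: y_def l_distr r_distr)
      then have "y \<otimes> (\<one> \<ominus> h) = (\<one> \<ominus> h) \<otimes> y"
        using yR hR by (simp add: minus_eq l_distr r_distr l_minus r_minus)
      then show ?thesis
        using yR hR by (intro commute_mult) auto
    qed
    also have "\<dots> = (\<one> \<ominus> h) \<otimes> (\<one> \<oplus> (s \<oplus> s \<oplus> s \<oplus> s))"
      using w(1) by (simp add: y_def s_def l_distr r_distr a_ac)
    also have "(\<one> \<ominus> h) \<otimes> (\<one> \<oplus> (s \<oplus> s \<oplus> s \<oplus> s)) = (\<one> \<ominus> h) \<oplus> (u \<oplus> u \<oplus> u \<oplus> u)"
    proof -
      have "(\<one> \<ominus> h) \<otimes> s = u"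
        using sR hR by (simp add: u_def minus_eq l_distr l_minus)
      then show ?thesis
        using sR hR by (simp add: r_distr)
    qed
    also have "\<dots> = \<one>"
      using hR by (simp add: u g4 minus_eq a_assoc l_neg)
    finally show ?thesis .
  qed
  define v where "v = y \<otimes> (q \<otimes> p)"
  have vR: "v \<in> carrier R"
    using yR p q by (simp add: v_def)
  have v_star: "star R v = p \<otimes> q \<otimes> y"
    using yR p q by (simp add: v_def star_mult y_star)
  have "star R v \<otimes> v = p"
  proof -
    have "star R v \<otimes> v = p \<otimes> q \<otimes> (y \<otimes> y) \<otimes> q \<otimes> p"
      unfolding v_star unfolding v_def using yR p(1) q(1) by (simp add: m_assoc)
    also have "p \<otimes> q \<otimes> (y \<otimes> y) = (y \<otimes> y) \<otimes> (p \<otimes> q)"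
      using yR p(1) q(1) yp yq by (intro commute_mult commute_mult[symmetric]) auto
    also have "(y \<otimes> y) \<otimes> (p \<otimes> q) \<otimes> q \<otimes> p = (y \<otimes> y) \<otimes> (p \<otimes> (q \<otimes> q) \<otimes> p)"
      using yR p(1) q(1) by (simp add: m_assoc)
    also have "\<dots> = y \<otimes> y \<otimes> (\<one> \<ominus> h) \<otimes> p"
      using yR p(1) hR by (simp add: q(3) php(2) m_assoc)
    also have "\<dots> = p"
      using yy p(1) by simp
    finally show ?thesis .
  qed
  moreover have "v \<otimes> star R v = q"
  proof -
    have "v \<otimes> star R v = y \<otimes> (q \<otimes> (p \<otimes> p) \<otimes> q) \<otimes> y"
      unfolding v_star unfolding v_def using yR p(1) q(1) by (simp add: m_assoc)
    also have "\<dots> = y \<otimes> (q \<otimes> p \<otimes> q \<otimes> y)"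
      using yR p(1) q(1) by (simp add: p(3) m_assoc)
    also have "q \<otimes> p \<otimes> q \<otimes> y = y \<otimes> (q \<otimes> p \<otimes> q)"
      using yR p(1) q(1) yp yq by (intro commute_mult) auto
    also have "y \<otimes> (y \<otimes> (q \<otimes> p \<otimes> q)) = y \<otimes> y \<otimes> (\<one> \<ominus> h) \<otimes> q"
      using yR p(1) q(1) hR by (simp add: qhq(2) m_assoc)
    also have "\<dots> = q"
      using yy q(1) by simp
    finally show ?thesis .
  qed
  ultimately show ?thesis
    using vR by blast
qed

end

section \<open>Square matrices as a normed ring\<close>

definition mat_one :: "('a, 'm) star_alg_scheme \<Rightarrow> nat \<Rightarrow> 'a mat" where
  "mat_one R n = mat n n (\<lambda>(i, j). if i = j then \<one>\<^bsub>R\<^esub> else \<zero>\<^bsub>R\<^esub>)"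

definition mat_ring :: "('a, 'm) star_alg_scheme \<Rightarrow> nat \<Rightarrow> 'a mat star_alg" where
  "mat_ring R n = \<lparr>
     carrier = mat_over R n n,
     mult = mat_mult R,
     one = mat_one R n,
     zero = mat_zero R n n,
     add = (\<lambda>P Q. mat n n (\<lambda>ij. P $$ ij \<oplus>\<^bsub>R\<^esub> Q $$ ij)),
     smult = (\<lambda>c. map_mat (smult R c)),
     star = mat_star R\<rparr>"

lemma mat_ring_simps [simp]:
  "carrier (mat_ring R n) = mat_over R n n"
  "mult (mat_ring R n) = mat_mult R"
  "one (mat_ring R n) = mat_one R n"
  "zero (mat_ring R n) = mat_zero R n n"
  "star (mat_ring R n) = mat_star R"
  "add (mat_ring R n) P Q = mat n n (\<lambda>ij. P $$ ij \<oplus>\<^bsub>R\<^esub> Q $$ ij)"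
  by (simp_all add: mat_ring_def)

lemma mat_one_dims [simp]: "dim_row (mat_one R n) = n" "dim_col (mat_one R n) = n"
  by (simp_all add: mat_one_def)

lemma mat_one_index [simp]:
  "\<lbrakk>i < n; j < n\<rbrakk> \<Longrightarrow> mat_one R n $$ (i, j) = (if i = j then \<one>\<^bsub>R\<^esub> else \<zero>\<^bsub>R\<^esub>)"
  by (simp add: mat_one_def)

context star_ring
begin

lemma mat_ring_abelian_group: "abelian_group (mat_ring R n)"
proof (rule abelian_groupI)
  fix P
  assume P: "P \<in> carrier (mat_ring R n)"
  show "\<exists>Q\<in>carrier (mat_ring R n). Q \<oplus>\<^bsub>mat_ring R n\<^esub> P = \<zero>\<^bsub>mat_ring R n\<^esub>"
    using P by (intro bexI[of _ "map_mat (\<lambda>x. \<ominus> x) P"] eq_matI) (auto simp: mat_over_iff l_neg)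
qed (auto intro!: eq_matI simp: mat_over_iff a_ac)

lemma mat_mult_one:
  assumes "P \<in> mat_over R m n"
  shows "mat_mult R P (mat_one R n) = P"
proof (rule eq_matI)
  fix i j
  assume ij: "i < dim_row P" "j < dim_col P"
  have "mat_mult R P (mat_one R n) $$ (i, j) = (\<Oplus>k\<in>{..<n}. if j = k then P $$ (i, k) else \<zero>)"
    using assms ij by (auto simp: mat_over_iff intro!: finsum_cong')
  also have "\<dots> = P $$ (i, j)"
    using assms ij by (intro finsum_singleton) (auto simp: mat_over_iff)
  finally show "mat_mult R P (mat_one R n) $$ (i, j) = P $$ (i, j)" .
qed (use assms in \<open>auto simp: mat_over_iff\<close>)

lemma mat_one_closed: "mat_one R n \<in> mat_over R n n"
  by (auto simp: mat_over_iff)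

lemma mat_one_mult:
  assumes "P \<in> mat_over R n m"
  shows "mat_mult R (mat_one R n) P = P"
proof -
  have "mat_star R (mat_one R n) = mat_one R n"
    by (intro eq_matI) auto
  then have "mat_mult R (mat_one R n) P = mat_star R (mat_mult R (mat_star R P) (mat_one R n))"
    using assms mat_star_mult[OF mat_star_closed[OF assms] mat_one_closed] mat_star_star by simp
  then show ?thesis
    using assms mat_mult_one[OF mat_star_closed] mat_star_star by metis
qed

lemma mat_ring_star_ring: "star_ring (mat_ring R n)"
proof -
  have "monoid (mat_ring R n)"
    using mat_mult_assoc by (intro monoidI)
      (auto intro: mat_mult_closed mat_one_closed mat_one_mult mat_mult_one)
  moreover have "(P \<oplus>\<^bsub>mat_ring R n\<^esub> Q) \<otimes>\<^bsub>mat_ring R n\<^esub> S =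
      P \<otimes>\<^bsub>mat_ring R n\<^esub> S \<oplus>\<^bsub>mat_ring R n\<^esub> Q \<otimes>\<^bsub>mat_ring R n\<^esub> S"
    if "P \<in> carrier (mat_ring R n)" "Q \<in> carrier (mat_ring R n)" "S \<in> carrier (mat_ring R n)" for P Q S
    using that by (intro eq_matI)
      (auto simp: mat_over_iff l_distr simp flip: finsum_addf intro!: finsum_cong')
  moreover have "S \<otimes>\<^bsub>mat_ring R n\<^esub> (P \<oplus>\<^bsub>mat_ring R n\<^esub> Q) =
      S \<otimes>\<^bsub>mat_ring R n\<^esub> P \<oplus>\<^bsub>mat_ring R n\<^esub> S \<otimes>\<^bsub>mat_ring R n\<^esub> Q"
    if "P \<in> carrier (mat_ring R n)" "Q \<in> carrier (mat_ring R n)" "S \<in> carrier (mat_ring R n)" for P Q S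
    using that by (intro eq_matI)
      (auto simp: mat_over_iff r_distr simp flip: finsum_addf intro!: finsum_cong')
  ultimately have "ring (mat_ring R n)"
    by (intro ringI mat_ring_abelian_group)
  then show ?thesis
  proof (rule star_ring.intro[OF _ star_ring_axioms.intro])
    fix P Q
    assume PQ: "P \<in> carrier (mat_ring R n)" "Q \<in> carrier (mat_ring R n)"
    show "star (mat_ring R n) (P \<otimes>\<^bsub>mat_ring R n\<^esub> Q) =
        star (mat_ring R n) Q \<otimes>\<^bsub>mat_ring R n\<^esub> star (mat_ring R n) P"
      using PQ mat_star_mult by simp
    show "star (mat_ring R n) (P \<oplus>\<^bsub>mat_ring R n\<^esub> Q) =
        star (mat_ring R n) P \<oplus>\<^bsub>mat_ring R n\<^esub> star (mat_ring R n) Q"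
      using PQ by (intro eq_matI) (auto simp: mat_over_iff star_add)
  qed (auto intro: mat_star_closed mat_star_star)
qed

lemma mat_ring_minus:
  assumes "P \<in> mat_over R n n"
  shows "\<ominus>\<^bsub>mat_ring R n\<^esub> P = map_mat (\<lambda>x. \<ominus> x) P"
proof -
  interpret M: star_ring "mat_ring R n"
    by (rule mat_ring_star_ring)
  show ?thesis
    using assms by (intro M.minus_equality eq_matI) (auto simp: mat_over_iff l_neg)
qed

lemma mat_ring_diff_index:
  assumes "P \<in> mat_over R n n" "Q \<in> mat_over R n n" "i < n" "j < n"
  shows "(P \<ominus>\<^bsub>mat_ring R n\<^esub> Q) $$ (i, j) = P $$ (i, j) \<ominus> Q $$ (i, j)"
  using assms by (auto simp: a_minus_def mat_ring_minus mat_over_iff)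

end

definition ideal_mats :: "'a set \<Rightarrow> nat \<Rightarrow> 'a mat set" where
  "ideal_mats J n = {P \<in> carrier_mat n n. \<forall>i<n. \<forall>j<n. P $$ (i, j) \<in> J}"

lemma (in ideal) finsum_ideal:
  assumes "\<And>k. k \<in> S \<Longrightarrow> f k \<in> I"
  shows "finsum R f S \<in> I"
  using assms
proof (induction S rule: infinite_finite_induct)
  case (insert x S)
  then have "f \<in> S \<rightarrow> carrier R" "f x \<in> carrier R"
    using a_subset by auto
  then show ?case
    using insert a_closed by simp
qed auto

lemma (in star_ring) ideal_mats_ideal:
  assumes "ideal J R"
  shows "ideal (ideal_mats J n) (mat_ring R n)"
proof -
  interpret J: ideal J R
    by fact
  interpret M: star_ring "mat_ring R n"
    by (rule mat_ring_star_ring)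
  have sub: "ideal_mats J n \<subseteq> mat_over R n n"
    using J.a_subset by (auto simp: ideal_mats_def mat_over_iff)
  have "subgroup (ideal_mats J n) (add_monoid (mat_ring R n))"
  proof (rule M.add.subgroupI)
    show "ideal_mats J n \<subseteq> carrier (mat_ring R n)"
      using sub by simp
    have "mat_zero R n n \<in> ideal_mats J n"
      by (auto simp: ideal_mats_def)
    then show "ideal_mats J n \<noteq> {}"
      by auto
  next
    fix P
    assume P: "P \<in> ideal_mats J n"
    then show "\<ominus>\<^bsub>mat_ring R n\<^esub> P \<in> ideal_mats J n"
      using sub by (subst mat_ring_minus) (auto simp: ideal_mats_def)
  qed (auto simp: ideal_mats_def)
  then show ?thesis
  proof (rule idealI[OF M.ring_axioms])
    fix P X
    assume "P \<in> ideal_mats J n" "X \<in> carrier (mat_ring R n)"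
    then have P: "dim_row P = n" "dim_col P = n" "\<And>i j. \<lbrakk>i < n; j < n\<rbrakk> \<Longrightarrow> P $$ (i, j) \<in> J"
      and X: "dim_row X = n" "dim_col X = n" "\<And>i j. \<lbrakk>i < n; j < n\<rbrakk> \<Longrightarrow> X $$ (i, j) \<in> carrier R"
      by (auto simp: ideal_mats_def mat_over_iff)
    show "X \<otimes>\<^bsub>mat_ring R n\<^esub> P \<in> ideal_mats J n"
      using P X by (auto simp: ideal_mats_def intro!: J.finsum_ideal J.I_l_closed)
    show "P \<otimes>\<^bsub>mat_ring R n\<^esub> X \<in> ideal_mats J n"
      using P X by (auto simp: ideal_mats_def intro!: J.finsum_ideal J.I_r_closed)
  qed
qed

text \<open>
  The sum of the norms of the entries: a submultiplicative norm for which completeness reduces to that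
  of the entries.
\<close>

definition mat_norm :: "('a \<Rightarrow> real) \<Rightarrow> 'a mat \<Rightarrow> real" where
  "mat_norm N P = (\<Sum>i<dim_row P. \<Sum>j<dim_col P. N (P $$ (i, j)))"

context normed_star_ring
begin

lemma norm_finsum:
  assumes "f \<in> S \<rightarrow> carrier R"
  shows "N (\<Oplus>k\<in>S. f k) \<le> (\<Sum>k\<in>S. N (f k))"
  using assms
proof (induction S rule: infinite_finite_induct)
  case (insert x S)
  then have "f x \<in> carrier R" "f \<in> S \<rightarrow> carrier R"
    by auto
  then show ?case
    using insert norm_triangle[of "f x" "finsum R f S"] by simp
qed auto

lemma norm_entry_le_mat_norm:
  assumes P: "P \<in> mat_over R n n" and ij: "i < n" "j < n"
  shows "N (P $$ (i, j)) \<le> mat_norm N P"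
proof -
  have "N (P $$ (i, j)) \<le> (\<Sum>j<n. N (P $$ (i, j)))"
    using P ij by (intro member_le_sum) (auto simp: mat_over_iff norm_nonneg)
  also have "\<dots> \<le> (\<Sum>i<n. \<Sum>j<n. N (P $$ (i, j)))"
    using P ij by (intro member_le_sum[of i _ "\<lambda>i. \<Sum>j<n. N (P $$ (i, j))"])
      (auto simp: mat_over_iff norm_nonneg intro!: sum_nonneg)
  finally show ?thesis
    using P by (simp add: mat_norm_def mat_over_iff)
qed

lemma mat_norm_mult:
  assumes P: "P \<in> mat_over R n n" and Q: "Q \<in> mat_over R n n"
  shows "mat_norm N (mat_mult R P Q) \<le> mat_norm N P * mat_norm N Q"
proof -
  let ?p = "\<lambda>i k. N (P $$ (i, k))" and ?q = "\<lambda>k j. N (Q $$ (k, j))"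
  have nonneg: "0 \<le> ?p i k" "0 \<le> ?q i k" if "i < n" "k < n" for i k
    using that P Q by (auto simp: mat_over_iff norm_nonneg)
  have "N (mat_mult R P Q $$ (i, j)) \<le> (\<Sum>k<n. ?p i k) * (\<Sum>k<n. ?q k j)" if "i < n" "j < n" for i j
  proof -
    have PQ: "P $$ (i, k) \<in> carrier R" "Q $$ (k, j) \<in> carrier R" if "k < n" for k
      using that P Q \<open>i < n\<close> \<open>j < n\<close> by (auto simp: mat_over_iff)
    have "N (mat_mult R P Q $$ (i, j)) \<le> (\<Sum>k<n. N (P $$ (i, k) \<otimes> Q $$ (k, j)))"
      using P Q that PQ by (simp add: mat_over_iff) (intro norm_finsum, auto)
    also have "\<dots> \<le> (\<Sum>k<n. ?p i k * ?q k j)"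
      using PQ by (intro sum_mono norm_mult) auto
    also have "\<dots> \<le> (\<Sum>k<n. ?p i k * (\<Sum>l<n. ?q l j))"
      using that by (intro sum_mono mult_left_mono member_le_sum[of _ _ "\<lambda>l. ?q l j"]) (auto intro: nonneg)
    finally show ?thesis
      by (simp add: sum_distrib_right)
  qed
  then have "(\<Sum>i<n. \<Sum>j<n. N (mat_mult R P Q $$ (i, j))) \<le>
      (\<Sum>i<n. \<Sum>j<n. (\<Sum>k<n. ?p i k) * (\<Sum>k<n. ?q k j))"
    by (intro sum_mono) auto
  also have "\<dots> = (\<Sum>i<n. \<Sum>k<n. ?p i k) * (\<Sum>j<n. \<Sum>k<n. ?q k j)"
    by (simp add: sum_product)
  also have "(\<Sum>j<n. \<Sum>k<n. ?q k j) = (\<Sum>k<n. \<Sum>j<n. ?q k j)"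
    by (rule sum.swap)
  finally show ?thesis
    using P Q by (simp add: mat_norm_def mat_over_iff)
qed

lemma mat_ring_normed: "normed_star_ring (mat_ring R n) (mat_norm N)"
proof (rule normed_star_ring.intro[OF mat_ring_star_ring normed_star_ring_axioms.intro])
  fix P
  assume P: "P \<in> carrier (mat_ring R n)"
  show "0 \<le> mat_norm N P"
    using P by (auto simp: mat_norm_def mat_over_iff intro!: sum_nonneg norm_nonneg)
  show "P = \<zero>\<^bsub>mat_ring R n\<^esub>" if "mat_norm N P = 0"
  proof (rule eq_matI)
    fix i j
    assume ij: "i < dim_row (\<zero>\<^bsub>mat_ring R n\<^esub>)" "j < dim_col (\<zero>\<^bsub>mat_ring R n\<^esub>)"
    then have Pij: "P $$ (i, j) \<in> carrier R"
      using P by (auto simp: mat_over_iff)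
    then have "N (P $$ (i, j)) = 0"
      using norm_entry_le_mat_norm[of P n i j] P ij that norm_nonneg by fastforce
    then show "P $$ (i, j) = \<zero>\<^bsub>mat_ring R n\<^esub> $$ (i, j)"
      using norm_eq_zero[OF Pij] ij by simp
  qed (use P in \<open>auto simp: mat_over_iff\<close>)
  show "mat_norm N (\<ominus>\<^bsub>mat_ring R n\<^esub> P) = mat_norm N P"
    using P by (auto simp: mat_norm_def mat_ring_minus mat_over_iff norm_minus intro!: sum.cong)
  have "(\<Sum>i<n. \<Sum>j<n. N (star R (P $$ (j, i)))) = (\<Sum>i<n. \<Sum>j<n. N (P $$ (j, i)))"
    using P by (auto simp: mat_over_iff norm_star intro!: sum.cong)
  also have "\<dots> = (\<Sum>i<n. \<Sum>j<n. N (P $$ (i, j)))"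
    by (rule sum.swap)
  finally show "mat_norm N (star (mat_ring R n) P) = mat_norm N P"
    using P by (simp add: mat_norm_def mat_over_iff)
  fix Q
  assume Q: "Q \<in> carrier (mat_ring R n)"
  show "mat_norm N (P \<otimes>\<^bsub>mat_ring R n\<^esub> Q) \<le> mat_norm N P * mat_norm N Q"
    using P Q by (simp add: mat_norm_mult)
  have "(\<Sum>i<n. \<Sum>j<n. N (P $$ (i, j) \<oplus> Q $$ (i, j))) \<le>
      (\<Sum>i<n. \<Sum>j<n. N (P $$ (i, j)) + N (Q $$ (i, j)))"
    using P Q by (intro sum_mono norm_triangle) (auto simp: mat_over_iff)
  then show "mat_norm N (P \<oplus>\<^bsub>mat_ring R n\<^esub> Q) \<le> mat_norm N P + mat_norm N Q"
    using P Q by (simp add: mat_norm_def mat_over_iff sum.distrib)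
qed (simp add: mat_norm_def)

lemma ideal_mats_complete:
  assumes complete: "norm_complete R N J" and J: "J \<subseteq> carrier R"
  shows "norm_complete (mat_ring R n) (mat_norm N) (ideal_mats J n)"
  unfolding norm_complete_def
proof (intro allI impI)
  fix \<sigma> :: "nat \<Rightarrow> 'a mat"
  assume \<sigma>: "range \<sigma> \<subseteq> ideal_mats J n"
    and Cauchy: "\<forall>\<epsilon>>0. \<exists>M. \<forall>k\<ge>M. \<forall>l\<ge>M. mat_norm N (\<sigma> k \<ominus>\<^bsub>mat_ring R n\<^esub> \<sigma> l) < \<epsilon>"
  interpret M: normed_star_ring "mat_ring R n" "mat_norm N"
    by (rule mat_ring_normed)
  have \<sigma>J: "\<sigma> k $$ (i, j) \<in> J" if "i < n" "j < n" for k :: nat and i j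
    using \<sigma> that by (auto simp: ideal_mats_def)
  have sub: "ideal_mats J n \<subseteq> mat_over R n n"
    using subsetD[OF J] by (auto simp: ideal_mats_def mat_over_iff)
  then have \<sigma>M: "\<sigma> k \<in> mat_over R n n" for k :: nat
    using \<sigma> by auto
  have "\<exists>l\<in>J. (\<lambda>k. N (\<sigma> k $$ (i, j) \<ominus> l)) \<longlonglongrightarrow> 0" if ij: "i < n" "j < n" for i j
  proof -
    have "N (\<sigma> k $$ (i, j) \<ominus> \<sigma> l $$ (i, j)) \<le> mat_norm N (\<sigma> k \<ominus>\<^bsub>mat_ring R n\<^esub> \<sigma> l)" for k l
      using norm_entry_le_mat_norm[OF _ ij, of "\<sigma> k \<ominus>\<^bsub>mat_ring R n\<^esub> \<sigma> l"] M.minus_closed \<sigma>M ij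
      by (simp add: mat_ring_diff_index)
    then have "\<exists>M. \<forall>k\<ge>M. \<forall>l\<ge>M. N (\<sigma> k $$ (i, j) \<ominus> \<sigma> l $$ (i, j)) < \<epsilon>" if "\<epsilon> > 0" for \<epsilon>
      using Cauchy that by (meson le_less_trans)
    then show ?thesis
      by (rule norm_completeD[OF complete \<sigma>J[OF ij]]) auto
  qed
  then obtain l where l: "\<And>i j. \<lbrakk>i < n; j < n\<rbrakk> \<Longrightarrow> l i j \<in> J"
    and lim: "\<And>i j. \<lbrakk>i < n; j < n\<rbrakk> \<Longrightarrow> (\<lambda>k. N (\<sigma> k $$ (i, j) \<ominus> l i j)) \<longlonglongrightarrow> 0"
    by metis
  define L where "L = mat n n (\<lambda>(i, j). l i j)"
  have L: "L \<in> ideal_mats J n"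
    using l by (auto simp: L_def ideal_mats_def)
  have "mat_norm N (\<sigma> k \<ominus>\<^bsub>mat_ring R n\<^esub> L) = (\<Sum>i<n. \<Sum>j<n. N (\<sigma> k $$ (i, j) \<ominus> l i j))" for k
  proof -
    have "\<sigma> k \<ominus>\<^bsub>mat_ring R n\<^esub> L \<in> mat_over R n n"
      using M.minus_closed \<sigma>M L sub by auto
    then have "mat_norm N (\<sigma> k \<ominus>\<^bsub>mat_ring R n\<^esub> L) =
        (\<Sum>i<n. \<Sum>j<n. N ((\<sigma> k \<ominus>\<^bsub>mat_ring R n\<^esub> L) $$ (i, j)))"
      by (simp add: mat_norm_def mat_over_iff)
    also have "\<dots> = (\<Sum>i<n. \<Sum>j<n. N (\<sigma> k $$ (i, j) \<ominus> l i j))"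
      using \<sigma>M L sub by (intro sum.cong refl) (subst mat_ring_diff_index, auto simp: L_def)
    finally show ?thesis .
  qed
  moreover have "(\<lambda>k. \<Sum>i<n. \<Sum>j<n. N (\<sigma> k $$ (i, j) \<ominus> l i j)) \<longlonglongrightarrow> 0"
    by (intro tendsto_null_sum lim) auto
  ultimately show "\<exists>l\<in>ideal_mats J n. (\<lambda>k. mat_norm N (\<sigma> k \<ominus>\<^bsub>mat_ring R n\<^esub> l)) \<longlonglongrightarrow> 0"
    using L by (intro bexI[of _ L]) simp_all
qed

text \<open>
  The bound on the entries makes \<open>\<delta> = mat_norm N (p - q)\<close> at most \<open>1 / (4 (1 + n N e))\<close>, whence \<open>\<delta>\<^sup>2 \<le> 1/4\<close>
  and \<open>n N e \<delta>\<^sup>2 \<le> 1/16\<close>. Here \<open>n N e\<close> is the norm of the diagonal matrix with entries \<open>e\<close>.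
\<close>

theorem close_projections_mvn:
  assumes ideal: "ideal J R" and complete: "norm_complete R N J"
    and e: "e \<in> carrier R" "e \<oplus> e \<oplus> e \<oplus> e = \<one>"
    and pq: "p \<in> projections R" "q \<in> projections R" "dim_row p = n" "dim_row q = n"
    and J: "\<And>i j. \<lbrakk>i < n; j < n\<rbrakk> \<Longrightarrow> p $$ (i, j) \<ominus> q $$ (i, j) \<in> J"
    and close: "\<And>i j. \<lbrakk>i < n; j < n\<rbrakk> \<Longrightarrow>
      N (p $$ (i, j) \<ominus> q $$ (i, j)) \<le> 1 / (4 * real n ^ 2 * (1 + real n * N e))"
  shows "(p, q) \<in> mvn_rel R"
proof -
  interpret M: normed_star_ring "mat_ring R n" "mat_norm N"
    by (rule mat_ring_normed)
  have p: "p \<in> mat_over R n n" "mat_star R p = p" "mat_mult R p p = p" and n: "n \<ge> 1"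
    using pq by (auto elim!: projectionsE)
  have q: "q \<in> mat_over R n n" "mat_star R q = q" "mat_mult R q q = q"
    using pq by (auto elim!: projectionsE)
  define E where "E = mat n n (\<lambda>(i, j). if i = j then e else \<zero>)"
  have E: "E \<in> mat_over R n n"
    using e by (auto simp: E_def mat_over_iff)
  have "mat_norm N E = (\<Sum>i<n. \<Sum>j<n. if i = j then N e else 0)"
    by (simp add: mat_norm_def E_def if_distrib[of N] cong: if_cong)
  then have NE: "mat_norm N E = real n * N e"
    by simp
  let ?c = "1 / (4 * (1 + real n * N e))"
  have Ne: "0 \<le> real n * N e"
    using e norm_nonneg by simp
  have D: "p \<ominus>\<^bsub>mat_ring R n\<^esub> q \<in> mat_over R n n"
    using M.minus_closed p(1) q(1) by simp
  then have "mat_norm N (p \<ominus>\<^bsub>mat_ring R n\<^esub> q) =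
      (\<Sum>i<n. \<Sum>j<n. N ((p \<ominus>\<^bsub>mat_ring R n\<^esub> q) $$ (i, j)))"
    by (simp add: mat_norm_def mat_over_iff)
  also have "\<dots> \<le> (\<Sum>i<n. \<Sum>j<n. 1 / (4 * real n ^ 2 * (1 + real n * N e)))"
    using close p(1) q(1) by (intro sum_mono) (simp add: mat_ring_diff_index)
  also have "\<dots> = ?c"
    using n by (simp add: power2_eq_square)
  finally have le: "mat_norm N (p \<ominus>\<^bsub>mat_ring R n\<^esub> q) \<le> ?c" .
  have sq: "(mat_norm N (p \<ominus>\<^bsub>mat_ring R n\<^esub> q))\<^sup>2 \<le> ?c\<^sup>2"
    using le M.norm_nonneg D by (intro power_mono) auto
  have c: "0 \<le> ?c" "?c \<le> 1/4" "real n * N e * ?c \<le> 1/4"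
    using Ne by (auto simp: field_simps)
  have c2: "?c\<^sup>2 \<le> 1/16" "(real n * N e) * ?c\<^sup>2 \<le> 1/16"
    using c mult_mono[of ?c "1/4" ?c "1/4"] mult_mono[of "real n * N e * ?c" "1/4" ?c "1/4"]
    by (auto simp: power2_eq_square mult.assoc)
  have "\<exists>v\<in>carrier (mat_ring R n).
      star (mat_ring R n) v \<otimes>\<^bsub>mat_ring R n\<^esub> v = p \<and> v \<otimes>\<^bsub>mat_ring R n\<^esub> star (mat_ring R n) v = q"
  proof (rule M.close_projections[of "ideal_mats J n" E])
    show "ideal (ideal_mats J n) (mat_ring R n)"
      by (rule ideal_mats_ideal[OF ideal])
    show "norm_complete (mat_ring R n) (mat_norm N) (ideal_mats J n)"
      using ideal_mats_complete[OF complete] additive_subgroup.a_subset[OF ideal.axioms(1)[OF ideal]]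
      by simp
    show "E \<oplus>\<^bsub>mat_ring R n\<^esub> E \<oplus>\<^bsub>mat_ring R n\<^esub> E \<oplus>\<^bsub>mat_ring R n\<^esub> E = \<one>\<^bsub>mat_ring R n\<^esub>"
      using e by (intro eq_matI) (auto simp: E_def)
    show "p \<ominus>\<^bsub>mat_ring R n\<^esub> q \<in> ideal_mats J n"
      using D J p(1) q(1) by (auto simp: ideal_mats_def mat_over_iff mat_ring_diff_index)
    show "(mat_norm N (p \<ominus>\<^bsub>mat_ring R n\<^esub> q))\<^sup>2 \<le> 1/4"
      using sq c2 by simp
    have "mat_norm N E * (mat_norm N (p \<ominus>\<^bsub>mat_ring R n\<^esub> q))\<^sup>2 \<le> real n * N e * ?c\<^sup>2"
      unfolding NE using sq Ne by (rule mult_left_mono)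
    then show "mat_norm N E * (mat_norm N (p \<ominus>\<^bsub>mat_ring R n\<^esub> q))\<^sup>2 \<le> 1/16"
      using c2 by simp
  qed (use p q E in simp_all)
  then obtain v where "v \<in> mat_over R n n" "mat_mult R (mat_star R v) v = p" "mat_mult R v (mat_star R v) = q"
    by auto
  then show ?thesis
    using pq by (intro mvn_relI[of p q v]) auto
qed

end

section \<open>Normed algebras with involution and their unitizations\<close>

text \<open>
  The algebraic part of a C*-algebra; the unit is left to the unitization.
\<close>

locale star_algebra = module complex_alg A for A :: "('a, 'm) star_alg_scheme" (structure) +
  assumes m_closed: "\<lbrakk>x \<in> carrier A; y \<in> carrier A\<rbrakk> \<Longrightarrow> x \<otimes> y \<in> carrier A"
    and m_assoc: "\<lbrakk>x \<in> carrier A; y \<in> carrier A; z \<in> carrier A\<rbrakk> \<Longrightarrow> (x \<otimes> y) \<otimes> z = x \<otimes> (y \<otimes> z)"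
    and l_distr: "\<lbrakk>x \<in> carrier A; y \<in> carrier A; z \<in> carrier A\<rbrakk> \<Longrightarrow> (x \<oplus> y) \<otimes> z = x \<otimes> z \<oplus> y \<otimes> z"
    and r_distr: "\<lbrakk>x \<in> carrier A; y \<in> carrier A; z \<in> carrier A\<rbrakk> \<Longrightarrow> z \<otimes> (x \<oplus> y) = z \<otimes> x \<oplus> z \<otimes> y"
    and smult_mult_l: "\<lbrakk>x \<in> carrier A; y \<in> carrier A\<rbrakk> \<Longrightarrow> (c \<odot> x) \<otimes> y = c \<odot> (x \<otimes> y)"
    and smult_mult_r: "\<lbrakk>x \<in> carrier A; y \<in> carrier A\<rbrakk> \<Longrightarrow> x \<otimes> (c \<odot> y) = c \<odot> (x \<otimes> y)"
    and star_closed: "x \<in> carrier A \<Longrightarrow> star A x \<in> carrier A"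
    and star_star: "x \<in> carrier A \<Longrightarrow> star A (star A x) = x"
    and star_add: "\<lbrakk>x \<in> carrier A; y \<in> carrier A\<rbrakk> \<Longrightarrow> star A (x \<oplus> y) = star A x \<oplus> star A y"
    and star_smult: "x \<in> carrier A \<Longrightarrow> star A (c \<odot> x) = cnj c \<odot> star A x"
    and star_mult: "\<lbrakk>x \<in> carrier A; y \<in> carrier A\<rbrakk> \<Longrightarrow> star A (x \<otimes> y) = star A y \<otimes> star A x"
begin

lemma scalar_closed [simp, intro]: "x \<in> carrier A \<Longrightarrow> c \<odot> x \<in> carrier A"
  by (rule smult_closed) (simp add: complex_alg_def)

lemma scalar_add: "x \<in> carrier A \<Longrightarrow> (c + d) \<odot> x = c \<odot> x \<oplus> d \<odot> x"
  using smult_l_distr[of c d x] by (simp add: complex_alg_def)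

lemma scalar_distr: "\<lbrakk>x \<in> carrier A; y \<in> carrier A\<rbrakk> \<Longrightarrow> c \<odot> (x \<oplus> y) = c \<odot> x \<oplus> c \<odot> y"
  using smult_r_distr[of c x y] by (simp add: complex_alg_def)

lemma scalar_scalar: "x \<in> carrier A \<Longrightarrow> c \<odot> (d \<odot> x) = (c * d) \<odot> x"
  using smult_assoc1[of c d x] by (simp add: complex_alg_def)

lemma scalar_one [simp]: "x \<in> carrier A \<Longrightarrow> 1 \<odot> x = x"
  using smult_one[of x] by (simp add: complex_alg_def)

lemma scalar_zero [simp]: "x \<in> carrier A \<Longrightarrow> 0 \<odot> x = \<zero>"
  using smult_l_null[of x] by (simp add: complex_alg_def)

lemma scalar_zero_right [simp]: "c \<odot> \<zero> = \<zero>"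
  using smult_r_null[of c] by (simp add: complex_alg_def)

lemma scalar_minus_one: "x \<in> carrier A \<Longrightarrow> \<ominus> x = (-1) \<odot> x"
  using scalar_add[of x "-1" 1] by (intro M.minus_equality) simp_all

lemma mult_zero [simp]: "x \<in> carrier A \<Longrightarrow> x \<otimes> \<zero> = \<zero>" "x \<in> carrier A \<Longrightarrow> \<zero> \<otimes> x = \<zero>"
  using smult_mult_r[of x \<zero> 0] smult_mult_l[of \<zero> x 0] m_closed by auto

lemma star_zero [simp]: "star A \<zero> = \<zero>"
  using star_smult[of \<zero> 0] star_closed by simp

abbreviation U where "U \<equiv> unitization A"

lemma unitization_star_ring: "star_ring U"
proof -
  have "abelian_group U"
  proof (rule abelian_groupI)
    fix x
    assume "x \<in> carrier U"
    then show "\<exists>y\<in>carrier U. y \<oplus>\<^bsub>U\<^esub> x = \<zero>\<^bsub>U\<^esub>"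
      by (intro bexI[of _ "(\<ominus> fst x, - snd x)"]) (auto simp: unitization_def M.l_neg)
  qed (auto simp: unitization_def M.a_ac)
  moreover have "monoid U"
  proof (rule monoidI)
    fix x y z
    assume "x \<in> carrier U" "y \<in> carrier U" "z \<in> carrier U"
    then show "x \<otimes>\<^bsub>U\<^esub> y \<otimes>\<^bsub>U\<^esub> z =
        x \<otimes>\<^bsub>U\<^esub> (y \<otimes>\<^bsub>U\<^esub> z)"
      by (auto simp: unitization_def m_closed m_assoc l_distr r_distr scalar_distr scalar_scalar
          smult_mult_l smult_mult_r M.a_ac mult.commute)
  qed (auto simp: unitization_def m_closed)
  ultimately have "ring U"
    by (rule ringI) (auto simp: unitization_def m_closed l_distr r_distr scalar_distr scalar_add
        M.a_ac distrib_left distrib_right)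
  then show ?thesis
    by (rule star_ring.intro[OF _ star_ring_axioms.intro])
      (auto simp: unitization_def star_closed star_star star_add star_mult star_smult m_closed M.a_ac)
qed

lemma unitization_minus:
  assumes "x \<in> carrier U"
  shows "\<ominus>\<^bsub>U\<^esub> x = (\<ominus> fst x, - snd x)"
proof -
  interpret U: star_ring U
    by (rule unitization_star_ring)
  show ?thesis
    using assms by (intro U.minus_equality) (auto simp: unitization_def M.l_neg)
qed

lemma unitization_diff:
  assumes "x \<in> carrier U" "y \<in> carrier U"
  shows "x \<ominus>\<^bsub>U\<^esub> y = (fst x \<ominus> fst y, snd x - snd y)"
  using assms unitization_minus[OF assms(2)]
  by (auto simp: a_minus_def) (auto simp: unitization_def)

end

lemma cstar_homD:
  assumes "h \<in> cstar_hom A B"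
  shows "x \<in> carrier A \<Longrightarrow> h x \<in> carrier B"
    and "\<lbrakk>x \<in> carrier A; y \<in> carrier A\<rbrakk> \<Longrightarrow> h (x \<otimes>\<^bsub>A\<^esub> y) = h x \<otimes>\<^bsub>B\<^esub> h y"
    and "\<lbrakk>x \<in> carrier A; y \<in> carrier A\<rbrakk> \<Longrightarrow> h (x \<oplus>\<^bsub>A\<^esub> y) = h x \<oplus>\<^bsub>B\<^esub> h y"
    and "x \<in> carrier A \<Longrightarrow> h (c \<odot>\<^bsub>A\<^esub> x) = c \<odot>\<^bsub>B\<^esub> h x"
    and "x \<in> carrier A \<Longrightarrow> h (star A x) = star B (h x)"
  using assms by (auto simp: cstar_hom_def hom_def)

lemma cstar_hom_zero:
  assumes "star_algebra A" "star_algebra B" "h \<in> cstar_hom A B"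
  shows "h \<zero>\<^bsub>A\<^esub> = \<zero>\<^bsub>B\<^esub>"
proof -
  interpret A: star_algebra A by fact
  interpret B: star_algebra B by fact
  have "h (0 \<odot>\<^bsub>A\<^esub> \<zero>\<^bsub>A\<^esub>) = 0 \<odot>\<^bsub>B\<^esub> h \<zero>\<^bsub>A\<^esub>"
    by (rule cstar_homD[OF assms(3)]) simp
  then show ?thesis
    using cstar_homD(1)[OF assms(3)] by simp
qed

lemma unitization_hom:
  assumes "star_algebra A" "star_algebra B" "h \<in> cstar_hom A B"
  shows "star_ring_hom (unitization A) (unitization B) (map_prod h id)"
proof -
  interpret A: star_algebra A by fact
  interpret B: star_algebra B by fact
  note h = cstar_homD[OF assms(3)]
  have "map_prod h id \<in> ring_hom (unitization A) (unitization B)"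
    by (rule ring_hom_memI) (auto simp: unitization_def h A.m_closed cstar_hom_zero[OF assms])
  then show ?thesis
    by (intro star_ring_hom.intro star_ring_hom_axioms.intro A.unitization_star_ring
        B.unitization_star_ring) (auto simp: unitization_def h)
qed

locale normed_star_algebra = star_algebra A for A :: "('a, 'm) star_alg_scheme" (structure) +
  fixes N :: "'a \<Rightarrow> real"
  assumes norm_nonneg: "x \<in> carrier A \<Longrightarrow> 0 \<le> N x"
    and norm_eq_zero: "\<lbrakk>x \<in> carrier A; N x = 0\<rbrakk> \<Longrightarrow> x = \<zero>"
    and norm_triangle: "\<lbrakk>x \<in> carrier A; y \<in> carrier A\<rbrakk> \<Longrightarrow> N (x \<oplus> y) \<le> N x + N y"
    and norm_scalar: "x \<in> carrier A \<Longrightarrow> N (c \<odot> x) = cmod c * N x"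
    and norm_mult: "\<lbrakk>x \<in> carrier A; y \<in> carrier A\<rbrakk> \<Longrightarrow> N (x \<otimes> y) \<le> N x * N y"
    and norm_star: "x \<in> carrier A \<Longrightarrow> N (star A x) = N x"
begin

lemma norm_zero [simp]: "N \<zero> = 0"
  using norm_scalar[of \<zero> 0] by simp

lemma norm_minus: "x \<in> carrier A \<Longrightarrow> N (\<ominus> x) = N x"
  by (simp add: scalar_minus_one norm_scalar)

text \<open>
  The sum of the norms of the two parts is submultiplicative, and on an ideal of \<open>A\<close> it is the given norm.
\<close>

lemma unitization_normed: "normed_star_ring U (\<lambda>x. N (fst x) + cmod (snd x))"
proof (rule normed_star_ring.intro[OF unitization_star_ring normed_star_ring_axioms.intro])
  fix x
  assume x: "x \<in> carrier U"
  then have fx: "fst x \<in> carrier A"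
    by (auto simp: unitization_def)
  show "0 \<le> N (fst x) + cmod (snd x)"
    using fx norm_nonneg by simp
  show "x = \<zero>\<^bsub>U\<^esub>" if "N (fst x) + cmod (snd x) = 0"
    using that fx norm_nonneg[OF fx] norm_eq_zero[OF fx] norm_ge_zero[of "snd x"]
    by (auto simp: unitization_def prod_eq_iff add_nonneg_eq_0_iff)
  show "N (fst (\<ominus>\<^bsub>U\<^esub> x)) + cmod (snd (\<ominus>\<^bsub>U\<^esub> x)) = N (fst x) + cmod (snd x)"
    using x fx by (simp add: unitization_minus norm_minus)
  show "N (fst (star U x)) + cmod (snd (star U x)) = N (fst x) + cmod (snd x)"
    using fx by (simp add: unitization_def case_prod_unfold norm_star)
  fix y
  assume y: "y \<in> carrier U"
  then have fy: "fst y \<in> carrier A"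
    by (auto simp: unitization_def)
  show "N (fst (x \<oplus>\<^bsub>U\<^esub> y)) + cmod (snd (x \<oplus>\<^bsub>U\<^esub> y)) \<le>
      N (fst x) + cmod (snd x) + (N (fst y) + cmod (snd y))"
    using norm_triangle[OF fx fy] norm_triangle_ineq[of "snd x" "snd y"]
    by (simp add: unitization_def case_prod_unfold)
  have "N (fst x \<otimes> fst y \<oplus> snd y \<odot> fst x \<oplus> snd x \<odot> fst y) \<le>
      N (fst x \<otimes> fst y \<oplus> snd y \<odot> fst x) + N (snd x \<odot> fst y)"
    using fx fy m_closed by (intro norm_triangle) auto
  also have "N (fst x \<otimes> fst y \<oplus> snd y \<odot> fst x) \<le> N (fst x \<otimes> fst y) + N (snd y \<odot> fst x)"
    using fx fy m_closed by (intro norm_triangle) auto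
  finally have "N (fst x \<otimes> fst y \<oplus> snd y \<odot> fst x \<oplus> snd x \<odot> fst y) \<le>
      N (fst x) * N (fst y) + cmod (snd y) * N (fst x) + cmod (snd x) * N (fst y)"
    using norm_mult[OF fx fy] fx fy by (simp add: norm_scalar)
  then show "N (fst (x \<otimes>\<^bsub>U\<^esub> y)) + cmod (snd (x \<otimes>\<^bsub>U\<^esub> y)) \<le>
      (N (fst x) + cmod (snd x)) * (N (fst y) + cmod (snd y))"
    by (simp add: unitization_def case_prod_unfold Real_Vector_Spaces.norm_mult algebra_simps)
qed (simp add: unitization_def)

end

section \<open>Homotopy invariance of projections\<close>

text \<open>
  An ideal that is complete in its own right, inside an algebra that need not be. Homotopies whose
  increments stay in such an ideal move projections within their equivalence class.
\<close>

locale complete_ideal = normed_star_algebra A N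
  for A :: "('a, 'm) star_alg_scheme" (structure) and N :: "'a \<Rightarrow> real" +
  fixes J :: "'a set"
  assumes ideal_subset: "J \<subseteq> carrier A"
    and ideal_zero: "\<zero> \<in> J"
    and ideal_add: "\<lbrakk>x \<in> J; y \<in> J\<rbrakk> \<Longrightarrow> x \<oplus> y \<in> J"
    and ideal_scalar: "x \<in> J \<Longrightarrow> c \<odot> x \<in> J"
    and ideal_mult: "\<lbrakk>x \<in> J; y \<in> carrier A\<rbrakk> \<Longrightarrow> x \<otimes> y \<in> J" "\<lbrakk>x \<in> J; y \<in> carrier A\<rbrakk> \<Longrightarrow> y \<otimes> x \<in> J"
    and ideal_complete: "norm_complete A N J"
begin

lemma unitization_ideal: "ideal (J \<times> {0 :: complex}) U"
proof -
  interpret U: star_ring U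
    by (rule unitization_star_ring)
  have "subgroup (J \<times> {0 :: complex}) (add_monoid U)"
  proof (rule U.add.subgroupI)
    show "J \<times> {0 :: complex} \<subseteq> carrier U"
      using ideal_subset by (auto simp: unitization_def)
    fix x
    assume x: "x \<in> J \<times> {0 :: complex}"
    then have "x \<in> carrier U"
      using ideal_subset by (auto simp: unitization_def)
    then show "\<ominus>\<^bsub>U\<^esub> x \<in> J \<times> {0 :: complex}"
      using x subsetD[OF ideal_subset]
      by (auto simp: unitization_minus scalar_minus_one intro!: ideal_scalar)
  qed (use ideal_zero in \<open>auto simp: unitization_def intro: ideal_add\<close>)
  then show ?thesis
  proof (rule idealI[OF U.ring_axioms])
    fix x y
    assume "x \<in> J \<times> {0 :: complex}" "y \<in> carrier U"
    then obtain a b c where "x = (a, 0)" "y = (b, c)" "a \<in> J" "a \<in> carrier A" "b \<in> carrier A"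
      using ideal_subset by (auto simp: unitization_def)
    then show "y \<otimes>\<^bsub>U\<^esub> x \<in> J \<times> {0}" "x \<otimes>\<^bsub>U\<^esub> y \<in> J \<times> {0}"
      using ideal_mult[of a b] ideal_scalar[of a c] ideal_zero
      by (auto simp: unitization_def m_closed intro: ideal_add)
  qed
qed

lemma unitization_ideal_complete:
  "norm_complete U (\<lambda>x. N (fst x) + cmod (snd x)) (J \<times> {0 :: complex})"
  unfolding norm_complete_def
proof (intro allI impI)
  fix \<sigma> :: "nat \<Rightarrow> 'a \<times> complex"
  assume \<sigma>: "range \<sigma> \<subseteq> J \<times> {0 :: complex}"
    and Cauchy: "\<forall>\<epsilon>>0. \<exists>M. \<forall>m\<ge>M. \<forall>n\<ge>M. N (fst (\<sigma> m \<ominus>\<^bsub>U\<^esub> \<sigma> n)) +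
        cmod (snd (\<sigma> m \<ominus>\<^bsub>U\<^esub> \<sigma> n)) < \<epsilon>"
  have fJ: "fst (\<sigma> n) \<in> J" and s0: "snd (\<sigma> n) = 0" for n
    using \<sigma> by (auto simp: image_subset_iff mem_Times_iff)
  have "\<sigma> n \<in> carrier U" for n
    using fJ ideal_subset by (auto simp: unitization_def mem_Times_iff)
  then have diff: "\<sigma> m \<ominus>\<^bsub>U\<^esub> y = (fst (\<sigma> m) \<ominus> fst y, - snd y)"
    if "y \<in> carrier U" for m y
    using that by (simp add: unitization_diff s0)
  have "\<exists>M. \<forall>m\<ge>M. \<forall>n\<ge>M. N (fst (\<sigma> m) \<ominus> fst (\<sigma> n)) < \<epsilon>" if "\<epsilon> > 0" for \<epsilon>
    using Cauchy that \<open>\<And>n. \<sigma> n \<in> carrier U\<close> by (simp add: diff s0)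
  then obtain l where l: "l \<in> J" "(\<lambda>n. N (fst (\<sigma> n) \<ominus> l)) \<longlonglongrightarrow> 0"
    by (rule norm_completeD[OF ideal_complete fJ]) auto
  then have "(l, 0) \<in> carrier U"
    using ideal_subset by (auto simp: unitization_def)
  then have "(\<lambda>n. N (fst (\<sigma> n \<ominus>\<^bsub>U\<^esub> (l, 0))) + cmod (snd (\<sigma> n \<ominus>\<^bsub>U\<^esub> (l, 0)))) \<longlonglongrightarrow> 0"
    using l by (simp add: diff)
  then show "\<exists>l\<in>J \<times> {0 :: complex}. (\<lambda>n. N (fst (\<sigma> n \<ominus>\<^bsub>U\<^esub> l)) +
      cmod (snd (\<sigma> n \<ominus>\<^bsub>U\<^esub> l))) \<longlonglongrightarrow> 0"
    using l by blast
qed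

end

text \<open>
  Since a matrix has finitely many entries, one step width serves for all of them; the projections at
  successive multiples of \<open>1/m\<close> are then close enough to be equivalent, and transitivity does the rest.
\<close>

theorem homotopic_projections_mvn:
  fixes A :: "('a, 'm) cstar_alg_scheme" (structure)
  assumes "complete_ideal A N J"
    and hom: "\<And>u. u \<in> {0..1::real} \<Longrightarrow> \<phi> u \<in> cstar_hom A A"
    and J: "\<And>u u' x. \<lbrakk>u \<in> {0..1}; u' \<in> {0..1}; x \<in> carrier A\<rbrakk> \<Longrightarrow> \<phi> u x \<ominus> \<phi> u' x \<in> J"
    and cont: "\<And>x \<epsilon>. \<lbrakk>x \<in> carrier A; \<epsilon> > 0\<rbrakk> \<Longrightarrow>
      \<exists>\<delta>>0. \<forall>u\<in>{0..1}. \<forall>u'\<in>{0..1}. \<bar>u - u'\<bar> < \<delta> \<longrightarrow> N (\<phi> u x \<ominus> \<phi> u' x) \<le> \<epsilon>"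
    and p: "p \<in> projections (unitization A)"
  shows "(map_mat (map_prod (\<phi> 0) id) p, map_mat (map_prod (\<phi> 1) id) p) \<in> mvn_rel (unitization A)"
proof -
  interpret complete_ideal A N J
    by fact
  let ?N = "\<lambda>x. N (fst x) + cmod (snd x)"
  interpret U: normed_star_ring U ?N
    by (rule unitization_normed)
  let ?q = "\<lambda>u. map_mat (map_prod (\<phi> u) id) p"
  obtain n where n: "n \<ge> 1" "p \<in> mat_over U n n" "dim_row p = n" "dim_col p = n"
    using p by (rule U.projectionsE)
  have pij: "p $$ (i, j) \<in> carrier U" "fst (p $$ (i, j)) \<in> carrier A" if "i < n" "j < n" for i j
    using n that by (auto simp: mat_over_iff unitization_def mem_Times_iff)
  have q: "?q u \<in> projections U" if "u \<in> {0..1}" for u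
    using star_ring_hom.map_mat_projection[OF unitization_hom[OF star_algebra_axioms star_algebra_axioms hom[OF that]] p] .
  have diff: "?q u $$ (i, j) \<ominus>\<^bsub>U\<^esub> ?q u' $$ (i, j) =
      (\<phi> u (fst (p $$ (i, j))) \<ominus> \<phi> u' (fst (p $$ (i, j))), 0)"
    if "u \<in> {0..1}" "u' \<in> {0..1}" "i < n" "j < n" for u u' i j
  proof -
    have "map_prod (\<phi> w) id (p $$ (i, j)) \<in> carrier U" if "w \<in> {0..1}" for w
      using cstar_homD(1)[OF hom[OF that] pij(2)[OF \<open>i < n\<close> \<open>j < n\<close>]]
      by (simp add: unitization_def mem_Times_iff)
    then show ?thesis
      using that n by (simp add: unitization_diff)
  qed
  \<comment> \<open>the bound that \<open>close_projections_mvn\<close> asks for, with the scalar \<open>1/4\<close> in the place of \<open>e\<close>\<close>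
  define \<epsilon> where "\<epsilon> = 1 / (4 * real n ^ 2 * (1 + real n * ?N (\<zero>, 1/4)))"
  have "\<epsilon> > 0"
    using n by (auto simp: \<epsilon>_def intro!: divide_pos_pos mult_pos_pos add_pos_nonneg)
  have step: "(?q u, ?q u') \<in> mvn_rel U"
    if u: "u \<in> {0..1}" "u' \<in> {0..1}"
      and close: "\<And>i j. \<lbrakk>i < n; j < n\<rbrakk> \<Longrightarrow> N (\<phi> u (fst (p $$ (i, j))) \<ominus> \<phi> u' (fst (p $$ (i, j)))) \<le> \<epsilon>"
    for u u'
  proof (rule U.close_projections_mvn[OF unitization_ideal unitization_ideal_complete])
    show "(\<zero>, 1/4) \<oplus>\<^bsub>U\<^esub> (\<zero>, 1/4) \<oplus>\<^bsub>U\<^esub> (\<zero>, 1/4) \<oplus>\<^bsub>U\<^esub> (\<zero>, 1/4) =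
        \<one>\<^bsub>U\<^esub>" "(\<zero>, 1/4) \<in> carrier U"
      by (simp_all add: unitization_def)
    fix i j
    assume ij: "i < n" "j < n"
    show "?q u $$ (i, j) \<ominus>\<^bsub>U\<^esub> ?q u' $$ (i, j) \<in> J \<times> {0 :: complex}"
      using J[OF u pij(2)[OF ij]] diff[OF u ij] by simp
    show "?N (?q u $$ (i, j) \<ominus>\<^bsub>U\<^esub> ?q u' $$ (i, j)) \<le>
        1 / (4 * real n ^ 2 * (1 + real n * ?N (\<zero>, 1/4)))"
      using close[OF ij] diff[OF u ij] by (simp add: \<epsilon>_def)
  qed (use q u n in auto)
  have "\<forall>\<^sub>F m in sequentially. \<forall>i<n. \<forall>j<n. \<forall>u\<in>{0..1}. \<forall>u'\<in>{0..1}. \<bar>u - u'\<bar> \<le> 1 / real m \<longrightarrow>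
      N (\<phi> u (fst (p $$ (i, j))) \<ominus> \<phi> u' (fst (p $$ (i, j)))) \<le> \<epsilon>"
  proof -
    have "\<forall>\<^sub>F m in sequentially. \<forall>u\<in>{0..1}. \<forall>u'\<in>{0..1}. \<bar>u - u'\<bar> \<le> 1 / real m \<longrightarrow>
        N (\<phi> u (fst (p $$ (i, j))) \<ominus> \<phi> u' (fst (p $$ (i, j)))) \<le> \<epsilon>" if ij: "i < n" "j < n" for i j
    proof -
      obtain \<delta> where \<delta>: "\<delta> > 0" "\<And>u u'. \<lbrakk>u \<in> {0..1}; u' \<in> {0..1}; \<bar>u - u'\<bar> < \<delta>\<rbrakk> \<Longrightarrow>
          N (\<phi> u (fst (p $$ (i, j))) \<ominus> \<phi> u' (fst (p $$ (i, j)))) \<le> \<epsilon>"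
        using cont[OF pij(2)[OF ij] \<open>\<epsilon> > 0\<close>] by blast
      have "\<forall>\<^sub>F m in sequentially. 1 / real m < \<delta>"
        using order_tendstoD(2)[OF lim_1_over_n \<delta>(1)] .
      then show ?thesis
      proof eventually_elim
        case (elim m)
        then show ?case
          by (intro ballI impI \<delta>(2)) (assumption | erule (1) le_less_trans)+
      qed
    qed
    then have "\<forall>\<^sub>F m in sequentially. \<forall>i\<in>{..<n}. \<forall>j\<in>{..<n}. \<forall>u\<in>{0..1}. \<forall>u'\<in>{0..1}. \<bar>u - u'\<bar> \<le> 1 / real m \<longrightarrow>
        N (\<phi> u (fst (p $$ (i, j))) \<ominus> \<phi> u' (fst (p $$ (i, j)))) \<le> \<epsilon>"
      by (intro ballI eventually_ball_finite[OF finite_lessThan]) auto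
    then show ?thesis
      by eventually_elim auto
  qed
  then obtain M where M: "\<And>m i j u u'. \<lbrakk>m \<ge> M; i < n; j < n; u \<in> {0..1}; u' \<in> {0..1}; \<bar>u - u'\<bar> \<le> 1 / real m\<rbrakk> \<Longrightarrow>
      N (\<phi> u (fst (p $$ (i, j))) \<ominus> \<phi> u' (fst (p $$ (i, j)))) \<le> \<epsilon>"
    unfolding eventually_sequentially by blast
  define m where "m = Suc M"
  have "(?q 0, ?q (real k / real m)) \<in> mvn_rel U" if "k \<le> m" for k
    using that
  proof (induction k)
    case 0
    then show ?case
      using equiv_class_self[OF U.mvn_equiv q[of 0]]
      by (simp only: of_nat_0 div_0 Image_singleton_iff atLeastAtMost_iff order_refl zero_le_one simp_thms)
  next
    case (Suc k)
    have u: "real k / real m \<in> {0..1}" "real (Suc k) / real m \<in> {0..1}"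
      using Suc.prems by (auto simp: m_def)
    have "\<bar>real k / real m - real (Suc k) / real m\<bar> \<le> 1 / real m"
      by (simp add: field_simps m_def)
    then have "(?q (real k / real m), ?q (real (Suc k) / real m)) \<in> mvn_rel U"
      using u by (intro step M[of m]) (auto simp: m_def)
    then show ?case
      using Suc U.mvn_equiv by (meson Suc_leD equivE transD)
  qed
  from this[of m] show ?thesis
    by (simp add: m_def)
qed

section \<open>Transport of Grothendieck groups\<close>

lemma groth_rel_image:
  assumes bij: "bij_betw \<Phi> (carrier S) (carrier S')"
    and closed: "\<And>x y. \<lbrakk>x \<in> carrier S; y \<in> carrier S\<rbrakk> \<Longrightarrow> x \<otimes>\<^bsub>S\<^esub> y \<in> carrier S"
    and mult: "\<And>x y. \<lbrakk>x \<in> carrier S; y \<in> carrier S\<rbrakk> \<Longrightarrow> \<Phi> (x \<otimes>\<^bsub>S\<^esub> y) = \<Phi> x \<otimes>\<^bsub>S'\<^esub> \<Phi> y"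
    and x: "x \<in> carrier S" and y: "y \<in> carrier S"
  shows "map_prod \<Phi> \<Phi> ` (groth_rel S `` {(x, y)}) = groth_rel S' `` {(\<Phi> x, \<Phi> y)}"
proof -
  have inj: "inj_on \<Phi> (carrier S)" and surj: "\<Phi> ` carrier S = carrier S'"
    using bij by (auto simp: bij_betw_def)
  have rel: "((x, y), (u, w)) \<in> groth_rel S \<longleftrightarrow> ((\<Phi> x, \<Phi> y), (\<Phi> u, \<Phi> w)) \<in> groth_rel S'"
    if uw: "u \<in> carrier S" "w \<in> carrier S" for u w
  proof -
    have "(x \<otimes>\<^bsub>S\<^esub> w \<otimes>\<^bsub>S\<^esub> z = u \<otimes>\<^bsub>S\<^esub> y \<otimes>\<^bsub>S\<^esub> z) \<longleftrightarrow>
        (\<Phi> x \<otimes>\<^bsub>S'\<^esub> \<Phi> w \<otimes>\<^bsub>S'\<^esub> \<Phi> z = \<Phi> u \<otimes>\<^bsub>S'\<^esub> \<Phi> y \<otimes>\<^bsub>S'\<^esub> \<Phi> z)"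
      if z: "z \<in> carrier S" for z
    proof -
      have "x \<otimes>\<^bsub>S\<^esub> w \<in> carrier S" "u \<otimes>\<^bsub>S\<^esub> y \<in> carrier S"
        using x y uw by (auto intro: closed)
      moreover from this have "x \<otimes>\<^bsub>S\<^esub> w \<otimes>\<^bsub>S\<^esub> z \<in> carrier S" "u \<otimes>\<^bsub>S\<^esub> y \<otimes>\<^bsub>S\<^esub> z \<in> carrier S"
        using z by (auto intro: closed)
      ultimately show ?thesis
        using inj_on_eq_iff[OF inj] x y uw z by (simp flip: mult)
    qed
    then have "(\<exists>z\<in>carrier S. x \<otimes>\<^bsub>S\<^esub> w \<otimes>\<^bsub>S\<^esub> z = u \<otimes>\<^bsub>S\<^esub> y \<otimes>\<^bsub>S\<^esub> z) \<longleftrightarrow>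
        (\<exists>z\<in>\<Phi> ` carrier S. \<Phi> x \<otimes>\<^bsub>S'\<^esub> \<Phi> w \<otimes>\<^bsub>S'\<^esub> z = \<Phi> u \<otimes>\<^bsub>S'\<^esub> \<Phi> y \<otimes>\<^bsub>S'\<^esub> z)"
      by simp
    moreover have "\<Phi> x \<in> carrier S'" "\<Phi> y \<in> carrier S'" "\<Phi> u \<in> carrier S'" "\<Phi> w \<in> carrier S'"
      using x y uw surj by blast+
    ultimately show ?thesis
      using x y uw unfolding groth_rel_def surj by simp
  qed
  show ?thesis
  proof (intro equalityI subsetI)
    fix t
    assume "t \<in> map_prod \<Phi> \<Phi> ` (groth_rel S `` {(x, y)})"
    then obtain u w where "((x, y), (u, w)) \<in> groth_rel S" "t = (\<Phi> u, \<Phi> w)"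
      by auto
    moreover from this have "u \<in> carrier S" "w \<in> carrier S"
      by (auto simp: groth_rel_def)
    ultimately show "t \<in> groth_rel S' `` {(\<Phi> x, \<Phi> y)}"
      using rel by auto
  next
    fix t
    assume "t \<in> groth_rel S' `` {(\<Phi> x, \<Phi> y)}"
    then obtain u' w' where t: "((\<Phi> x, \<Phi> y), (u', w')) \<in> groth_rel S'" "t = (u', w')"
      by (cases t) auto
    then have "u' \<in> carrier S'" "w' \<in> carrier S'"
      by (auto simp: groth_rel_def)
    then obtain u w where uw: "u \<in> carrier S" "w \<in> carrier S" "u' = \<Phi> u" "w' = \<Phi> w"
      using surj by blast
    then show "t \<in> map_prod \<Phi> \<Phi> ` (groth_rel S `` {(x, y)})"
      using rel[of u w] t by (force intro!: image_eqI[of _ _ "(u, w)"])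
  qed
qed

text \<open>
  The carrier, the relation and the product of the Grothendieck construction are defined from the
  carrier and the product of the monoid alone. Therefore a bijection that respects products induces an
  isomorphism, which simply takes images of classes.
\<close>

lemma groth_group_transport:
  assumes bij: "bij_betw \<Phi> (carrier S) (carrier S')"
    and closed: "\<And>x y. \<lbrakk>x \<in> carrier S; y \<in> carrier S\<rbrakk> \<Longrightarrow> x \<otimes>\<^bsub>S\<^esub> y \<in> carrier S"
    and mult: "\<And>x y. \<lbrakk>x \<in> carrier S; y \<in> carrier S\<rbrakk> \<Longrightarrow> \<Phi> (x \<otimes>\<^bsub>S\<^esub> y) = \<Phi> x \<otimes>\<^bsub>S'\<^esub> \<Phi> y"
  shows "(`) (map_prod \<Phi> \<Phi>) \<in> iso (groth_group S) (groth_group S')"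
proof -
  let ?F = "(`) (map_prod \<Phi> \<Phi>)"
  have image: "?F (groth_rel S `` {(x, y)}) = groth_rel S' `` {(\<Phi> x, \<Phi> y)}"
    if "x \<in> carrier S" "y \<in> carrier S" for x y
    using that by (intro groth_rel_image bij closed mult)
  have inj: "inj_on \<Phi> (carrier S)" and surj: "\<Phi> ` carrier S = carrier S'"
    using bij by (auto simp: bij_betw_def)
  have sub: "X \<subseteq> carrier S \<times> carrier S" if "X \<in> carrier (groth_group S)" for X
    using that by (auto simp: groth_group_def groth_rel_def elim!: quotientE)
  have "bij_betw ?F (carrier (groth_group S)) (carrier (groth_group S'))"
    unfolding bij_betw_def
  proof
    have "inj_on (map_prod \<Phi> \<Phi>) (carrier S \<times> carrier S)"
      using inj by (simp add: map_prod_inj_on)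
    then show "inj_on ?F (carrier (groth_group S))"
      using sub by (intro inj_onI) (meson inj_on_image_eq_iff)
    have "?F ` carrier (groth_group S) =
        (\<lambda>(x, y). ?F (groth_rel S `` {(x, y)})) ` (carrier S \<times> carrier S)"
      by (auto simp: groth_group_def quotient_def)
    also have "\<dots> = (\<lambda>(x, y). groth_rel S' `` {(\<Phi> x, \<Phi> y)}) ` (carrier S \<times> carrier S)"
    proof (rule image_cong[OF refl], clarify)
      fix x y
      assume "x \<in> carrier S" "y \<in> carrier S"
      then show "?F (groth_rel S `` {(x, y)}) = groth_rel S' `` {(\<Phi> x, \<Phi> y)}"
        by (rule image)
    qed
    also have "\<dots> = carrier (groth_group S')"
      unfolding groth_group_def quotient_def surj[symmetric] by force
    finally show "?F ` carrier (groth_group S) = carrier (groth_group S')" .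
  qed
  moreover have "?F (X \<otimes>\<^bsub>groth_group S\<^esub> Y) = ?F X \<otimes>\<^bsub>groth_group S'\<^esub> ?F Y"
    if "X \<in> carrier (groth_group S)" "Y \<in> carrier (groth_group S)" for X Y
  proof -
    have "?F (X \<otimes>\<^bsub>groth_group S\<^esub> Y) =
        (\<Union>(x, y)\<in>X. \<Union>(x', y')\<in>Y. ?F (groth_rel S `` {(x \<otimes>\<^bsub>S\<^esub> x', y \<otimes>\<^bsub>S\<^esub> y')}))"
      by (simp add: groth_group_def image_UN case_prod_unfold)
    also have "\<dots> = (\<Union>(x, y)\<in>X. \<Union>(x', y')\<in>Y.
        groth_rel S' `` {(\<Phi> x \<otimes>\<^bsub>S'\<^esub> \<Phi> x', \<Phi> y \<otimes>\<^bsub>S'\<^esub> \<Phi> y')})"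
    proof (intro SUP_cong refl, clarify, intro SUP_cong refl, clarify)
      fix x y x' y'
      assume "(x, y) \<in> X" "(x', y') \<in> Y"
      then have "x \<in> carrier S" "y \<in> carrier S" "x' \<in> carrier S" "y' \<in> carrier S"
        using sub that by auto
      then show "?F (groth_rel S `` {(x \<otimes>\<^bsub>S\<^esub> x', y \<otimes>\<^bsub>S\<^esub> y')}) =
          groth_rel S' `` {(\<Phi> x \<otimes>\<^bsub>S'\<^esub> \<Phi> x', \<Phi> y \<otimes>\<^bsub>S'\<^esub> \<Phi> y')}"
        using image[of "x \<otimes>\<^bsub>S\<^esub> x'" "y \<otimes>\<^bsub>S\<^esub> y'"] closed mult by simp
    qed
    also have "\<dots> = ?F X \<otimes>\<^bsub>groth_group S'\<^esub> ?F Y"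
      by (simp add: groth_group_def case_prod_unfold)
    finally show ?thesis .
  qed
  ultimately show ?thesis
    by (auto simp: iso_def hom_def dest: bij_betwE)
qed

section \<open>Invariance of \<open>K\<^sub>0\<close>\<close>

text \<open>
  A retraction \<open>r\<close> with section \<open>s\<close> for which \<open>s \<circ> r\<close> does not change the class of a projection. This is
  what remains of a deformation retraction at the level of projections.
\<close>

locale star_ring_deformation_retract =
  s: star_ring_hom R S s + r: star_ring_hom S R r
  for R :: "('a, 'm) star_alg_scheme" and S :: "('b, 'n) star_alg_scheme" and s r +
  assumes retract: "x \<in> carrier R \<Longrightarrow> r (s x) = x"
    and homotopic: "p \<in> projections S \<Longrightarrow> (map_mat s (map_mat r p), p) \<in> mvn_rel S"
begin

definition class_map :: "'a mat set \<Rightarrow> 'b mat set" where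
  "class_map X = mvn_rel S `` (map_mat s ` X)"

lemma map_mat_retract:
  assumes "p \<in> projections R"
  shows "map_mat r (map_mat s p) = p"
proof -
  obtain n where "p \<in> mat_over R n n"
    using assms by (rule s.R.projectionsE)
  then show ?thesis
    by (intro eq_matI) (auto simp: mat_over_iff retract)
qed

lemma proj_monoid_carrierE:
  assumes "X \<in> carrier (proj_monoid R)"
  obtains p where "p \<in> projections R" "X = mvn_rel R `` {p}"
  using assms by (auto simp: proj_monoid_def elim!: quotientE)

lemma class_map_class:
  assumes "p \<in> projections R"
  shows "class_map (mvn_rel R `` {p}) = mvn_rel S `` {map_mat s p}"
proof -
  note eq = s.S.mvn_equiv
  have "mvn_rel S `` {map_mat s q} = mvn_rel S `` {map_mat s p}" if "(p, q) \<in> mvn_rel R" for q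
    using s.map_mat_mvn_rel[OF that] by (metis equiv_class_eq[OF eq])
  moreover have "p \<in> mvn_rel R `` {p}"
    using equiv_class_self[OF s.R.mvn_equiv assms] .
  ultimately show ?thesis
    unfolding class_map_def by blast
qed

end

lemma (in star_ring) proj_monoid_mult_class:
  assumes "p \<in> projections R" "q \<in> projections R"
  shows "mult (proj_monoid R) (mvn_rel R `` {p}) (mvn_rel R `` {q}) = mvn_rel R `` {mat_dsum R p q}"
proof -
  have "mvn_rel R `` {mat_dsum R p' q'} = mvn_rel R `` {mat_dsum R p q}"
    if "(p, p') \<in> mvn_rel R" "(q, q') \<in> mvn_rel R" for p' q'
    using mvn_rel_dsum[OF that] equiv_class_eq[OF mvn_equiv] by metis
  then have "(\<Union>p'\<in>mvn_rel R `` {p}. \<Union>q'\<in>mvn_rel R `` {q}. mvn_rel R `` {mat_dsum R p' q'}) =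
      (\<Union>p'\<in>mvn_rel R `` {p}. \<Union>q'\<in>mvn_rel R `` {q}. mvn_rel R `` {mat_dsum R p q})"
    by (intro SUP_cong refl) simp
  moreover have "mvn_rel R `` {p} \<noteq> {}" "mvn_rel R `` {q} \<noteq> {}"
    using equiv_class_self[OF mvn_equiv] assms by blast+
  ultimately show ?thesis
    by (simp add: proj_monoid_def)
qed

context star_ring_deformation_retract
begin

lemma class_map_bij: "bij_betw class_map (carrier (proj_monoid R)) (carrier (proj_monoid S))"
  unfolding bij_betw_def
proof
  show "inj_on class_map (carrier (proj_monoid R))"
  proof (rule inj_onI)
    fix X Y
    assume X: "X \<in> carrier (proj_monoid R)" and Y: "Y \<in> carrier (proj_monoid R)"
      and eq: "class_map X = class_map Y"
    obtain p where p: "p \<in> projections R" "X = mvn_rel R `` {p}"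
      using X by (rule proj_monoid_carrierE)
    obtain q where q: "q \<in> projections R" "Y = mvn_rel R `` {q}"
      using Y by (rule proj_monoid_carrierE)
    have "(map_mat s p, map_mat s q) \<in> mvn_rel S"
      using eq p q s.map_mat_projection eq_equiv_class[OF _ s.S.mvn_equiv]
      by (simp add: class_map_class)
    from r.map_mat_mvn_rel[OF this] show "X = Y"
      using p q by (simp add: map_mat_retract equiv_class_eq[OF s.R.mvn_equiv])
  qed
  show "class_map ` carrier (proj_monoid R) = carrier (proj_monoid S)"
  proof (intro equalityI subsetI)
    fix Y
    assume "Y \<in> class_map ` carrier (proj_monoid R)"
    then show "Y \<in> carrier (proj_monoid S)"
      using s.map_mat_projection
      by (auto simp: proj_monoid_def class_map_class elim!: quotientE intro!: quotientI)
  next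
    fix Y
    assume "Y \<in> carrier (proj_monoid S)"
    then obtain q where q: "q \<in> projections S" "Y = mvn_rel S `` {q}"
      by (auto simp: proj_monoid_def elim!: quotientE)
    have "class_map (mvn_rel R `` {map_mat r q}) = mvn_rel S `` {map_mat s (map_mat r q)}"
      using q r.map_mat_projection by (simp add: class_map_class)
    also have "\<dots> = Y"
      using q homotopic equiv_class_eq[OF s.S.mvn_equiv] by simp
    finally show "Y \<in> class_map ` carrier (proj_monoid R)"
      using q r.map_mat_projection
      by (force simp: proj_monoid_def intro!: image_eqI[of _ _ "mvn_rel R `` {map_mat r q}"] quotientI)
  qed
qed

lemma proj_monoid_closed:
  assumes "X \<in> carrier (proj_monoid R)" "Y \<in> carrier (proj_monoid R)"
  shows "mult (proj_monoid R) X Y \<in> carrier (proj_monoid R)"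
proof -
  obtain p where p: "p \<in> projections R" "X = mvn_rel R `` {p}"
    using assms(1) by (rule proj_monoid_carrierE)
  obtain q where q: "q \<in> projections R" "Y = mvn_rel R `` {q}"
    using assms(2) by (rule proj_monoid_carrierE)
  have "mult (proj_monoid R) X Y = mvn_rel R `` {mat_dsum R p q}"
    using p q by (simp add: s.R.proj_monoid_mult_class)
  then show ?thesis
    using p q by (simp add: proj_monoid_def quotientI s.R.dsum_projection)
qed

lemma class_map_mult:
  assumes "X \<in> carrier (proj_monoid R)" "Y \<in> carrier (proj_monoid R)"
  shows "class_map (mult (proj_monoid R) X Y) = mult (proj_monoid S) (class_map X) (class_map Y)"
proof -
  obtain p where p: "p \<in> projections R" "X = mvn_rel R `` {p}"
    using assms(1) by (rule proj_monoid_carrierE)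
  obtain q where q: "q \<in> projections R" "Y = mvn_rel R `` {q}"
    using assms(2) by (rule proj_monoid_carrierE)
  show ?thesis
    using p q by (simp add: s.R.proj_monoid_mult_class s.S.proj_monoid_mult_class class_map_class
        s.R.dsum_projection s.map_mat_projection s.map_mat_dsum)
qed

text \<open>
  Take \<open>e\<close> and \<open>e'\<close> to be the scalar parts. Both sides are unions over the same set of matrices: applying
  \<open>e'\<close> to the class of \<open>s p\<close> and \<open>e\<close> to the class of \<open>p\<close> gives literally the same matrices, because \<open>s\<close> and
  \<open>r\<close> map each class to the other and keep scalar parts.
\<close>

lemma proj_monoid_map_class_map:
  assumes X: "X \<in> carrier (proj_monoid R)"
    and s: "\<And>x. x \<in> carrier R \<Longrightarrow> e' (s x) = e x"
    and r: "\<And>y. y \<in> carrier S \<Longrightarrow> e (r y) = e' y"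
  shows "proj_monoid_map Q e' (class_map X) = proj_monoid_map Q e X"
proof -
  obtain p where p: "p \<in> projections R" "X = mvn_rel R `` {p}"
    using X by (rule proj_monoid_carrierE)
  have es: "map_mat e' (map_mat s q) = map_mat e q" if "q \<in> projections R" for q
  proof -
    have "q $$ (i, j) \<in> carrier R" if "i < dim_row q" "j < dim_col q" for i j
      using s.R.projectionsE[OF \<open>q \<in> projections R\<close>] that by (metis mat_over_iff)
    then show ?thesis
      by (intro eq_matI) (simp_all add: s)
  qed
  have er: "map_mat e (map_mat r q) = map_mat e' q" if "q \<in> projections S" for q
  proof -
    have "q $$ (i, j) \<in> carrier S" if "i < dim_row q" "j < dim_col q" for i j
      using s.S.projectionsE[OF \<open>q \<in> projections S\<close>] that by (metis mat_over_iff)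
    then show ?thesis
      by (intro eq_matI) (simp_all add: r)
  qed
  have "map_mat e' ` class_map X = map_mat e ` X"
  proof (intro equalityI subsetI)
    fix t
    assume "t \<in> map_mat e' ` class_map X"
    then obtain q where q: "(map_mat s p, q) \<in> mvn_rel S" "t = map_mat e' q"
      using p by (auto simp: class_map_class)
    then have "(p, map_mat r q) \<in> mvn_rel R"
      using r.map_mat_mvn_rel[of "map_mat s p" q] p by (simp add: map_mat_retract)
    moreover have "t = map_mat e (map_mat r q)"
      using q er by (auto simp: mvn_rel_def)
    ultimately show "t \<in> map_mat e ` X"
      using p by auto
  next
    fix t
    assume "t \<in> map_mat e ` X"
    then obtain q where q: "(p, q) \<in> mvn_rel R" "t = map_mat e q"
      using p by auto
    then have "(map_mat s p, map_mat s q) \<in> mvn_rel S" "q \<in> projections R"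
      using s.map_mat_mvn_rel by (auto simp: mvn_rel_def)
    then show "t \<in> map_mat e' ` class_map X"
      using p q es by (force simp: class_map_class)
  qed
  then have "(\<Union>p\<in>map_mat e' ` class_map X. mvn_rel Q `` {p}) = (\<Union>p\<in>map_mat e ` X. mvn_rel Q `` {p})"
    by simp
  then show ?thesis
    by (simp add: proj_monoid_map_def)
qed

end

lemma iso_kernel_restrict:
  assumes F: "F \<in> iso G H" and "\<And>x. x \<in> carrier G \<Longrightarrow> g (F x) = f x"
  shows "G\<lparr>carrier := kernel G K f\<rparr> \<cong> H\<lparr>carrier := kernel H K g\<rparr>"
proof -
  have bij: "bij_betw F (carrier G) (carrier H)" and hom: "F \<in> hom G H"
    using F by (auto simp: iso_def)
  have "bij_betw F (kernel G K f) (kernel H K g)"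
  proof (rule bij_betw_imageI)
    show "inj_on F (kernel G K f)"
      using bij by (auto simp: bij_betw_def kernel_def intro: inj_on_subset)
    have "carrier H = F ` carrier G"
      using bij by (simp add: bij_betw_def)
    then show "F ` kernel G K f = kernel H K g"
      using assms(2) by (auto simp: kernel_def)
  qed
  then have "F \<in> iso (G\<lparr>carrier := kernel G K f\<rparr>) (H\<lparr>carrier := kernel H K g\<rparr>)"
    using hom by (auto simp: iso_def hom_def kernel_def dest: bij_betwE)
  then show ?thesis
    by (auto simp: is_iso_def)
qed

lemma K0_iso_deformation_retract:
  assumes "star_ring_deformation_retract (unitization A) (unitization B) s r"
    and "\<And>x. x \<in> carrier (unitization A) \<Longrightarrow> snd (s x) = snd x"
    and "\<And>y. y \<in> carrier (unitization B) \<Longrightarrow> snd (r y) = snd y"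
  shows "K0 A \<cong> K0 B"
proof -
  interpret star_ring_deformation_retract "unitization A" "unitization B" s r
    by fact
  let ?F = "(`) (map_prod class_map class_map)"
  let ?M = "proj_monoid (unitization A)"
  have iso: "?F \<in> iso (K00 (unitization A)) (K00 (unitization B))"
    unfolding K00_def
    by (intro groth_group_transport class_map_bij proj_monoid_closed class_map_mult)
  have "K00_map complex_alg snd (?F X) = K00_map complex_alg snd X"
    if X: "X \<in> carrier (K00 (unitization A))" for X
  proof -
    have "X \<subseteq> carrier ?M \<times> carrier ?M"
      using X by (auto simp: K00_def groth_group_def groth_rel_def elim!: quotientE)
    then show ?thesis
      unfolding K00_map_def groth_map_def
      by (auto simp: proj_monoid_map_class_map[where e = snd and e' = snd, OF _ assms(2,3)]
          dest!: subsetD intro!: SUP_cong)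
  qed
  then show ?thesis
    unfolding K0_def by (intro iso_kernel_restrict[OF iso])
qed

section \<open>Continuous functions into a C*-algebra\<close>

context normed_star_algebra
begin

lemma norm_diff_commute: "\<lbrakk>x \<in> carrier A; y \<in> carrier A\<rbrakk> \<Longrightarrow> N (x \<ominus> y) = N (y \<ominus> x)"
  using norm_minus[of "x \<ominus> y"] by (simp add: M.minus_eq M.minus_add M.a_comm)

lemma norm_diff_trans:
  assumes "x \<in> carrier A" "y \<in> carrier A" "z \<in> carrier A"
  shows "N (x \<ominus> z) \<le> N (x \<ominus> y) + N (y \<ominus> z)"
proof -
  have "x \<ominus> z = (x \<ominus> y) \<oplus> (y \<ominus> z)"
    using assms by (simp add: M.minus_eq M.a_assoc M.r_neg1)
  then show ?thesis
    using assms norm_triangle[of "x \<ominus> y" "y \<ominus> z"] by simp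
qed

lemma norm_le_norm_diff:
  assumes "x \<in> carrier A" "y \<in> carrier A"
  shows "N x \<le> N (x \<ominus> y) + N y"
  using norm_diff_trans[of x y \<zero>] assms by (simp add: M.minus_eq scalar_minus_one[of \<zero>])

lemma diff_eq_zero_iff:
  assumes "x \<in> carrier A" "y \<in> carrier A"
  shows "x \<ominus> y = \<zero> \<longleftrightarrow> x = y"
proof -
  have "(x \<ominus> y) \<oplus> y = x" "y \<ominus> y = \<zero>"
    using assms by (simp_all add: M.minus_eq M.a_assoc M.l_neg M.r_neg)
  then show ?thesis
    using assms by auto
qed

lemma scalar_diff:
  "\<lbrakk>x \<in> carrier A; y \<in> carrier A\<rbrakk> \<Longrightarrow> c \<odot> x \<ominus> c \<odot> y = c \<odot> (x \<ominus> y)"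
  by (simp add: M.minus_eq scalar_minus_one scalar_distr scalar_scalar mult.commute)

lemma star_diff:
  "\<lbrakk>x \<in> carrier A; y \<in> carrier A\<rbrakk> \<Longrightarrow> star A x \<ominus> star A y = star A (x \<ominus> y)"
  by (simp add: M.minus_eq scalar_minus_one star_add star_smult star_closed)

lemma add_diff:
  "\<lbrakk>x \<in> carrier A; y \<in> carrier A; x' \<in> carrier A; y' \<in> carrier A\<rbrakk> \<Longrightarrow>
     (x \<oplus> y) \<ominus> (x' \<oplus> y') = (x \<ominus> x') \<oplus> (y \<ominus> y')"
  by (simp add: M.minus_eq M.minus_add M.a_ac)

lemma norm_mult_diff:
  assumes "a \<in> carrier A" "b \<in> carrier A" "c \<in> carrier A" "d \<in> carrier A"
  shows "N (a \<otimes> b \<ominus> c \<otimes> d) \<le> N a * N (b \<ominus> d) + N (a \<ominus> c) * N d"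
proof -
  have "a \<otimes> (b \<ominus> d) = a \<otimes> b \<ominus> a \<otimes> d" "(a \<ominus> c) \<otimes> d = a \<otimes> d \<ominus> c \<otimes> d"
    using assms by (simp_all add: M.minus_eq scalar_minus_one l_distr r_distr smult_mult_l smult_mult_r m_closed)
  then have "N (a \<otimes> b \<ominus> c \<otimes> d) \<le> N (a \<otimes> (b \<ominus> d)) + N ((a \<ominus> c) \<otimes> d)"
    using norm_diff_trans[of "a \<otimes> b" "a \<otimes> d" "c \<otimes> d"] assms by (simp add: m_closed)
  then show ?thesis
    using norm_mult[of a "b \<ominus> d"] norm_mult[of "a \<ominus> c" d] assms by simp
qed

lemma norm_limit_unique:
  assumes "\<And>n. \<sigma> n \<in> carrier A" "l \<in> carrier A" "l' \<in> carrier A"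
    and "(\<lambda>n. N (\<sigma> n \<ominus> l)) \<longlonglongrightarrow> 0" "(\<lambda>n. N (\<sigma> n \<ominus> l')) \<longlonglongrightarrow> 0"
  shows "l = l'"
proof -
  have "N (l \<ominus> l') \<le> N (\<sigma> n \<ominus> l) + N (\<sigma> n \<ominus> l')" for n
    using norm_diff_trans[of l "\<sigma> n" l'] norm_diff_commute[of l "\<sigma> n"] assms by simp
  moreover have "(\<lambda>n. N (\<sigma> n \<ominus> l) + N (\<sigma> n \<ominus> l')) \<longlonglongrightarrow> 0"
    using tendsto_add[OF assms(4,5)] by simp
  ultimately have "N (l \<ominus> l') \<le> 0"
    by (intro tendsto_lowerbound[of _ 0 sequentially]) auto
  then show ?thesis
    using norm_eq_zero[of "l \<ominus> l'"] norm_nonneg[of "l \<ominus> l'"] diff_eq_zero_iff assms by simp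
qed

end

context cstar_algebra
begin

lemma cnorm_star:
  assumes "x \<in> carrier A"
  shows "cnorm A (star A x) = cnorm A x"
proof -
  have le: "cnorm A y \<le> cnorm A (star A y)" if y: "y \<in> carrier A" for y
  proof (cases "cnorm A y = 0")
    case False
    have "cnorm A y * cnorm A y \<le> cnorm A (star A y) * cnorm A y"
      using cnorm_star_mult[OF y] cnorm_mult[of "star A y" y] y star_closed by (simp add: power2_eq_square)
    then show ?thesis
      using False cnorm_nonneg[OF y] by simp
  qed (use cnorm_nonneg star_closed y in auto)
  show ?thesis
    using le[of x] le[of "star A x"] assms by (simp add: star_star star_closed)
qed

sublocale normed: normed_star_algebra A "cnorm A"
  by unfold_locales
    (auto simp: m_closed m_assoc l_distr r_distr smult_mult_l smult_mult_r star_closed star_star star_add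
      star_smult star_mult cnorm_nonneg cnorm_eq_0_iff cnorm_triangle cnorm_smult cnorm_mult cnorm_star)

sublocale metric: Metric_space "carrier A" "cstar_dist A"
proof
  fix x y
  show "0 \<le> cstar_dist A x y"
    by (simp add: cstar_dist_def cnorm_nonneg)
  show "cstar_dist A x y = cstar_dist A y x"
    by (simp add: cstar_dist_def normed.norm_diff_commute)
next
  fix x y
  assume "x \<in> carrier A" "y \<in> carrier A"
  then show "cstar_dist A x y = 0 \<longleftrightarrow> x = y"
    by (simp add: cstar_dist_def cnorm_eq_0_iff normed.diff_eq_zero_iff)
next
  fix x y z
  assume "x \<in> carrier A" "y \<in> carrier A" "z \<in> carrier A"
  then show "cstar_dist A x z \<le> cstar_dist A x y + cstar_dist A y z"
    by (simp add: cstar_dist_def normed.norm_diff_trans)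
qed

lemma cnorm_complete: "norm_complete A (cnorm A) (carrier A)"
  unfolding norm_complete_def
proof (intro allI impI)
  fix \<sigma> :: "nat \<Rightarrow> 'a"
  assume \<sigma>: "range \<sigma> \<subseteq> carrier A"
    and Cauchy: "\<forall>\<epsilon>>0. \<exists>M. \<forall>m\<ge>M. \<forall>n\<ge>M. cnorm A (\<sigma> m \<ominus> \<sigma> n) < \<epsilon>"
  have \<sigma>A: "\<sigma> n \<in> carrier A" for n
    using \<sigma> by auto
  have "metric.MCauchy \<sigma>"
    using \<sigma> \<sigma>A Cauchy by (auto simp: metric.MCauchy_def cstar_dist_def)
  then obtain l where "limitin metric.mtopology \<sigma> l sequentially"
    using complete by (auto simp: metric.mcomplete_def)
  then show "\<exists>l\<in>carrier A. (\<lambda>n. cnorm A (\<sigma> n \<ominus> l)) \<longlonglongrightarrow> 0"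
    using \<sigma>A by (auto simp: metric.limitin_metric_dist_null cstar_dist_def)
qed

end

context
  fixes A :: "'a cstar_alg" (structure)
  assumes cstar: "cstar_algebra A"
begin

interpretation cstar_algebra A
  by (rule cstar)

text \<open>
  By compactness of the interval, continuity is uniform continuity. With a modulus that does not depend
  on the point, membership in the function algebra becomes a plain \<open>\<epsilon>\<close>-\<open>\<delta>\<close> statement about the norm.
\<close>

lemma interval_alg_iff:
  "f \<in> carrier (interval_alg A) \<longleftrightarrow> f \<in> {0..1} \<rightarrow>\<^sub>E carrier A \<and>
     (\<forall>\<epsilon>>0. \<exists>\<delta>>0. \<forall>s\<in>{0..1}. \<forall>t\<in>{0..1}. \<bar>s - t\<bar> < \<delta> \<longrightarrow> cnorm A (f s \<ominus> f t) < \<epsilon>)"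
proof (cases "f \<in> {0..1} \<rightarrow>\<^sub>E carrier A")
  case True
  then have fA: "f t \<in> carrier A" if "t \<in> {0..1}" for t
    using that by auto
  let ?I = "submetric euclidean_metric {0..1::real}"
  have I: "mtopology_of ?I = top_of_set {0..1}"
    by (simp add: mtopology_of_submetric)
  then have "compact_space (mtopology_of ?I)"
    by (simp add: compact_space_subtopology)
  then have "continuous_map (mtopology_of ?I) (mtopology_of (metric (carrier A, cstar_dist A))) f \<longleftrightarrow>
      uniformly_continuous_map ?I (metric (carrier A, cstar_dist A)) f"
    by (rule continuous_eq_uniformly_continuous_map)
  also have "\<dots> \<longleftrightarrow> (\<forall>\<epsilon>>0. \<exists>\<delta>>0. \<forall>t\<in>{0..1}. \<forall>s\<in>{0..1}. \<bar>s - t\<bar> < \<delta> \<longrightarrow> cnorm A (f s \<ominus> f t) < \<epsilon>)"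
    using fA by (simp add: uniformly_continuous_map_def cstar_dist_def dist_real_def Pi_iff)
  also have "\<dots> \<longleftrightarrow> (\<forall>\<epsilon>>0. \<exists>\<delta>>0. \<forall>s\<in>{0..1}. \<forall>t\<in>{0..1}. \<bar>s - t\<bar> < \<delta> \<longrightarrow> cnorm A (f s \<ominus> f t) < \<epsilon>)"
    by blast
  finally show ?thesis
    using True by (simp add: interval_alg_def I)
qed (simp add: interval_alg_def)

lemma interval_algD:
  assumes "f \<in> carrier (interval_alg A)"
  shows "t \<in> {0..1} \<Longrightarrow> f t \<in> carrier A" "f \<in> extensional {0..1}"
    and "\<epsilon> > 0 \<Longrightarrow> \<exists>\<delta>>0. \<forall>s\<in>{0..1}. \<forall>t\<in>{0..1}. \<bar>s - t\<bar> < \<delta> \<longrightarrow> cnorm A (f s \<ominus> f t) < \<epsilon>"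
  using assms by (auto simp: interval_alg_iff PiE_iff)

lemma interval_alg_bounded:
  assumes f: "f \<in> carrier (interval_alg A)"
  shows "bdd_above ((\<lambda>t. cnorm A (f t)) ` {0..1})"
proof -
  have "uniformly_continuous_on {0..1} (\<lambda>t. cnorm A (f t))"
    unfolding uniformly_continuous_on_def
  proof (intro allI impI)
    fix \<epsilon> :: real
    assume "\<epsilon> > 0"
    then obtain \<delta> where \<delta>: "\<delta> > 0"
      "\<And>s t. \<lbrakk>s \<in> {0..1}; t \<in> {0..1}; \<bar>s - t\<bar> < \<delta>\<rbrakk> \<Longrightarrow> cnorm A (f s \<ominus> f t) < \<epsilon>"
      using interval_algD(3)[OF f] by blast
    have "\<bar>cnorm A (f s) - cnorm A (f t)\<bar> \<le> cnorm A (f s \<ominus> f t)" if "s \<in> {0..1}" "t \<in> {0..1}" for s t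
      using that interval_algD(1)[OF f] normed.norm_le_norm_diff[of "f s" "f t"]
        normed.norm_le_norm_diff[of "f t" "f s"] normed.norm_diff_commute[of "f s" "f t"] by simp
    then have "dist (cnorm A (f s)) (cnorm A (f t)) < \<epsilon>" if "t \<in> {0..1}" "s \<in> {0..1}" "dist s t < \<delta>" for s t
      using \<delta>(2)[of s t] that by (fastforce simp: dist_real_def)
    then show "\<exists>\<delta>>0. \<forall>t\<in>{0..1}. \<forall>s\<in>{0..1}. dist s t < \<delta> \<longrightarrow> dist (cnorm A (f s)) (cnorm A (f t)) < \<epsilon>"
      using \<delta>(1) by blast
  qed
  then have "compact ((\<lambda>t. cnorm A (f t)) ` {0..1})"
    by (intro compact_continuous_image uniformly_continuous_imp_continuous) auto
  then show ?thesis
    by (intro bounded_imp_bdd_above compact_imp_bounded)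
qed

text \<open>
  Every pointwise operation satisfies an estimate of this kind, for multiplication because continuous
  functions are bounded.
\<close>

lemma interval_algI:
  assumes f: "f \<in> carrier (interval_alg A)" and g: "g \<in> carrier (interval_alg A)"
    and h: "\<And>t. t \<in> {0..1} \<Longrightarrow> h t \<in> carrier A" and C: "C \<ge> 0"
    and bound: "\<And>s t. \<lbrakk>s \<in> {0..1}; t \<in> {0..1}\<rbrakk> \<Longrightarrow>
      cnorm A (h s \<ominus> h t) \<le> C * (cnorm A (f s \<ominus> f t) + cnorm A (g s \<ominus> g t))"
  shows "(\<lambda>t\<in>{0..1}. h t) \<in> carrier (interval_alg A)"
  unfolding interval_alg_iff
proof (intro conjI allI impI)
  fix \<epsilon> :: real
  assume "\<epsilon> > 0"
  define \<eta> where "\<eta> = \<epsilon> / (2 * (C + 1))"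
  have \<eta>: "\<eta> > 0" "C * (2 * \<eta>) < \<epsilon>"
    using \<open>\<epsilon> > 0\<close> C by (auto simp: \<eta>_def field_simps)
  obtain \<delta>1 where \<delta>1: "\<delta>1 > 0" "\<And>s t. \<lbrakk>s \<in> {0..1}; t \<in> {0..1}; \<bar>s - t\<bar> < \<delta>1\<rbrakk> \<Longrightarrow> cnorm A (f s \<ominus> f t) < \<eta>"
    using interval_algD(3)[OF f \<eta>(1)] by blast
  obtain \<delta>2 where \<delta>2: "\<delta>2 > 0" "\<And>s t. \<lbrakk>s \<in> {0..1}; t \<in> {0..1}; \<bar>s - t\<bar> < \<delta>2\<rbrakk> \<Longrightarrow> cnorm A (g s \<ominus> g t) < \<eta>"
    using interval_algD(3)[OF g \<eta>(1)] by blast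
  have "cnorm A (h s \<ominus> h t) < \<epsilon>" if st: "s \<in> {0..1}" "t \<in> {0..1}" "\<bar>s - t\<bar> < min \<delta>1 \<delta>2" for s t
  proof -
    have "cnorm A (h s \<ominus> h t) \<le> C * (cnorm A (f s \<ominus> f t) + cnorm A (g s \<ominus> g t))"
      using bound st by blast
    also have "\<dots> \<le> C * (2 * \<eta>)"
      using \<delta>1(2)[of s t] \<delta>2(2)[of s t] st C by (intro mult_left_mono) auto
    finally show ?thesis
      using \<eta>(2) by simp
  qed
  then show "\<exists>\<delta>>0. \<forall>s\<in>{0..1}. \<forall>t\<in>{0..1}. \<bar>s - t\<bar> < \<delta> \<longrightarrow>
      cnorm A ((\<lambda>t\<in>{0..1}. h t) s \<ominus> (\<lambda>t\<in>{0..1}. h t) t) < \<epsilon>"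
    using \<delta>1(1) \<delta>2(1) by (intro exI[of _ "min \<delta>1 \<delta>2"]) auto
qed (use h in auto)

lemma interval_alg_const: "a \<in> carrier A \<Longrightarrow> (\<lambda>t\<in>{0..1}. a) \<in> carrier (interval_alg A)"
  unfolding interval_alg_iff by (auto intro!: exI[of _ 1] simp: normed.diff_eq_zero_iff[THEN iffD2])

lemma interval_alg_closed:
  assumes f: "f \<in> carrier (interval_alg A)" and g: "g \<in> carrier (interval_alg A)"
  shows "(\<lambda>t\<in>{0..1}. f t \<oplus> g t) \<in> carrier (interval_alg A)"
    and "(\<lambda>t\<in>{0..1}. f t \<otimes> g t) \<in> carrier (interval_alg A)"
    and "(\<lambda>t\<in>{0..1}. c \<odot> f t) \<in> carrier (interval_alg A)"
    and "(\<lambda>t\<in>{0..1}. star A (f t)) \<in> carrier (interval_alg A)"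
proof -
  note fA = interval_algD(1)[OF f] and gA = interval_algD(1)[OF g]
  show "(\<lambda>t\<in>{0..1}. f t \<oplus> g t) \<in> carrier (interval_alg A)"
    by (rule interval_algI[OF f g, where C = 1]) (auto simp: fA gA normed.add_diff intro!: cnorm_triangle)
  show "(\<lambda>t\<in>{0..1}. c \<odot> f t) \<in> carrier (interval_alg A)"
    by (rule interval_algI[OF f f, where C = "cmod c"])
      (auto simp: fA normed.scalar_diff cnorm_smult cnorm_nonneg mult_left_mono)
  show "(\<lambda>t\<in>{0..1}. star A (f t)) \<in> carrier (interval_alg A)"
    by (rule interval_algI[OF f f, where C = 1])
      (auto simp: fA normed.star_diff cnorm_star cnorm_nonneg star_closed)
  obtain b where b: "\<And>t. t \<in> {0..1} \<Longrightarrow> cnorm A (f t) \<le> b"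
    using interval_alg_bounded[OF f] unfolding bdd_above_def by blast
  obtain d where d: "\<And>t. t \<in> {0..1} \<Longrightarrow> cnorm A (g t) \<le> d"
    using interval_alg_bounded[OF g] unfolding bdd_above_def by blast
  have b0: "0 \<le> b" and d0: "0 \<le> d"
    using b[of 0] d[of 0] cnorm_nonneg[OF fA[of 0]] cnorm_nonneg[OF gA[of 0]] by auto
  show "(\<lambda>t\<in>{0..1}. f t \<otimes> g t) \<in> carrier (interval_alg A)"
  proof (rule interval_algI[OF f g, where C = "b + d"])
    fix s t :: real
    assume st: "s \<in> {0..1}" "t \<in> {0..1}"
    have "cnorm A (f s \<otimes> g s \<ominus> f t \<otimes> g t) \<le>
        cnorm A (f s) * cnorm A (g s \<ominus> g t) + cnorm A (f s \<ominus> f t) * cnorm A (g t)"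
      using st by (intro normed.norm_mult_diff fA gA)
    also have "\<dots> \<le> b * cnorm A (g s \<ominus> g t) + cnorm A (f s \<ominus> f t) * d"
      using st b d fA gA cnorm_nonneg by (intro add_mono mult_right_mono mult_left_mono) auto
    also have "\<dots> \<le> (b + d) * (cnorm A (f s \<ominus> f t) + cnorm A (g s \<ominus> g t))"
      using b0 d0 st fA gA cnorm_nonneg by (simp add: algebra_simps)
    finally show "cnorm A (f s \<otimes> g s \<ominus> f t \<otimes> g t) \<le> (b + d) * (cnorm A (f s \<ominus> f t) + cnorm A (g s \<ominus> g t))" .
  qed (use b0 d0 fA gA m_closed in auto)
qed

text \<open>
  A change of parameter that does not increase distances keeps the modulus of continuity.
\<close>

lemma interval_alg_reparametrize:
  assumes f: "f \<in> carrier (interval_alg A)" and \<tau>: "\<And>t. t \<in> {0..1} \<Longrightarrow> \<tau> t \<in> {0..1}"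
    and contraction: "\<And>s t. \<bar>\<tau> s - \<tau> t\<bar> \<le> \<bar>s - t\<bar>"
  shows "(\<lambda>t\<in>{0..1}. f (\<tau> t)) \<in> carrier (interval_alg A)"
  unfolding interval_alg_iff
proof (intro conjI allI impI)
  fix \<epsilon> :: real
  assume "\<epsilon> > 0"
  then obtain \<delta> where \<delta>: "\<delta> > 0"
    "\<And>s t. \<lbrakk>s \<in> {0..1}; t \<in> {0..1}; \<bar>s - t\<bar> < \<delta>\<rbrakk> \<Longrightarrow> cnorm A (f s \<ominus> f t) < \<epsilon>"
    using interval_algD(3)[OF f] by blast
  have "cnorm A (f (\<tau> s) \<ominus> f (\<tau> t)) < \<epsilon>" if "s \<in> {0..1}" "t \<in> {0..1}" "\<bar>s - t\<bar> < \<delta>" for s t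
    using \<delta>(2)[OF \<tau> \<tau>] that contraction[of s t] by simp
  then show "\<exists>\<delta>>0. \<forall>s\<in>{0..1}. \<forall>t\<in>{0..1}. \<bar>s - t\<bar> < \<delta> \<longrightarrow>
      cnorm A ((\<lambda>t\<in>{0..1}. f (\<tau> t)) s \<ominus> (\<lambda>t\<in>{0..1}. f (\<tau> t)) t) < \<epsilon>"
    using \<delta>(1) by (intro exI[of _ \<delta>]) auto
qed (use interval_algD(1)[OF f \<tau>] in auto)

lemma interval_alg_uniform_limit:
  assumes f: "\<And>n. f n \<in> carrier (interval_alg A)" and l: "\<And>t. t \<in> {0..1} \<Longrightarrow> l t \<in> carrier A"
    and lim: "\<And>\<epsilon>. \<epsilon> > 0 \<Longrightarrow> \<exists>n. \<forall>t\<in>{0..1}. cnorm A (f n t \<ominus> l t) \<le> \<epsilon>"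
  shows "(\<lambda>t\<in>{0..1}. l t) \<in> carrier (interval_alg A)"
  unfolding interval_alg_iff
proof (intro conjI allI impI)
  fix \<epsilon> :: real
  assume "\<epsilon> > 0"
  then obtain n where n: "\<And>t. t \<in> {0..1} \<Longrightarrow> cnorm A (f n t \<ominus> l t) \<le> \<epsilon> / 3"
    using lim[of "\<epsilon> / 3"] by (meson divide_pos_pos zero_less_numeral)
  note fA = interval_algD(1)[OF f[of n]]
  obtain \<delta> where \<delta>: "\<delta> > 0"
    "\<And>s t. \<lbrakk>s \<in> {0..1}; t \<in> {0..1}; \<bar>s - t\<bar> < \<delta>\<rbrakk> \<Longrightarrow> cnorm A (f n s \<ominus> f n t) < \<epsilon> / 3"
    using interval_algD(3)[OF f[of n], of "\<epsilon> / 3"] \<open>\<epsilon> > 0\<close> by auto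
  have "cnorm A (l s \<ominus> l t) < \<epsilon>" if st: "s \<in> {0..1}" "t \<in> {0..1}" "\<bar>s - t\<bar> < \<delta>" for s t
  proof -
    have "cnorm A (l s \<ominus> l t) \<le> cnorm A (l s \<ominus> f n s) + cnorm A (f n s \<ominus> l t)"
      using st l fA by (intro normed.norm_diff_trans) auto
    also have "cnorm A (f n s \<ominus> l t) \<le> cnorm A (f n s \<ominus> f n t) + cnorm A (f n t \<ominus> l t)"
      using st l fA by (intro normed.norm_diff_trans) auto
    also have "cnorm A (l s \<ominus> f n s) = cnorm A (f n s \<ominus> l s)"
      using st l fA by (intro normed.norm_diff_commute) auto
    finally show ?thesis
      using n[of s] n[of t] \<delta>(2)[of s t] st by simp
  qed
  then show "\<exists>\<delta>>0. \<forall>s\<in>{0..1}. \<forall>t\<in>{0..1}. \<bar>s - t\<bar> < \<delta> \<longrightarrow>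
      cnorm A ((\<lambda>t\<in>{0..1}. l t) s \<ominus> (\<lambda>t\<in>{0..1}. l t) t) < \<epsilon>"
    using \<delta>(1) by (intro exI[of _ \<delta>]) auto
qed (use l in auto)

end

section \<open>Algebras of functions\<close>

text \<open>
  An algebra whose elements are determined by their values at the points of \<open>I\<close>, with pointwise
  operations and bounded values in C*-algebras. The laws of a *-algebra are then inherited from the
  values, and the supremum of the norms of the values is a norm. For the telescope, a point is a pair of
  a coordinate and a parameter in the interval.
\<close>

locale evaluation_family =
  fixes T :: "('x, 'm) star_alg_scheme" and I :: "'i set" and B :: "'i \<Rightarrow> 'b cstar_alg"
    and ev :: "'i \<Rightarrow> 'x \<Rightarrow> 'b"
  assumes B: "i \<in> I \<Longrightarrow> cstar_algebra (B i)"
    and I: "I \<noteq> {}"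
    and zero_T: "\<zero>\<^bsub>T\<^esub> \<in> carrier T"
    and add_T: "\<lbrakk>x \<in> carrier T; y \<in> carrier T\<rbrakk> \<Longrightarrow> x \<oplus>\<^bsub>T\<^esub> y \<in> carrier T"
    and scalar_T: "x \<in> carrier T \<Longrightarrow> c \<odot>\<^bsub>T\<^esub> x \<in> carrier T"
    and mult_T: "\<lbrakk>x \<in> carrier T; y \<in> carrier T\<rbrakk> \<Longrightarrow> x \<otimes>\<^bsub>T\<^esub> y \<in> carrier T"
    and star_T: "x \<in> carrier T \<Longrightarrow> star T x \<in> carrier T"
    and ev_closed: "\<lbrakk>i \<in> I; x \<in> carrier T\<rbrakk> \<Longrightarrow> ev i x \<in> carrier (B i)"
    and ev_zero: "i \<in> I \<Longrightarrow> ev i \<zero>\<^bsub>T\<^esub> = \<zero>\<^bsub>B i\<^esub>"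
    and ev_add: "\<lbrakk>i \<in> I; x \<in> carrier T; y \<in> carrier T\<rbrakk> \<Longrightarrow> ev i (x \<oplus>\<^bsub>T\<^esub> y) = ev i x \<oplus>\<^bsub>B i\<^esub> ev i y"
    and ev_scalar: "\<lbrakk>i \<in> I; x \<in> carrier T\<rbrakk> \<Longrightarrow> ev i (c \<odot>\<^bsub>T\<^esub> x) = c \<odot>\<^bsub>B i\<^esub> ev i x"
    and ev_mult: "\<lbrakk>i \<in> I; x \<in> carrier T; y \<in> carrier T\<rbrakk> \<Longrightarrow> ev i (x \<otimes>\<^bsub>T\<^esub> y) = ev i x \<otimes>\<^bsub>B i\<^esub> ev i y"
    and ev_star: "\<lbrakk>i \<in> I; x \<in> carrier T\<rbrakk> \<Longrightarrow> ev i (star T x) = star (B i) (ev i x)"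
    and ev_inject: "\<lbrakk>x \<in> carrier T; y \<in> carrier T; \<And>i. i \<in> I \<Longrightarrow> ev i x = ev i y\<rbrakk> \<Longrightarrow> x = y"
    and ev_bounded: "x \<in> carrier T \<Longrightarrow> bdd_above ((\<lambda>i. cnorm (B i) (ev i x)) ` I)"
begin

definition sup_norm :: "'x \<Rightarrow> real" where
  "sup_norm x = (SUP i\<in>I. cnorm (B i) (ev i x))"

lemma star_algebra: "star_algebra T"
proof -
  note closed = zero_T add_T scalar_T mult_T star_T
  note ev = ev_closed ev_zero ev_add ev_scalar ev_mult ev_star closed
  have B_star: "star_algebra (B i)" and B_abelian: "abelian_group (B i)" if "i \<in> I" for i
  proof -
    interpret cstar_algebra "B i"
      by (rule B[OF that])
    show "star_algebra (B i)" "abelian_group (B i)"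
      by unfold_locales
  qed
  note law = B_star B_abelian abelian_group.axioms(1) abelian_monoid.a_assoc abelian_monoid.a_comm
    abelian_monoid.l_zero abelian_group.l_neg star_algebra.scalar_add star_algebra.scalar_distr
    star_algebra.scalar_one star_algebra.m_assoc star_algebra.l_distr star_algebra.r_distr
    star_algebra.smult_mult_l star_algebra.smult_mult_r star_algebra.star_star
    star_algebra.star_add star_algebra.star_smult star_algebra.star_mult
  have abelian: "abelian_group T"
  proof (rule abelian_groupI)
    fix x y z
    assume xyz: "x \<in> carrier T" "y \<in> carrier T" "z \<in> carrier T"
    show "x \<oplus>\<^bsub>T\<^esub> y \<oplus>\<^bsub>T\<^esub> z = x \<oplus>\<^bsub>T\<^esub> (y \<oplus>\<^bsub>T\<^esub> z)"
      by (rule ev_inject) (simp_all add: ev law xyz)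
    show "x \<oplus>\<^bsub>T\<^esub> y = y \<oplus>\<^bsub>T\<^esub> x"
      by (rule ev_inject) (simp_all add: ev law xyz)
  next
    fix x
    assume x: "x \<in> carrier T"
    show "\<zero>\<^bsub>T\<^esub> \<oplus>\<^bsub>T\<^esub> x = x"
      by (rule ev_inject) (simp_all add: ev law x)
    have "(-1) \<odot>\<^bsub>T\<^esub> x \<oplus>\<^bsub>T\<^esub> x = \<zero>\<^bsub>T\<^esub>"
      by (rule ev_inject) (simp_all add: ev law x flip: star_algebra.scalar_minus_one)
    then show "\<exists>y\<in>carrier T. y \<oplus>\<^bsub>T\<^esub> x = \<zero>\<^bsub>T\<^esub>"
      using x closed by blast
  qed (use closed in auto)
  have "cring complex_alg"
    using B I by (meson cstar_algebra_def ex_in_conv module.axioms(1))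
  then have "module complex_alg T"
  proof (rule moduleI[OF _ abelian])
    fix c d x y
    assume x: "x \<in> carrier T"
    have "(c + d) \<odot>\<^bsub>T\<^esub> x = c \<odot>\<^bsub>T\<^esub> x \<oplus>\<^bsub>T\<^esub> d \<odot>\<^bsub>T\<^esub> x"
      by (rule ev_inject) (simp_all add: ev law x)
    then show "(c \<oplus>\<^bsub>complex_alg\<^esub> d) \<odot>\<^bsub>T\<^esub> x = c \<odot>\<^bsub>T\<^esub> x \<oplus>\<^bsub>T\<^esub> d \<odot>\<^bsub>T\<^esub> x"
      by (simp add: complex_alg_def)
    have "(c * d) \<odot>\<^bsub>T\<^esub> x = c \<odot>\<^bsub>T\<^esub> (d \<odot>\<^bsub>T\<^esub> x)"
      by (rule ev_inject) (simp_all add: ev law x star_algebra.scalar_scalar)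
    then show "(c \<otimes>\<^bsub>complex_alg\<^esub> d) \<odot>\<^bsub>T\<^esub> x = c \<odot>\<^bsub>T\<^esub> (d \<odot>\<^bsub>T\<^esub> x)"
      by (simp add: complex_alg_def)
    have "1 \<odot>\<^bsub>T\<^esub> x = x"
      by (rule ev_inject) (simp_all add: ev law x)
    then show "\<one>\<^bsub>complex_alg\<^esub> \<odot>\<^bsub>T\<^esub> x = x"
      by (simp add: complex_alg_def)
    assume y: "y \<in> carrier T"
    show "c \<odot>\<^bsub>T\<^esub> (x \<oplus>\<^bsub>T\<^esub> y) = c \<odot>\<^bsub>T\<^esub> x \<oplus>\<^bsub>T\<^esub> c \<odot>\<^bsub>T\<^esub> y"
      by (rule ev_inject) (simp_all add: ev law x y)
  qed (use closed in auto)
  then show ?thesis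
  proof (rule star_algebra.intro[OF _ star_algebra_axioms.intro])
    fix c x y z
    assume x: "x \<in> carrier T"
    show "star T (star T x) = x"
      by (rule ev_inject) (simp_all add: ev law x)
    show "star T (c \<odot>\<^bsub>T\<^esub> x) = cnj c \<odot>\<^bsub>T\<^esub> star T x"
      by (rule ev_inject) (simp_all add: ev law x)
    assume y: "y \<in> carrier T"
    show "star T (x \<oplus>\<^bsub>T\<^esub> y) = star T x \<oplus>\<^bsub>T\<^esub> star T y"
      by (rule ev_inject) (simp_all add: ev law x y)
    show "star T (x \<otimes>\<^bsub>T\<^esub> y) = star T y \<otimes>\<^bsub>T\<^esub> star T x"
      by (rule ev_inject) (simp_all add: ev law x y)
    show "(c \<odot>\<^bsub>T\<^esub> x) \<otimes>\<^bsub>T\<^esub> y = c \<odot>\<^bsub>T\<^esub> (x \<otimes>\<^bsub>T\<^esub> y)"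
      by (rule ev_inject) (simp_all add: ev law x y)
    show "x \<otimes>\<^bsub>T\<^esub> (c \<odot>\<^bsub>T\<^esub> y) = c \<odot>\<^bsub>T\<^esub> (x \<otimes>\<^bsub>T\<^esub> y)"
      by (rule ev_inject) (simp_all add: ev law x y)
    assume z: "z \<in> carrier T"
    show "x \<otimes>\<^bsub>T\<^esub> y \<otimes>\<^bsub>T\<^esub> z = x \<otimes>\<^bsub>T\<^esub> (y \<otimes>\<^bsub>T\<^esub> z)"
      by (rule ev_inject) (simp_all add: ev law x y z)
    show "(x \<oplus>\<^bsub>T\<^esub> y) \<otimes>\<^bsub>T\<^esub> z = x \<otimes>\<^bsub>T\<^esub> z \<oplus>\<^bsub>T\<^esub> y \<otimes>\<^bsub>T\<^esub> z"
      by (rule ev_inject) (simp_all add: ev law x y z)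
    show "z \<otimes>\<^bsub>T\<^esub> (x \<oplus>\<^bsub>T\<^esub> y) = z \<otimes>\<^bsub>T\<^esub> x \<oplus>\<^bsub>T\<^esub> z \<otimes>\<^bsub>T\<^esub> y"
      by (rule ev_inject) (simp_all add: ev law x y z)
  qed (use closed in auto)
qed

lemma ev_diff:
  assumes i: "i \<in> I" and x: "x \<in> carrier T" and y: "y \<in> carrier T"
  shows "ev i (x \<ominus>\<^bsub>T\<^esub> y) = ev i x \<ominus>\<^bsub>B i\<^esub> ev i y"
proof -
  interpret T: star_algebra T
    by (rule star_algebra)
  interpret cstar_algebra "B i"
    by (rule B[OF i])
  show ?thesis
    using i x y by (simp add: T.M.minus_eq M.minus_eq T.scalar_minus_one normed.scalar_minus_one
        ev_add ev_scalar ev_closed)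
qed

lemma ev_le_sup_norm: "\<lbrakk>i \<in> I; x \<in> carrier T\<rbrakk> \<Longrightarrow> cnorm (B i) (ev i x) \<le> sup_norm x"
  unfolding sup_norm_def by (rule cSUP_upper[OF _ ev_bounded])

lemma sup_norm_le: "(\<And>i. i \<in> I \<Longrightarrow> cnorm (B i) (ev i x) \<le> b) \<Longrightarrow> sup_norm x \<le> b"
  unfolding sup_norm_def by (rule cSUP_least[OF I])

lemma sup_norm_nonneg:
  assumes "x \<in> carrier T"
  shows "0 \<le> sup_norm x"
proof -
  obtain i where i: "i \<in> I"
    using I by blast
  interpret cstar_algebra "B i"
    by (rule B[OF i])
  show ?thesis
    using ev_le_sup_norm[OF i assms] cnorm_nonneg[OF ev_closed[OF i assms]] by simp
qed

lemma normed_star_algebra: "normed_star_algebra T sup_norm"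
proof (rule normed_star_algebra.intro[OF star_algebra normed_star_algebra_axioms.intro])
  interpret T: star_algebra T
    by (rule star_algebra)
  fix x c
  assume x: "x \<in> carrier T"
  show "0 \<le> sup_norm x"
    by (rule sup_norm_nonneg[OF x])
  show "x = \<zero>\<^bsub>T\<^esub>" if "sup_norm x = 0"
  proof (rule ev_inject[OF x zero_T])
    fix i assume i: "i \<in> I"
    interpret cstar_algebra "B i"
      by (rule B[OF i])
    have "cnorm (B i) (ev i x) = 0"
      using ev_le_sup_norm[OF i x] that cnorm_nonneg[OF ev_closed[OF i x]] by simp
    then show "ev i x = ev i \<zero>\<^bsub>T\<^esub>"
      using i x by (simp add: ev_zero ev_closed cnorm_eq_0_iff)
  qed
  have scalar: "sup_norm (c \<odot>\<^bsub>T\<^esub> x) \<le> cmod c * sup_norm x" if x: "x \<in> carrier T" for c x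
  proof (rule sup_norm_le)
    fix i assume i: "i \<in> I"
    interpret cstar_algebra "B i"
      by (rule B[OF i])
    show "cnorm (B i) (ev i (c \<odot>\<^bsub>T\<^esub> x)) \<le> cmod c * sup_norm x"
      using i x ev_le_sup_norm[OF i x] by (simp add: ev_scalar ev_closed cnorm_smult mult_left_mono)
  qed
  show "sup_norm (c \<odot>\<^bsub>T\<^esub> x) = cmod c * sup_norm x"
  proof (cases "c = 0")
    case True
    then show ?thesis
      using scalar[OF x, of 0] sup_norm_nonneg[OF scalar_T[OF x, of 0]] by simp
  next
    case False
    have "sup_norm ((1 / c) \<odot>\<^bsub>T\<^esub> (c \<odot>\<^bsub>T\<^esub> x)) \<le> cmod (1 / c) * sup_norm (c \<odot>\<^bsub>T\<^esub> x)"
      using scalar_T[OF x] by (rule scalar)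
    moreover have "(1 / c) \<odot>\<^bsub>T\<^esub> (c \<odot>\<^bsub>T\<^esub> x) = x"
      using False x by (simp add: T.scalar_scalar)
    ultimately have "cmod c * sup_norm x \<le> sup_norm (c \<odot>\<^bsub>T\<^esub> x)"
      using False by (simp add: norm_divide field_simps)
    then show ?thesis
      using scalar[OF x, of c] by simp
  qed
  have "cnorm (B i) (ev i (star T x)) = cnorm (B i) (ev i x)" if "i \<in> I" for i
    using that x by (simp add: ev_star cstar_algebra.cnorm_star[OF B] ev_closed)
  then show "sup_norm (star T x) = sup_norm x"
    by (simp add: sup_norm_def)
  fix y
  assume y: "y \<in> carrier T"
  show "sup_norm (x \<oplus>\<^bsub>T\<^esub> y) \<le> sup_norm x + sup_norm y"
  proof (rule sup_norm_le)
    fix i assume i: "i \<in> I"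
    interpret cstar_algebra "B i"
      by (rule B[OF i])
    have "cnorm (B i) (ev i x \<oplus>\<^bsub>B i\<^esub> ev i y) \<le> cnorm (B i) (ev i x) + cnorm (B i) (ev i y)"
      using i x y by (intro cnorm_triangle ev_closed)
    then show "cnorm (B i) (ev i (x \<oplus>\<^bsub>T\<^esub> y)) \<le> sup_norm x + sup_norm y"
      using ev_le_sup_norm[OF i x] ev_le_sup_norm[OF i y] i x y by (simp add: ev_add)
  qed
  show "sup_norm (x \<otimes>\<^bsub>T\<^esub> y) \<le> sup_norm x * sup_norm y"
  proof (rule sup_norm_le)
    fix i assume i: "i \<in> I"
    interpret cstar_algebra "B i"
      by (rule B[OF i])
    have "cnorm (B i) (ev i x \<otimes>\<^bsub>B i\<^esub> ev i y) \<le> cnorm (B i) (ev i x) * cnorm (B i) (ev i y)"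
      using i x y by (intro cnorm_mult ev_closed)
    also have "\<dots> \<le> sup_norm x * sup_norm y"
      using i x y by (intro mult_mono ev_le_sup_norm sup_norm_nonneg cnorm_nonneg ev_closed)
    finally show "cnorm (B i) (ev i (x \<otimes>\<^bsub>T\<^esub> y)) \<le> sup_norm x * sup_norm y"
      using i x y by (simp add: ev_mult)
  qed
qed

text \<open>
  Completeness of the algebra is thereby reduced to the question whether the limit family consists of
  the values of an element.
\<close>

lemma sup_norm_Cauchy_pointwise:
  assumes \<sigma>: "\<And>n. \<sigma> n \<in> carrier T"
    and Cauchy: "\<And>\<epsilon>. \<epsilon> > 0 \<Longrightarrow> \<exists>M. \<forall>m\<ge>M. \<forall>n\<ge>M. sup_norm (\<sigma> m \<ominus>\<^bsub>T\<^esub> \<sigma> n) < \<epsilon>"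
  obtains l where "\<And>i. i \<in> I \<Longrightarrow> l i \<in> carrier (B i)"
    and "\<And>i. i \<in> I \<Longrightarrow> (\<lambda>n. cnorm (B i) (ev i (\<sigma> n) \<ominus>\<^bsub>B i\<^esub> l i)) \<longlonglongrightarrow> 0"
    and "\<And>\<epsilon>. \<epsilon> > 0 \<Longrightarrow> \<exists>M. \<forall>m\<ge>M. \<forall>i\<in>I. cnorm (B i) (ev i (\<sigma> m) \<ominus>\<^bsub>B i\<^esub> l i) \<le> \<epsilon>"
proof -
  interpret T: normed_star_algebra T sup_norm
    by (rule normed_star_algebra)
  have le: "cnorm (B i) (ev i (\<sigma> m) \<ominus>\<^bsub>B i\<^esub> ev i (\<sigma> n)) \<le> sup_norm (\<sigma> m \<ominus>\<^bsub>T\<^esub> \<sigma> n)" if "i \<in> I" for i m n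
    using ev_le_sup_norm[OF that, of "\<sigma> m \<ominus>\<^bsub>T\<^esub> \<sigma> n"] that \<sigma> by (simp add: ev_diff)
  have "\<exists>l\<in>carrier (B i). (\<lambda>n. cnorm (B i) (ev i (\<sigma> n) \<ominus>\<^bsub>B i\<^esub> l)) \<longlonglongrightarrow> 0" if i: "i \<in> I" for i
  proof -
    interpret cstar_algebra "B i"
      by (rule B[OF i])
    have "\<exists>M. \<forall>m\<ge>M. \<forall>n\<ge>M. cnorm (B i) (ev i (\<sigma> m) \<ominus>\<^bsub>B i\<^esub> ev i (\<sigma> n)) < \<epsilon>" if "\<epsilon> > 0" for \<epsilon>
      using Cauchy[OF that] le[OF i] by (meson le_less_trans)
    then show ?thesis
      by (rule norm_completeD[OF cnorm_complete ev_closed[OF i \<sigma>]]) auto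
  qed
  then obtain l where l: "\<And>i. i \<in> I \<Longrightarrow> l i \<in> carrier (B i)"
    and lim: "\<And>i. i \<in> I \<Longrightarrow> (\<lambda>n. cnorm (B i) (ev i (\<sigma> n) \<ominus>\<^bsub>B i\<^esub> l i)) \<longlonglongrightarrow> 0"
    by metis
  have "\<exists>M. \<forall>m\<ge>M. \<forall>i\<in>I. cnorm (B i) (ev i (\<sigma> m) \<ominus>\<^bsub>B i\<^esub> l i) \<le> \<epsilon>" if "\<epsilon> > 0" for \<epsilon>
  proof -
    obtain M where M: "\<And>m n. \<lbrakk>m \<ge> M; n \<ge> M\<rbrakk> \<Longrightarrow> sup_norm (\<sigma> m \<ominus>\<^bsub>T\<^esub> \<sigma> n) < \<epsilon>"
      using Cauchy[OF \<open>\<epsilon> > 0\<close>] by blast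
    have "cnorm (B i) (ev i (\<sigma> m) \<ominus>\<^bsub>B i\<^esub> l i) \<le> \<epsilon>" if m: "m \<ge> M" and i: "i \<in> I" for m i
    proof -
      interpret cstar_algebra "B i"
        by (rule B[OF i])
      have "cnorm (B i) (ev i (\<sigma> m) \<ominus>\<^bsub>B i\<^esub> l i) \<le> \<epsilon> + cnorm (B i) (ev i (\<sigma> n) \<ominus>\<^bsub>B i\<^esub> l i)" if "n \<ge> M" for n
        using normed.norm_diff_trans[OF ev_closed[OF i \<sigma>[of m]] ev_closed[OF i \<sigma>[of n]] l[OF i]]
          le[OF i, of m n] M[OF m that] by simp
      moreover have "(\<lambda>n. \<epsilon> + cnorm (B i) (ev i (\<sigma> n) \<ominus>\<^bsub>B i\<^esub> l i)) \<longlonglongrightarrow> \<epsilon> + 0"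
        by (intro tendsto_intros lim i)
      ultimately show ?thesis
        by (intro tendsto_lowerbound[of "\<lambda>n. \<epsilon> + cnorm (B i) (ev i (\<sigma> n) \<ominus>\<^bsub>B i\<^esub> l i)" \<epsilon> sequentially])
          (auto simp: eventually_sequentially)
    qed
    then show ?thesis
      by blast
  qed
  then show ?thesis
    using that l lim by blast
qed

lemma sup_norm_limit:
  assumes \<sigma>: "\<And>n. \<sigma> n \<in> carrier T" and L: "L \<in> carrier T"
    and lim: "\<And>\<epsilon>. \<epsilon> > 0 \<Longrightarrow> \<exists>M. \<forall>m\<ge>M. \<forall>i\<in>I. cnorm (B i) (ev i (\<sigma> m) \<ominus>\<^bsub>B i\<^esub> ev i L) \<le> \<epsilon>"
  shows "(\<lambda>n. sup_norm (\<sigma> n \<ominus>\<^bsub>T\<^esub> L)) \<longlonglongrightarrow> 0"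
proof (rule LIMSEQ_I)
  interpret T: normed_star_algebra T sup_norm
    by (rule normed_star_algebra)
  fix r :: real
  assume "r > 0"
  then obtain M where M: "\<And>m i. \<lbrakk>m \<ge> M; i \<in> I\<rbrakk> \<Longrightarrow> cnorm (B i) (ev i (\<sigma> m) \<ominus>\<^bsub>B i\<^esub> ev i L) \<le> r / 2"
    using lim[of "r / 2"] by auto
  have "sup_norm (\<sigma> m \<ominus>\<^bsub>T\<^esub> L) \<le> r / 2" if "m \<ge> M" for m
    using M[OF that] \<sigma> L by (intro sup_norm_le) (simp add: ev_diff)
  then show "\<exists>M. \<forall>n\<ge>M. norm (sup_norm (\<sigma> n \<ominus>\<^bsub>T\<^esub> L) - 0) < r"
    using \<open>r > 0\<close> T.norm_nonneg[OF T.M.minus_closed[OF \<sigma> L]] by (fastforce intro!: exI[of _ M])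
qed

end

section \<open>The mapping cylindrical telescope\<close>

lemma cstar_homI:
  assumes "\<And>x. x \<in> carrier A \<Longrightarrow> h x \<in> carrier B"
    and "\<And>x y. \<lbrakk>x \<in> carrier A; y \<in> carrier A\<rbrakk> \<Longrightarrow> h (x \<otimes>\<^bsub>A\<^esub> y) = h x \<otimes>\<^bsub>B\<^esub> h y"
    and "\<And>x y. \<lbrakk>x \<in> carrier A; y \<in> carrier A\<rbrakk> \<Longrightarrow> h (x \<oplus>\<^bsub>A\<^esub> y) = h x \<oplus>\<^bsub>B\<^esub> h y"
    and "\<And>c x. x \<in> carrier A \<Longrightarrow> h (c \<odot>\<^bsub>A\<^esub> x) = c \<odot>\<^bsub>B\<^esub> h x"
    and "\<And>x. x \<in> carrier A \<Longrightarrow> h (star A x) = star B (h x)"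
  shows "h \<in> cstar_hom A B"
  using assms by (auto simp: cstar_hom_def hom_def)

text \<open>
  The first coordinate is regarded as a function that is constant in the parameter. All coordinates
  can then be treated alike: coordinate \<open>k\<close> takes values in \<open>A\<^sub>k\<close> and ends in the image of \<open>a\<close> in \<open>A\<^sub>k\<close>.
\<close>

definition tele_ev :: "nat \<times> real \<Rightarrow> 'a \<times> (nat \<Rightarrow> real \<Rightarrow> 'a) \<Rightarrow> 'a" where
  "tele_ev i x = (if fst i = 1 then fst x else snd x (fst i) (snd i))"

definition tele_family :: "nat \<Rightarrow> 'a \<Rightarrow> (nat \<Rightarrow> real \<Rightarrow> 'a) \<Rightarrow> 'a \<times> (nat \<Rightarrow> real \<Rightarrow> 'a)" where
  "tele_family j a g = (a, \<lambda>k\<in>{2..j+1}. \<lambda>t\<in>{0..1}. g k t)"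

lemma fst_tele_family [simp]: "fst (tele_family j a g) = a"
  by (simp add: tele_family_def)

lemma tele_ev_family:
  "\<lbrakk>k \<in> {1..j+1}; t \<in> {0..1}\<rbrakk> \<Longrightarrow> tele_ev (k, t) (tele_family j a g) = (if k = 1 then a else g k t)"
  by (simp add: tele_ev_def tele_family_def)

(* Keeps the index in A 1 apart from successors, so that facts about A 1 and A (k + 1) match as stated. *)
declare One_nat_def [simp del]

locale telescope_data =
  fixes A :: "nat \<Rightarrow> 'a cstar_alg" and \<alpha> :: "nat \<Rightarrow> 'a \<Rightarrow> 'a" and j :: nat
  assumes algebra: "k \<in> {1..j+1} \<Longrightarrow> cstar_algebra (A k)"
    and morphism: "k \<in> {1..j} \<Longrightarrow> \<alpha> k \<in> cstar_hom (A k) (A (k+1))"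
begin

abbreviation T :: "('a \<times> (nat \<Rightarrow> real \<Rightarrow> 'a)) cstar_alg" where
  "T \<equiv> telescope A \<alpha> j"

abbreviation I :: "(nat \<times> real) set" where
  "I \<equiv> {1..j+1} \<times> {0..1}"

lemma comp_upto_hom: "k \<le> j \<Longrightarrow> comp_upto \<alpha> k \<in> cstar_hom (A 1) (A (k+1))"
proof (induction k)
  case 0
  show ?case
    by (rule cstar_homI) simp_all
next
  case (Suc k)
  have h: "comp_upto \<alpha> k \<in> cstar_hom (A 1) (A (Suc k))" and g: "\<alpha> (Suc k) \<in> cstar_hom (A (Suc k)) (A (Suc (k + 1)))"
    using Suc morphism[of "Suc k"] by (simp_all add: Suc_eq_plus1)
  show ?case
    by (rule cstar_homI) (simp_all add: cstar_homD[OF h] cstar_homD[OF g])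
qed

lemma comp_upto_hom': "k \<in> {1..j+1} \<Longrightarrow> comp_upto \<alpha> (k-1) \<in> cstar_hom (A 1) (A k)"
  using comp_upto_hom[of "k-1"] by (cases k) (simp_all add: Suc_eq_plus1)

lemma telescope_carrier:
  "x \<in> carrier T \<longleftrightarrow> fst x \<in> carrier (A 1) \<and> snd x \<in> extensional {2..j+1} \<and>
     (\<forall>k\<in>{2..j+1}. snd x k \<in> carrier (interval_alg (A k))) \<and>
     (\<forall>k\<in>{2..j+1}. snd x k 1 = comp_upto \<alpha> (k-1) (fst x))"
proof -
  have "(\<forall>k\<in>{1..j}. snd x (k+1) 1 = comp_upto \<alpha> k (fst x)) \<longleftrightarrow>
      (\<forall>k\<in>Suc ` {1..j}. snd x k 1 = comp_upto \<alpha> (k-1) (fst x))"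
    by (simp only: ball_simps) (simp add: Suc_eq_plus1)
  also have "Suc ` {1..j} = {2..j+1}"
    by (simp add: image_Suc_atLeastAtMost numeral_2_eq_2 One_nat_def)
  finally show ?thesis
    by (cases x) (auto simp: telescope_def prod_alg_def direct_sum_alg_def PiE_iff)
qed

lemma telescope_operations:
  "\<zero>\<^bsub>T\<^esub> = tele_family j \<zero>\<^bsub>A 1\<^esub> (\<lambda>k t. \<zero>\<^bsub>A k\<^esub>)"
  "x \<oplus>\<^bsub>T\<^esub> y = tele_family j (fst x \<oplus>\<^bsub>A 1\<^esub> fst y) (\<lambda>k t. snd x k t \<oplus>\<^bsub>A k\<^esub> snd y k t)"
  "x \<otimes>\<^bsub>T\<^esub> y = tele_family j (fst x \<otimes>\<^bsub>A 1\<^esub> fst y) (\<lambda>k t. snd x k t \<otimes>\<^bsub>A k\<^esub> snd y k t)"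
  "c \<odot>\<^bsub>T\<^esub> x = tele_family j (c \<odot>\<^bsub>A 1\<^esub> fst x) (\<lambda>k t. c \<odot>\<^bsub>A k\<^esub> snd x k t)"
  "star T x = tele_family j (star (A 1) (fst x)) (\<lambda>k t. star (A k) (snd x k t))"
  by (simp_all add: telescope_def prod_alg_def direct_sum_alg_def interval_alg_def tele_family_def
      Let_def case_prod_unfold cong: restrict_cong)

lemma tele_family_closed:
  assumes "a \<in> carrier (A 1)"
    and "\<And>k. k \<in> {2..j+1} \<Longrightarrow> (\<lambda>t\<in>{0..1}. g k t) \<in> carrier (interval_alg (A k))"
    and "\<And>k. k \<in> {2..j+1} \<Longrightarrow> g k 1 = comp_upto \<alpha> (k-1) a"
  shows "tele_family j a g \<in> carrier T"
  using assms by (simp add: telescope_carrier tele_family_def)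

lemma tele_ev_closed:
  assumes "k \<in> {1..j+1}" "t \<in> {0..1}" "x \<in> carrier T"
  shows "tele_ev (k, t) x \<in> carrier (A k)"
  using assms interval_algD(1)[OF algebra, of k "snd x k" t] by (auto simp: tele_ev_def telescope_carrier)

lemma tele_ev_interval:
  assumes k: "k \<in> {1..j+1}" and x: "x \<in> carrier T"
  shows "(\<lambda>t\<in>{0..1}. tele_ev (k, t) x) \<in> carrier (interval_alg (A k))"
proof (cases "k = 1")
  case True
  then show ?thesis
    using x interval_alg_const[OF algebra[OF k]] by (simp add: tele_ev_def telescope_carrier)
next
  case False
  then have f: "snd x k \<in> carrier (interval_alg (A k))"
    using x k by (auto simp: telescope_carrier)
  have "(\<lambda>t\<in>{0..1}. tele_ev (k, t) x) = snd x k"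
    using False interval_algD(2)[OF algebra[OF k] f]
    by (auto simp: tele_ev_def extensional_def restrict_def)
  then show ?thesis
    using f by simp
qed

lemma tele_ev_endpoint:
  assumes "k \<in> {1..j+1}" "x \<in> carrier T"
  shows "tele_ev (k, 1) x = comp_upto \<alpha> (k-1) (fst x)"
  using assms by (auto simp: tele_ev_def telescope_carrier)

lemma tele_ev_inject:
  assumes x: "x \<in> carrier T" and y: "y \<in> carrier T"
    and eq: "\<And>i. i \<in> I \<Longrightarrow> tele_ev i x = tele_ev i y"
  shows "x = y"
proof (rule prod_eqI)
  show "fst x = fst y"
    using eq[of "(1, 0)"] by (simp add: tele_ev_def)
  show "snd x = snd y"
  proof (rule extensionalityI[of _ "{2..j+1}"])
    fix k
    assume k: "k \<in> {2..j+1}"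
    have "snd x k \<in> carrier (interval_alg (A k))" "snd y k \<in> carrier (interval_alg (A k))"
      using x y k by (auto simp: telescope_carrier)
    then have "snd x k \<in> extensional {0..1}" "snd y k \<in> extensional {0..1}"
      using k interval_algD(2)[OF algebra, of k] by simp_all
    moreover have "snd x k t = snd y k t" if "t \<in> {0..1}" for t
      using eq[of "(k, t)"] k that by (simp add: tele_ev_def)
    ultimately show "snd x k = snd y k"
      by (rule extensionalityI)
  qed (use x y in \<open>auto simp: telescope_carrier\<close>)
qed

lemma star_algebra_A: "k \<in> {1..j+1} \<Longrightarrow> star_algebra (A k)"
proof -
  assume "k \<in> {1..j+1}"
  then interpret cstar_algebra "A k"
    by (rule algebra)
  show "star_algebra (A k)"
    by unfold_locales
qed

lemma telescope_closed:
  shows "\<zero>\<^bsub>T\<^esub> \<in> carrier T"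
    and "\<lbrakk>x \<in> carrier T; y \<in> carrier T\<rbrakk> \<Longrightarrow> x \<oplus>\<^bsub>T\<^esub> y \<in> carrier T"
    and "\<lbrakk>x \<in> carrier T; y \<in> carrier T\<rbrakk> \<Longrightarrow> x \<otimes>\<^bsub>T\<^esub> y \<in> carrier T"
    and "x \<in> carrier T \<Longrightarrow> c \<odot>\<^bsub>T\<^esub> x \<in> carrier T"
    and "x \<in> carrier T \<Longrightarrow> star T x \<in> carrier T"
proof -
  interpret A1: cstar_algebra "A 1"
    by (rule algebra) simp
  have hom: "comp_upto \<alpha> (k-1) \<in> cstar_hom (A 1) (A k)" if "k \<in> {2..j+1}" for k
    using that by (intro comp_upto_hom') simp
  note A1_closed = A1.m_closed A1.star_closed A1.normed.scalar_closed A1.M.a_closed A1.M.zero_closed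
  have alg: "cstar_algebra (A k)" if "k \<in> {2..j+1}" for k
    using that algebra by simp
  show "\<zero>\<^bsub>T\<^esub> \<in> carrier T"
    unfolding telescope_operations
  proof (rule tele_family_closed)
    fix k
    assume k: "k \<in> {2..j+1}"
    then have "comp_upto \<alpha> (k-1) \<zero>\<^bsub>A 1\<^esub> = \<zero>\<^bsub>A k\<^esub>"
      by (intro cstar_hom_zero[OF _ _ comp_upto_hom'] star_algebra_A) auto
    then show "\<zero>\<^bsub>A k\<^esub> = comp_upto \<alpha> (k-1) \<zero>\<^bsub>A 1\<^esub>" ..
    interpret cstar_algebra "A k"
      by (rule alg[OF k])
    show "(\<lambda>t\<in>{0..1}. \<zero>\<^bsub>A k\<^esub>) \<in> carrier (interval_alg (A k))"
      by (intro interval_alg_const alg[OF k]) simp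
  qed (rule A1.M.zero_closed)
  assume x: "x \<in> carrier T"
  then have fx: "fst x \<in> carrier (A 1)"
      "\<And>k. k \<in> {2..j+1} \<Longrightarrow> snd x k \<in> carrier (interval_alg (A k))"
      "\<And>k. k \<in> {2..j+1} \<Longrightarrow> snd x k 1 = comp_upto \<alpha> (k-1) (fst x)"
    by (simp_all add: telescope_carrier)
  show "c \<odot>\<^bsub>T\<^esub> x \<in> carrier T" "star T x \<in> carrier T"
    unfolding telescope_operations
    by (rule tele_family_closed; simp add: fx A1_closed interval_alg_closed(3,4)[OF alg fx(2) fx(2)]
          cstar_homD[OF hom])+
  assume y: "y \<in> carrier T"
  then have fy: "fst y \<in> carrier (A 1)"
      "\<And>k. k \<in> {2..j+1} \<Longrightarrow> snd y k \<in> carrier (interval_alg (A k))"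
      "\<And>k. k \<in> {2..j+1} \<Longrightarrow> snd y k 1 = comp_upto \<alpha> (k-1) (fst y)"
    by (simp_all add: telescope_carrier)
  show "x \<oplus>\<^bsub>T\<^esub> y \<in> carrier T" "x \<otimes>\<^bsub>T\<^esub> y \<in> carrier T"
    unfolding telescope_operations
    by (rule tele_family_closed; simp add: fx fy A1_closed interval_alg_closed(1,2)[OF alg fx(2) fy(2)]
          cstar_homD[OF hom])+
qed

lemma tele_ev_bounded:
  assumes x: "x \<in> carrier T"
  shows "bdd_above ((\<lambda>i. cnorm (A (fst i)) (tele_ev i x)) ` I)"
proof -
  have "(\<lambda>i. cnorm (A (fst i)) (tele_ev i x)) ` I =
      (\<Union>k\<in>{1..j+1}. (\<lambda>t. cnorm (A k) (tele_ev (k, t) x)) ` {0..1})"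
    by force
  moreover have "bdd_above ((\<lambda>t. cnorm (A k) (tele_ev (k, t) x)) ` {0..1})" if "k \<in> {1..j+1}" for k
  proof -
    have "(\<lambda>t. cnorm (A k) ((\<lambda>t\<in>{0..1}. tele_ev (k, t) x) t)) ` {0..1} =
        (\<lambda>t. cnorm (A k) (tele_ev (k, t) x)) ` {0..1}"
      by (rule image_cong) auto
    then show ?thesis
      using interval_alg_bounded[OF algebra[OF that] tele_ev_interval[OF that x]] by simp
  qed
  ultimately show ?thesis
    by (simp add: bdd_above_UN)
qed

sublocale evaluation_family T I "\<lambda>i. A (fst i)" tele_ev
proof (rule evaluation_family.intro)
  show "I \<noteq> {}"
    by auto
  fix i :: "nat \<times> real"
  assume i: "i \<in> I"
  then show "cstar_algebra (A (fst i))"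
    by (auto intro: algebra)
  fix x
  assume "x \<in> carrier T"
  then show "tele_ev i x \<in> carrier (A (fst i))"
    using i tele_ev_closed[of "fst i" "snd i" x] by auto
qed (use telescope_closed tele_ev_inject tele_ev_bounded in
    \<open>auto simp: telescope_operations tele_ev_family\<close>, simp_all add: tele_ev_def)

text \<open>
  By the end condition all functions of such an element vanish at \<open>1\<close>.
\<close>

definition end_ideal :: "('a \<times> (nat \<Rightarrow> real \<Rightarrow> 'a)) set" where
  "end_ideal = {x \<in> carrier T. fst x = \<zero>\<^bsub>A 1\<^esub>}"

lemma end_ideal_ev_endpoint:
  assumes "x \<in> end_ideal" "k \<in> {1..j+1}"
  shows "tele_ev (k, 1) x = \<zero>\<^bsub>A k\<^esub>"
proof -
  have "comp_upto \<alpha> (k-1) \<zero>\<^bsub>A 1\<^esub> = \<zero>\<^bsub>A k\<^esub>"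
    using assms by (intro cstar_hom_zero[OF _ _ comp_upto_hom'] star_algebra_A) simp_all
  then show ?thesis
    using assms by (simp add: end_ideal_def tele_ev_endpoint)
qed

text \<open>
  The uniform limit of continuous functions that vanish at \<open>1\<close> is such a function again, and with first
  coordinate zero it satisfies the end condition because *-homomorphisms map zero to zero.
\<close>

lemma end_ideal_complete: "norm_complete T sup_norm end_ideal"
  unfolding norm_complete_def
proof (intro allI impI)
  fix \<sigma> :: "nat \<Rightarrow> 'a \<times> (nat \<Rightarrow> real \<Rightarrow> 'a)"
  assume \<sigma>: "range \<sigma> \<subseteq> end_ideal"
    and Cauchy: "\<forall>\<epsilon>>0. \<exists>M. \<forall>m\<ge>M. \<forall>n\<ge>M. sup_norm (\<sigma> m \<ominus>\<^bsub>T\<^esub> \<sigma> n) < \<epsilon>"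
  have \<sigma>J: "\<sigma> n \<in> end_ideal" and \<sigma>T: "\<sigma> n \<in> carrier T" for n
    using \<sigma> by (auto simp: end_ideal_def)
  have "\<exists>M. \<forall>m\<ge>M. \<forall>n\<ge>M. sup_norm (\<sigma> m \<ominus>\<^bsub>T\<^esub> \<sigma> n) < \<epsilon>" if "\<epsilon> > 0" for \<epsilon>
    using Cauchy that by blast
  from sup_norm_Cauchy_pointwise[of \<sigma>, OF \<sigma>T this]
  obtain l where l: "\<And>i. i \<in> I \<Longrightarrow> l i \<in> carrier (A (fst i))"
    and lim: "\<And>i. i \<in> I \<Longrightarrow> (\<lambda>n. cnorm (A (fst i)) (tele_ev i (\<sigma> n) \<ominus>\<^bsub>A (fst i)\<^esub> l i)) \<longlonglongrightarrow> 0"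
    and uniform: "\<And>\<epsilon>. \<epsilon> > 0 \<Longrightarrow>
      \<exists>M. \<forall>m\<ge>M. \<forall>i\<in>I. cnorm (A (fst i)) (tele_ev i (\<sigma> m) \<ominus>\<^bsub>A (fst i)\<^esub> l i) \<le> \<epsilon>"
    by metis
  have zero: "l i = \<zero>\<^bsub>A (fst i)\<^esub>" if i: "i \<in> I" and ev: "\<And>n. tele_ev i (\<sigma> n) = \<zero>\<^bsub>A (fst i)\<^esub>" for i
  proof -
    interpret cstar_algebra "A (fst i)"
      by (rule B[OF i])
    have "(\<lambda>n::nat. cnorm (A (fst i)) (\<zero>\<^bsub>A (fst i)\<^esub> \<ominus>\<^bsub>A (fst i)\<^esub> l i)) \<longlonglongrightarrow> 0"
      using lim[OF i] by (simp add: ev)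
    moreover have "\<zero>\<^bsub>A (fst i)\<^esub> \<ominus>\<^bsub>A (fst i)\<^esub> \<zero>\<^bsub>A (fst i)\<^esub> = \<zero>\<^bsub>A (fst i)\<^esub>"
      by (simp add: normed.diff_eq_zero_iff)
    ultimately show ?thesis
      by (intro normed.norm_limit_unique[of "\<lambda>_. \<zero>\<^bsub>A (fst i)\<^esub>", OF _ l[OF i]]) simp_all
  qed
  define L where "L = tele_family j \<zero>\<^bsub>A 1\<^esub> (\<lambda>k t. l (k, t))"
  have endpoint: "l (k, 1) = \<zero>\<^bsub>A k\<^esub>" if "k \<in> {1..j+1}" for k
    using zero[of "(k, 1)"] that end_ideal_ev_endpoint[OF \<sigma>J that] by simp
  have L: "L \<in> carrier T"
    unfolding L_def
  proof (rule tele_family_closed)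
    interpret cstar_algebra "A 1"
      by (rule algebra) simp
    show "\<zero>\<^bsub>A 1\<^esub> \<in> carrier (A 1)"
      by (rule M.zero_closed)
  next
    fix k
    assume k: "k \<in> {2..j+1}"
    then have k1: "k \<in> {1..j+1}"
      by simp
    have "comp_upto \<alpha> (k-1) \<zero>\<^bsub>A 1\<^esub> = \<zero>\<^bsub>A k\<^esub>"
      using k1 by (intro cstar_hom_zero[OF _ _ comp_upto_hom'] star_algebra_A) simp_all
    then show "l (k, 1) = comp_upto \<alpha> (k-1) \<zero>\<^bsub>A 1\<^esub>"
      using endpoint[OF k1] by simp
    show "(\<lambda>t\<in>{0..1}. l (k, t)) \<in> carrier (interval_alg (A k))"
    proof (rule interval_alg_uniform_limit[OF algebra[OF k1] tele_ev_interval[OF k1 \<sigma>T]])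
      fix \<epsilon> :: real
      assume "\<epsilon> > 0"
      then obtain M where "\<And>i. i \<in> I \<Longrightarrow> cnorm (A (fst i)) (tele_ev i (\<sigma> M) \<ominus>\<^bsub>A (fst i)\<^esub> l i) \<le> \<epsilon>"
        using uniform by blast
      from this[of "(k, _)"] show "\<exists>n. \<forall>t\<in>{0..1}.
          cnorm (A k) ((\<lambda>t\<in>{0..1}. tele_ev (k, t) (\<sigma> n)) t \<ominus>\<^bsub>A k\<^esub> l (k, t)) \<le> \<epsilon>"
        using k1 by (intro exI[of _ M]) simp
    qed (use l k1 in force)
  qed
  have ev_L: "tele_ev i L = l i" if i: "i \<in> I" for i
  proof (cases i)
    case (Pair k t)
    have "l (k, t) = \<zero>\<^bsub>A 1\<^esub>" if "k = 1"
      using zero[OF i] \<sigma>J that Pair by (simp add: end_ideal_def tele_ev_def)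
    then show ?thesis
      using i Pair by (simp add: L_def tele_ev_family)
  qed
  have "(\<lambda>n. sup_norm (\<sigma> n \<ominus>\<^bsub>T\<^esub> L)) \<longlonglongrightarrow> 0"
    by (rule sup_norm_limit[OF \<sigma>T L]) (use uniform ev_L in simp)
  moreover have "L \<in> end_ideal"
    using L by (simp add: end_ideal_def) (simp add: L_def)
  ultimately show "\<exists>l\<in>end_ideal. (\<lambda>n. sup_norm (\<sigma> n \<ominus>\<^bsub>T\<^esub> l)) \<longlonglongrightarrow> 0"
    by blast
qed

lemma fst_telescope_operations [simp]:
  "fst \<zero>\<^bsub>T\<^esub> = \<zero>\<^bsub>A 1\<^esub>" "fst (x \<oplus>\<^bsub>T\<^esub> y) = fst x \<oplus>\<^bsub>A 1\<^esub> fst y" "fst (x \<otimes>\<^bsub>T\<^esub> y) = fst x \<otimes>\<^bsub>A 1\<^esub> fst y"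
  "fst (c \<odot>\<^bsub>T\<^esub> x) = c \<odot>\<^bsub>A 1\<^esub> fst x" "fst (star T x) = star (A 1) (fst x)"
  by (simp_all add: telescope_operations)

lemma end_ideal: "complete_ideal T sup_norm end_ideal"
proof (rule complete_ideal.intro[OF normed_star_algebra complete_ideal_axioms.intro])
  interpret cstar_algebra "A 1"
    by (rule algebra) simp
  show "end_ideal \<subseteq> carrier T"
    by (auto simp: end_ideal_def)
  show "\<zero>\<^bsub>T\<^esub> \<in> end_ideal"
    by (simp add: end_ideal_def telescope_closed)
  show "norm_complete T sup_norm end_ideal"
    by (rule end_ideal_complete)
  fix x c
  assume x: "x \<in> end_ideal"
  then show "c \<odot>\<^bsub>T\<^esub> x \<in> end_ideal"
    by (simp add: end_ideal_def telescope_closed)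
  show "x \<oplus>\<^bsub>T\<^esub> y \<in> end_ideal" if "y \<in> end_ideal" for y
    using x that by (simp add: end_ideal_def telescope_closed)
  fix y
  assume y: "y \<in> carrier T"
  then have "fst y \<in> carrier (A 1)"
    by (simp add: telescope_carrier)
  then show "x \<otimes>\<^bsub>T\<^esub> y \<in> end_ideal" "y \<otimes>\<^bsub>T\<^esub> x \<in> end_ideal"
    using x y by (simp_all add: end_ideal_def telescope_closed)
qed

text \<open>
  The sliding homotopy. Coordinates up to \<open>m\<close> are kept: \<open>m = 1\<close> slides all functions and contracts the
  telescope to \<open>A\<^sub>1\<close>, \<open>m = j\<close> slides only the last function and contracts it to the telescope before.
\<close>

definition flow :: "nat \<Rightarrow> real \<Rightarrow> 'a \<times> (nat \<Rightarrow> real \<Rightarrow> 'a) \<Rightarrow> 'a \<times> (nat \<Rightarrow> real \<Rightarrow> 'a)" where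
  "flow m u x = tele_family j (fst x) (\<lambda>k t. tele_ev (k, if k \<le> m then t else max t u) x)"

lemma fst_flow [simp]: "fst (flow m u x) = fst x"
  by (simp add: flow_def)

lemma tele_ev_flow:
  "\<lbrakk>k \<in> {1..j+1}; t \<in> {0..1}\<rbrakk> \<Longrightarrow>
     tele_ev (k, t) (flow m u x) = tele_ev (k, if k \<le> m then t else max t u) x"
  by (simp add: flow_def tele_ev_family) (simp add: tele_ev_def)

lemma flow_closed:
  assumes u: "u \<in> {0..1}" and x: "x \<in> carrier T"
  shows "flow m u x \<in> carrier T"
  unfolding flow_def
proof (rule tele_family_closed)
  show "fst x \<in> carrier (A 1)"
    using x by (simp add: telescope_carrier)
  fix k
  assume "k \<in> {2..j+1}"
  then have k: "k \<in> {1..j+1}"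
    by simp
  show "tele_ev (k, if k \<le> m then 1 else max 1 u) x = comp_upto \<alpha> (k-1) (fst x)"
  proof -
    have "max 1 u = 1"
      using u by simp
    then show ?thesis
      using tele_ev_endpoint[OF k x] by simp
  qed
  let ?\<tau> = "\<lambda>t. if k \<le> m then t else max t u"
  have "(\<lambda>t\<in>{0..1}. (\<lambda>t\<in>{0..1}. tele_ev (k, t) x) (?\<tau> t)) \<in> carrier (interval_alg (A k))"
    by (rule interval_alg_reparametrize[OF algebra[OF k] tele_ev_interval[OF k x]]) (use u in auto)
  moreover have "(\<lambda>t\<in>{0..1}. (\<lambda>t\<in>{0..1}. tele_ev (k, t) x) (?\<tau> t)) = (\<lambda>t\<in>{0..1}. tele_ev (k, ?\<tau> t) x)"
    using u by (intro restrict_ext) auto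
  ultimately show "(\<lambda>t\<in>{0..1}. tele_ev (k, ?\<tau> t) x) \<in> carrier (interval_alg (A k))"
    by simp
qed

lemma flow_hom:
  assumes u: "u \<in> {0..1}"
  shows "flow m u \<in> cstar_hom T T"
proof -
  have in_I: "(k, if k \<le> m then t else max t u) \<in> I" if "k \<in> {1..j+1}" "t \<in> {0..1}" for k t
    using that u by auto
  note ev = tele_ev_flow ev_add[OF in_I] ev_mult[OF in_I] ev_scalar[OF in_I] ev_star[OF in_I]
    ev_add ev_mult ev_scalar ev_star telescope_closed flow_closed[OF u]
  have eqI: "x = y" if "x \<in> carrier T" "y \<in> carrier T"
    "\<And>k t. \<lbrakk>k \<in> {1..j+1}; t \<in> {0..1}\<rbrakk> \<Longrightarrow> tele_ev (k, t) x = tele_ev (k, t) y" for x y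
    using that by (intro tele_ev_inject[of x y]) auto
  show ?thesis
    by (rule cstar_homI; (rule eqI)?; simp add: ev del: atLeastAtMost_iff)
qed

lemma flow_zero:
  assumes "x \<in> carrier T"
  shows "flow m 0 x = x"
proof (rule tele_ev_inject)
  fix i
  assume "i \<in> I"
  then obtain k t where "i = (k, t)" "k \<in> {1..j+1}" "t \<in> {0..1}"
    by auto
  moreover from this have "max t 0 = t"
    by simp
  ultimately show "tele_ev i (flow m 0 x) = tele_ev i x"
    by (simp add: tele_ev_flow)
qed (use assms flow_closed in auto)

lemma flow_diff_end_ideal:
  assumes "u \<in> {0..1}" "u' \<in> {0..1}" "x \<in> carrier T"
  shows "flow m u x \<ominus>\<^bsub>T\<^esub> flow m u' x \<in> end_ideal"
proof -
  interpret T: star_algebra T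
    by (rule star_algebra)
  interpret cstar_algebra "A 1"
    by (rule algebra) simp
  have i: "(1, 0) \<in> I"
    by simp
  have f: "flow m u x \<in> carrier T" "flow m u' x \<in> carrier T"
    using assms by (auto intro: flow_closed)
  have "fst (flow m u x \<ominus>\<^bsub>T\<^esub> flow m u' x) = fst x \<ominus>\<^bsub>A 1\<^esub> fst x"
    using ev_diff[OF i f] by (simp add: tele_ev_def)
  also have "\<dots> = \<zero>\<^bsub>A 1\<^esub>"
    using assms by (simp add: normed.diff_eq_zero_iff telescope_carrier)
  finally show ?thesis
    using f by (simp add: end_ideal_def)
qed

text \<open>
  The functions are uniformly continuous and finite in number, and \<open>max t u\<close> moves at most as far as \<open>u\<close>.
\<close>

lemma flow_uniformly_continuous:
  assumes x: "x \<in> carrier T" and "\<epsilon> > 0"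
  shows "\<exists>\<delta>>0. \<forall>u\<in>{0..1}. \<forall>u'\<in>{0..1}. \<bar>u - u'\<bar> < \<delta> \<longrightarrow> sup_norm (flow m u x \<ominus>\<^bsub>T\<^esub> flow m u' x) \<le> \<epsilon>"
proof -
  have "\<exists>\<delta>>0. \<forall>s\<in>{0..1}. \<forall>t\<in>{0..1}. \<bar>s - t\<bar> < \<delta> \<longrightarrow>
      cnorm (A k) (tele_ev (k, s) x \<ominus>\<^bsub>A k\<^esub> tele_ev (k, t) x) < \<epsilon>" if k: "k \<in> {1..j+1}" for k
    using interval_algD(3)[OF algebra[OF k] tele_ev_interval[OF k x] \<open>\<epsilon> > 0\<close>] by simp
  then obtain \<delta> where pos: "\<And>k. k \<in> {1..j+1} \<Longrightarrow> \<delta> k > 0"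
    and \<delta>: "\<And>k s t. \<lbrakk>k \<in> {1..j+1}; s \<in> {0..1}; t \<in> {0..1}; \<bar>s - t\<bar> < \<delta> k\<rbrakk> \<Longrightarrow>
      cnorm (A k) (tele_ev (k, s) x \<ominus>\<^bsub>A k\<^esub> tele_ev (k, t) x) < \<epsilon>"
    by metis
  define \<eta> where "\<eta> = Min (\<delta> ` {1..j+1})"
  have \<eta>: "\<eta> > 0" "\<And>k. k \<in> {1..j+1} \<Longrightarrow> \<eta> \<le> \<delta> k"
    using pos by (auto simp: \<eta>_def)
  have "sup_norm (flow m u x \<ominus>\<^bsub>T\<^esub> flow m u' x) \<le> \<epsilon>"
    if u: "u \<in> {0..1}" "u' \<in> {0..1}" "\<bar>u - u'\<bar> < \<eta>" for u u'
  proof (rule sup_norm_le)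
    fix i
    assume i: "i \<in> I"
    obtain k t where kt: "i = (k, t)" "k \<in> {1..j+1}" "t \<in> {0..1}"
      using i by auto
    let ?\<tau> = "\<lambda>u. if k \<le> m then t else max t u"
    have "\<bar>?\<tau> u - ?\<tau> u'\<bar> < \<delta> k" "?\<tau> u \<in> {0..1}" "?\<tau> u' \<in> {0..1}"
      using u kt \<eta>(2)[OF kt(2)] \<eta>(1) by auto
    then have "cnorm (A k) (tele_ev (k, ?\<tau> u) x \<ominus>\<^bsub>A k\<^esub> tele_ev (k, ?\<tau> u') x) < \<epsilon>"
      using kt(2) by (intro \<delta>)
    then show "cnorm (A (fst i)) (tele_ev i (flow m u x \<ominus>\<^bsub>T\<^esub> flow m u' x)) \<le> \<epsilon>"
      using kt ev_diff[OF i flow_closed[OF u(1) x] flow_closed[OF u(2) x]] by (simp add: tele_ev_flow)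
  qed
  then show ?thesis
    using \<eta>(1) by blast
qed

lemma flow_projections_mvn:
  assumes "p \<in> projections (unitization T)"
  shows "(p, map_mat (map_prod (flow m 1) id) p) \<in> mvn_rel (unitization T)"
proof -
  interpret T: star_ring "unitization T"
    by (rule star_algebra.unitization_star_ring[OF star_algebra])
  have "(map_mat (map_prod (flow m 0) id) p, map_mat (map_prod (flow m 1) id) p) \<in> mvn_rel (unitization T)"
    by (rule homotopic_projections_mvn[OF end_ideal flow_hom flow_diff_end_ideal flow_uniformly_continuous assms])
  moreover have "map_mat (map_prod (flow m 0) id) p = p"
  proof (rule eq_matI)
    fix i k
    assume "i < dim_row p" "k < dim_col p"
    then have "p $$ (i, k) \<in> carrier (unitization T)"
      using T.projectionsE[OF assms] by (metis mat_over_iff)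
    then show "map_mat (map_prod (flow m 0) id) p $$ (i, k) = p $$ (i, k)"
      using \<open>i < dim_row p\<close> \<open>k < dim_col p\<close>
      by (auto simp: unitization_def flow_zero mem_Times_iff prod_eq_iff)
  qed simp_all
  ultimately show ?thesis
    by simp
qed

lemma K0_telescope_retract:
  fixes B :: "('b, 'n) cstar_alg_scheme"
  assumes B: "star_algebra B" and s: "s \<in> cstar_hom B T" and r: "r \<in> cstar_hom T B"
    and rs: "\<And>y. y \<in> carrier B \<Longrightarrow> r (s y) = y"
    and sr: "\<And>x. x \<in> carrier T \<Longrightarrow> s (r x) = flow m 1 x"
  shows "K0 B \<cong> K0 T"
proof (rule K0_iso_deformation_retract)
  interpret T: star_ring "unitization T"
    by (rule star_algebra.unitization_star_ring[OF star_algebra])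
  show "star_ring_deformation_retract (unitization B) (unitization T) (map_prod s id) (map_prod r id)"
  proof (rule star_ring_deformation_retract.intro[OF _ _ star_ring_deformation_retract_axioms.intro])
    show "star_ring_hom (unitization B) (unitization T) (map_prod s id)"
      by (rule unitization_hom[OF B star_algebra s])
    show "star_ring_hom (unitization T) (unitization B) (map_prod r id)"
      by (rule unitization_hom[OF star_algebra B r])
    show "map_prod r id (map_prod s id y) = y" if "y \<in> carrier (unitization B)" for y
      using that rs by (auto simp: unitization_def)
    fix p
    assume p: "p \<in> projections (unitization T)"
    have "map_mat (map_prod s id) (map_mat (map_prod r id) p) = map_mat (map_prod (flow m 1) id) p"
    proof (rule eq_matI)
      fix i k
      assume ik: "i < dim_row (map_mat (map_prod (flow m 1) id) p)"
        "k < dim_col (map_mat (map_prod (flow m 1) id) p)"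
      then have "p $$ (i, k) \<in> carrier (unitization T)"
        using T.projectionsE[OF p] by (metis mat_over_iff index_map_mat(2,3))
      then show "map_mat (map_prod s id) (map_mat (map_prod r id) p) $$ (i, k) =
          map_mat (map_prod (flow m 1) id) p $$ (i, k)"
        using ik by (auto simp: unitization_def sr mem_Times_iff prod_eq_iff)
    qed simp_all
    then show "(map_mat (map_prod s id) (map_mat (map_prod r id) p), p) \<in> mvn_rel (unitization T)"
      using flow_projections_mvn[OF p, of m] equivE[OF T.mvn_equiv] by (metis symE)
  qed
qed simp_all

text \<open>
  The section consists of constant functions, and sliding all functions ends there.
\<close>

lemma K0_base_telescope: "K0 (A 1) \<cong> K0 T"
proof (rule K0_telescope_retract)
  let ?s = "\<lambda>a. tele_family j a (\<lambda>k t. comp_upto \<alpha> (k-1) a)"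
  note hom = cstar_homD[OF comp_upto_hom']
  show "star_algebra (A 1)"
    by (rule star_algebra_A) simp
  show "fst \<in> cstar_hom T (A 1)"
    by (rule cstar_homI) (simp_all add: telescope_carrier)
  have s_closed: "?s a \<in> carrier T" if "a \<in> carrier (A 1)" for a
    using that by (intro tele_family_closed interval_alg_const algebra hom(1)) simp_all
  have s_ev: "tele_ev (k, t) (?s a) = comp_upto \<alpha> (k-1) a" if "k \<in> {1..j+1}" "t \<in> {0..1}" for k t a
    by (simp add: tele_ev_family[OF that])
  show "fst (?s a) = a" for a
    by simp
  have eqI: "x = y" if "x \<in> carrier T" "y \<in> carrier T"
    "\<And>k t. \<lbrakk>k \<in> {1..j+1}; t \<in> {0..1}\<rbrakk> \<Longrightarrow> tele_ev (k, t) x = tele_ev (k, t) y" for x y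
    using that by (intro tele_ev_inject[of x y]) auto
  interpret A1: cstar_algebra "A 1"
    by (rule algebra) simp
  show "?s \<in> cstar_hom (A 1) T"
    by (rule cstar_homI; (rule eqI)?;
        simp add: s_closed s_ev hom ev_add ev_mult ev_scalar ev_star telescope_closed
          A1.m_closed A1.star_closed del: atLeastAtMost_iff)
  show "?s (fst x) = flow 1 1 x" if x: "x \<in> carrier T" for x
  proof (rule eqI)
    have "fst x \<in> carrier (A 1)"
      using x by (simp add: telescope_carrier)
    then show "?s (fst x) \<in> carrier T"
      by (rule s_closed)
    show "flow 1 1 x \<in> carrier T"
      using x by (intro flow_closed) auto
    fix k t
    assume kt: "k \<in> {1..j+1}" "t \<in> {0..1::real}"
    have "tele_ev (k, if k \<le> 1 then t else max t 1) x = comp_upto \<alpha> (k-1) (fst x)"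
    proof (cases "k \<le> 1")
      case True
      then show ?thesis
        using kt by (simp add: tele_ev_def)
    next
      case False
      moreover have "max t 1 = 1"
        using kt by simp
      ultimately show ?thesis
        using kt x tele_ev_endpoint[of k x] by simp
    qed
    then show "tele_ev (k, t) (?s (fst x)) = tele_ev (k, t) (flow 1 1 x)"
      using kt by (simp add: s_ev tele_ev_flow)
  qed
qed

end

text \<open>
  The section adds a constant last function. Comparing the two telescopes with each other, rather than
  both with \<open>A\<^sub>1\<close>, leaves no isomorphism to be inverted.
\<close>

lemma K0_telescope_Suc:
  assumes "telescope_data A \<alpha> (j+1)"
  shows "K0 (telescope A \<alpha> j) \<cong> K0 (telescope A \<alpha> (j+1))"
proof -
  interpret S: telescope_data A \<alpha> "j+1"
    by fact
  interpret T: telescope_data A \<alpha> j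
    by (rule telescope_data.intro) (simp_all add: S.algebra S.morphism)
  note hom = cstar_homD[OF S.comp_upto_hom']
  define r where "r x = tele_family j (fst x) (\<lambda>k t. tele_ev (k, t) x)" for x :: "'a \<times> (nat \<Rightarrow> real \<Rightarrow> 'a)"
  let ?g = "\<lambda>y k t. if k \<le> j + 1 then tele_ev (k, t) y else comp_upto \<alpha> (k-1) (fst y)"
  define s where "s y = tele_family (j+1) (fst y) (?g y)" for y
  have r_ev: "tele_ev (k, t) (r x) = tele_ev (k, t) x" if "k \<in> {1..j+1}" "t \<in> {0..1}" for k t x
    unfolding r_def by (simp add: tele_ev_family[OF that]) (simp add: tele_ev_def)
  have s_ev: "tele_ev (k, t) (s y) = ?g y k t" if "k \<in> {1..j+1+1}" "t \<in> {0..1}" for k t y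
    unfolding s_def by (simp add: tele_ev_family[OF that]) (simp add: tele_ev_def)
  have r_fst: "fst (r x) = fst x" for x
    by (simp add: r_def)
  have r_closed: "r x \<in> carrier T.T" if x: "x \<in> carrier S.T" for x
    using x S.tele_ev_interval[OF _ x] S.tele_ev_endpoint[OF _ x]
    unfolding r_def by (intro T.tele_family_closed) (simp_all add: S.telescope_carrier)
  have s_closed: "s y \<in> carrier S.T" if y: "y \<in> carrier T.T" for y
    unfolding s_def
  proof (rule S.tele_family_closed)
    show y1: "fst y \<in> carrier (A 1)"
      using y by (simp add: T.telescope_carrier)
    fix k
    assume k: "k \<in> {2..j+1+1}"
    show "?g y k 1 = comp_upto \<alpha> (k-1) (fst y)"
      using k T.tele_ev_endpoint[OF _ y, of k] by simp
    show "(\<lambda>t\<in>{0..1}. ?g y k t) \<in> carrier (interval_alg (A k))"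
    proof (cases "k \<le> j + 1")
      case True
      then show ?thesis
        using k T.tele_ev_interval[OF _ y, of k] by simp
    next
      case False
      then show ?thesis
        using k hom(1)[of k "fst y"] y1 by (simp add: interval_alg_const S.algebra)
    qed
  qed
  have T_eqI: "x = y" if "x \<in> carrier T.T" "y \<in> carrier T.T"
    "\<And>k t. \<lbrakk>k \<in> {1..j+1}; t \<in> {0..1}\<rbrakk> \<Longrightarrow> tele_ev (k, t) x = tele_ev (k, t) y" for x y
    using that by (intro T.tele_ev_inject[of x y]) auto
  have S_eqI: "x = y" if "x \<in> carrier S.T" "y \<in> carrier S.T"
    "\<And>k t. \<lbrakk>k \<in> {1..j+1+1}; t \<in> {0..1}\<rbrakk> \<Longrightarrow> tele_ev (k, t) x = tele_ev (k, t) y" for x y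
    using that by (intro S.tele_ev_inject[of x y]) auto
  have T_fst: "fst y \<in> carrier (A 1)" if "y \<in> carrier T.T" for y
    using that by (simp add: T.telescope_carrier)
  show ?thesis
  proof (rule S.K0_telescope_retract[where s = s and r = r and m = "j+1"])
    show "star_algebra T.T"
      by (rule T.star_algebra)
    show "r \<in> cstar_hom S.T T.T"
      by (rule cstar_homI; (rule T_eqI)?;
          simp add: r_closed r_ev T.ev_add T.ev_mult T.ev_scalar T.ev_star T.telescope_closed
            S.ev_add S.ev_mult S.ev_scalar S.ev_star S.telescope_closed)
    show "s \<in> cstar_hom T.T S.T"
      by (rule cstar_homI; (rule S_eqI)?;
          simp add: s_closed s_ev T.ev_add T.ev_mult T.ev_scalar T.ev_star T.telescope_closed
            S.ev_add S.ev_mult S.ev_scalar S.ev_star S.telescope_closed hom T_fst)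
    show "r (s y) = y" if "y \<in> carrier T.T" for y
      by (rule T_eqI) (use that in \<open>simp_all add: r_closed s_closed r_ev s_ev\<close>)
    show "s (r x) = S.flow (j+1) 1 x" if x: "x \<in> carrier S.T" for x
    proof (rule S_eqI)
      show "s (r x) \<in> carrier S.T" "S.flow (j+1) 1 x \<in> carrier S.T"
        using x by (auto intro!: s_closed r_closed S.flow_closed)
      fix k t
      assume kt: "k \<in> {1..j+1+1}" "t \<in> {0..1::real}"
      show "tele_ev (k, t) (s (r x)) = tele_ev (k, t) (S.flow (j+1) 1 x)"
      proof (cases "k \<le> j + 1")
        case True
        then show ?thesis
          using kt by (simp add: s_ev r_ev S.tele_ev_flow)
      next
        case False
        moreover have "max t 1 = 1"
          using kt by simp
        ultimately show ?thesis
          using kt S.tele_ev_endpoint[OF kt(1) x] by (simp add: s_ev r_fst S.tele_ev_flow)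
      qed
    qed
  qed
qed

declare One_nat_def [simp]

theorem corollary5p4:
  fixes A :: "nat \<Rightarrow> 'a cstar_alg"
    and \<alpha> :: "nat \<Rightarrow> 'a \<Rightarrow> 'a"
    and n :: nat
  assumes "n \<ge> 1"
    and "\<And>k. k \<in> {1..n+1} \<Longrightarrow> cstar_algebra (A k)"
    and "\<And>k. k \<in> {1..n} \<Longrightarrow> \<alpha> k \<in> cstar_hom (A k) (A (k+1))"
  shows "K0 (A 1) \<cong> K0 (telescope A \<alpha> 1) \<and>
    (\<forall>j\<in>{1..<n}. K0 (telescope A \<alpha> j) \<cong> K0 (telescope A \<alpha> (j+1)))"
proof -
  have "telescope_data A \<alpha> j" if "j \<le> n" for j
    by (rule telescope_data.intro) (use assms(2,3) that in auto)
  note data = this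
  have "K0 (A 1) \<cong> K0 (telescope A \<alpha> 1)"
    by (rule telescope_data.K0_base_telescope[OF data[OF \<open>n \<ge> 1\<close>]])
  moreover have "K0 (telescope A \<alpha> j) \<cong> K0 (telescope A \<alpha> (j+1))" if "j \<in> {1..<n}" for j
    using that by (intro K0_telescope_Suc data) auto
  ultimately show ?thesis
    by blast
qed

end
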